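(* Let $X_1,\ldots,X_n$ be i.i.d. real random variables with absolutely continuous distribution function $F$, and $Y_1,\ldots,Y_m$ i.i.d. real random variables with absolutely continuous distribution function $G$, the two samples being independent, where $c_0 n\le m\le n$ for a fixed constant $0<c_0\le 1$. Let $\{\psi_k\}_{k\ge1}$ be either the trigonometric series $\psi_k(z)=\sqrt2\cos(\pi k z)$, or the normalized Legendre polynomials $\psi_k(z)=\frac{\sqrt{2k+1}}{k!}\frac{d^k}{dz^k}(z^2-z)^k$, $z\in[0,1]$, and let $d=d_{n,m}$ satisfy $d=o(n^{1/4})$ in the trigonometric case and $d=o(n^{1/9})$ in the Legendre case. Let $F_n(x)=n^{-1}\sum_{i=1}^n I(X_i\le x)$, $\hat\psi_k=m^{-1}\sum_{j=1}^m\psi_k(F_n(Y_j))$, $\hat\Psi(d)=\sqrt{nm/(n+m)}\max_{1\le k\le d}|\hat\psi_k|$, and for fixed $\alpha\in(0,1)$ let $c_\alpha(d)=\Phi^{-1}(1/2+(1-\alpha)^{1/d}/2)$ and $\Phi^{\rm S}_\alpha(d)=I\{\hat\Psi(d)\ge c_\alpha(d)\}$. Let $\bar n=2(n^{-1}+m^{-1})^{-1}$. Consider the alternative $H^d_1$: the random variable $V=F(Y_1)$ has density on $(0,1)$ $$\rho_\theta(z)=C_d(\theta)\exp\Big\{\sum_{k=1}^d\theta_k\psi_k(z)\Big\},\qquad \{C_d(\theta)\}^{-1}=\int_0^1\exp\Big\{\sum_{k=1}^d\theta_k\psi_k(z)\Big\}dz,$$ for some $\theta=(\theta_1,\ldots,\theta_d)^\intercal$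 with $\max_{1\le k\le d}|\theta_k|=\lambda\sqrt{\log d/\bar n}$, where $\lambda\ge2+\varepsilon$ for some fixed $\varepsilon>0$. Then $$\lim_{n,d\to\infty}P_{H^d_1}\{\Phi^{\rm S}_\alpha(d)=1\}=1.$$
   Context: $\Phi$ denotes the standard normal distribution function. *)

theory Defs
  imports "HOL-Probability.Probability" "HOL-Computational_Algebra.Polynomial"
begin

datatype basis = Trig | Legendre

definition psi :: "basis \<Rightarrow> nat \<Rightarrow> real \<Rightarrow> real" where
  "psi b k z = (case b of
      Trig \<Rightarrow> sqrt 2 * cos (pi * real k * z)
    | Legendre \<Rightarrow> sqrt (2 * real k + 1) / fact k * poly ((pderiv ^^ k) ([:0, -1, 1:] ^ k)) z)"

text \<open>Growth exponent for d: d = o(n^(1/4)) (trigonometric), d = o(n^(1/9)) (Legendre).\<close>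
definition growth_exp :: "basis \<Rightarrow> real" where
  "growth_exp b = (case b of Trig \<Rightarrow> 1/4 | Legendre \<Rightarrow> 1/9)"

definition Phi :: "real \<Rightarrow> real" where
  "Phi x = (LBINT t:{..x}. std_normal_density t)"

definition Phi_inv :: "real \<Rightarrow> real" where
  "Phi_inv p = (THE x. Phi x = p)"

definition emp_cdf :: "nat \<Rightarrow> (nat \<Rightarrow> real) \<Rightarrow> real \<Rightarrow> real" where
  "emp_cdf n X x = (\<Sum>i=1..n. if X i \<le> x then 1 else 0) / real n"

definition psi_hat :: "basis \<Rightarrow> nat \<Rightarrow> nat \<Rightarrow> (nat \<Rightarrow> real) \<Rightarrow> (nat \<Rightarrow> real) \<Rightarrow> nat \<Rightarrow> real" where
  "psi_hat b n m X Y k = (\<Sum>j=1..m. psi b k (emp_cdf n X (Y j))) / real m"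

definition Psi_hat :: "basis \<Rightarrow> nat \<Rightarrow> nat \<Rightarrow> nat \<Rightarrow> (nat \<Rightarrow> real) \<Rightarrow> (nat \<Rightarrow> real) \<Rightarrow> real" where
  "Psi_hat b n m d X Y =
     sqrt (real n * real m / (real n + real m)) * Max ((\<lambda>k. \<bar>psi_hat b n m X Y k\<bar>) ` {1..d})"

definition crit :: "real \<Rightarrow> nat \<Rightarrow> real" where
  "crit \<alpha> d = Phi_inv (1/2 + (1 - \<alpha>) powr (1 / real d) / 2)"

definition test_S :: "basis \<Rightarrow> real \<Rightarrow> nat \<Rightarrow> nat \<Rightarrow> nat \<Rightarrow> (nat \<Rightarrow> real) \<Rightarrow> (nat \<Rightarrow> real) \<Rightarrow> nat" where
  "test_S b \<alpha> n m d X Y = (if Psi_hat b n m d X Y \<ge> crit \<alpha> d then 1 else 0)"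

definition nbar :: "nat \<Rightarrow> nat \<Rightarrow> real" where
  "nbar n m = 2 * inverse (inverse (real n) + inverse (real m))"

definition C_d :: "basis \<Rightarrow> nat \<Rightarrow> (nat \<Rightarrow> real) \<Rightarrow> real" where
  "C_d b d \<theta> = inverse (integral {0..1} (\<lambda>z. exp (\<Sum>k=1..d. \<theta> k * psi b k z)))"

definition rho :: "basis \<Rightarrow> nat \<Rightarrow> (nat \<Rightarrow> real) \<Rightarrow> real \<Rightarrow> real" where
  "rho b d \<theta> z = C_d b d \<theta> * exp (\<Sum>k=1..d. \<theta> k * psi b k z)"

end

theory Submission
  imports Defs "HOL-Real_Asymp.Real_Asymp"
begin

text \<open>
  Write \<open>S = \<Sum> \<theta>\<^sub>k \<psi>\<^sub>k\<close>, \<open>\<tau> = max |\<theta>\<^sub>k|\<close>, \<open>T = \<Sum> |\<theta>\<^sub>k|\<close>, \<open>e\<^sub>k = E \<psi>\<^sub>k(V)\<close>, and let \<open>B\<close>, \<open>L\<close>, \<open>Q\<close> bound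
  \<open>\<psi>\<^sub>k\<close> and its first two derivatives on \<open>[0,1]\<close> for \<open>k \<le> d\<close>.  It suffices to find one index \<open>k\<close> for which
  \<open>|e\<^sub>k|\<close> beats both the critical value, at most \<open>(1 + o(1)) sqrt (2 ln d)\<close> on the scale of the
  statistic, and the mean deviation of \<open>\<psi>\<close>-hat from \<open>e\<^sub>k\<close>.  As \<open>\<lambda>\<close> is not bounded above, \<open>\<theta>\<close> need not be small, and there are
  two cases for a small constant \<open>\<delta>\<close>.

  If \<open>B T \<le> \<delta>\<close>, the density is close to 1, and expanding the exponential gives
  \<open>|e\<^sub>k| \<ge> (1 - 2 \<delta>) \<tau>\<close> for the largest coordinate.  The deviation splits into a conditional sampling
  error given the first sample, a linear term whose influence function is nearly \<open>- \<psi>\<^sub>k(F(x))\<close> and hence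
  has variance of order \<open>1/n\<close>, and a quadratic remainder of order \<open>Q/n\<close>.

  If \<open>B T > \<delta>\<close>, the mean of \<open>S\<close> under the density proportional to \<open>exp (t S)\<close> increases with \<open>t\<close>;
  comparing \<open>t = 1\<close> with \<open>t = \<delta> / (B T)\<close>, where the expansion applies, yields some \<open>|e\<^sub>k| \<ge> \<delta> / (2 B d)\<close>.
  This dominates the crude Lipschitz deviation \<open>B / sqrt m + L / sqrt n\<close> because \<open>L B d = o(sqrt n)\<close>.

  For Legendre polynomials \<open>B\<close>, \<open>L\<close>, \<open>Q\<close> are of order \<open>d\<^bsup>1/2\<^esup>\<close>, \<open>d\<^bsup>5/2\<^esup>\<close>, \<open>d\<^bsup>9/2\<^esup>\<close>; the last one is what
  requires \<open>d = o(n\<^bsup>1/9\<^esup>)\<close>.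
\<close>

section \<open>The trigonometric and Legendre systems\<close>

definition legendre_core :: "nat \<Rightarrow> real poly" where
  "legendre_core k = [:0, -1, 1:] ^ k"

lemma poly_ext_real:
  fixes p q :: "real poly"
  assumes "\<And>x. poly p x = poly q x"
  shows "p = q"
  using assms by (auto simp: poly_eq_poly_eq_iff [symmetric])

text \<open>This is the logarithmic derivative of (x^2 - x)^k cleared of denominators. Every later
  differential equation comes from differentiating it.\<close>

lemma legendre_core_ode_first:
  "[:0, -1, 1:] * pderiv (legendre_core k) = smult (real k) ([:-1, 2:] * legendre_core k)"
proof (cases k)
  case 0
  then show ?thesis by (simp add: legendre_core_def)
next
  case (Suc j)
  have "pderiv [:0, -1, 1::real:] = [:-1, 2:]" by (simp add: pderiv_pCons)
  then show ?thesis
    unfolding Suc legendre_core_def pderiv_power_Suc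
    by (simp add: mult_ac del: mult_pCons_left mult_pCons_right)
qed

text \<open>Differentiating \<open>legendre_core_ode_first\<close> \<open>j + 1\<close> times by
  Leibniz leaves only three orders of derivatives, because x^2 - x has degree 2. The induction does
  this one derivative at a time.\<close>

lemma legendre_core_ode:
  "[:0, -1, 1:] * (pderiv ^^ (j + 2)) (legendre_core k)
     + smult (real j + 1 - real k) ([:-1, 2:] * (pderiv ^^ (j + 1)) (legendre_core k))
     + smult ((real j + 1) * (real j - 2 * real k)) ((pderiv ^^ j) (legendre_core k)) = 0"
proof (induction j)
  have d1: "pderiv [:0, -1, 1::real:] = [:-1, 2:]" by (simp add: pderiv_pCons)
  have d2: "pderiv [:-1, 2::real:] = [:2:]" by (simp add: pderiv_pCons)
  {
    case 0
    let ?y = "legendre_core k"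
    have "pderiv ([:0, -1, 1:] * pderiv ?y) = pderiv (smult (real k) ([:-1, 2:] * ?y))"
      by (simp only: legendre_core_ode_first)
    then have "[:0, -1, 1:] * pderiv (pderiv ?y) + [:-1, 2:] * pderiv ?y
       = smult (real k) ([:-1, 2:] * pderiv ?y + [:2:] * ?y)"
      by (simp only: pderiv_mult pderiv_smult d1 d2 mult.commute add.commute)
    then have "poly ([:0, -1, 1:] * pderiv (pderiv ?y) + [:-1, 2:] * pderiv ?y) x
       = poly (smult (real k) ([:-1, 2:] * pderiv ?y + [:2:] * ?y)) x" for x by simp
    then show ?case
      by (intro poly_ext_real) (simp add: numeral_2_eq_2 algebra_simps)
  next
    case (Suc j)
    define y where "y = (pderiv ^^ j) (legendre_core k)"
    have "pderiv ([:0, -1, 1:] * pderiv (pderiv y)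
       + smult (real j + 1 - real k) ([:-1, 2:] * pderiv y)
       + smult ((real j + 1) * (real j - 2 * real k)) y) = pderiv 0"
      using Suc by (simp add: y_def numeral_2_eq_2)
    then have "[:0, -1, 1:] * pderiv (pderiv (pderiv y)) + [:-1, 2:] * pderiv (pderiv y)
       + smult (real j + 1 - real k) ([:-1, 2:] * pderiv (pderiv y) + [:2:] * pderiv y)
       + smult ((real j + 1) * (real j - 2 * real k)) (pderiv y) = 0"
      by (simp only: pderiv_mult pderiv_smult pderiv_add d1 d2 mult.commute add.commute pderiv_0)
    then have "poly ([:0, -1, 1:] * pderiv (pderiv (pderiv y)) + [:-1, 2:] * pderiv (pderiv y)
       + smult (real j + 1 - real k) ([:-1, 2:] * pderiv (pderiv y) + [:2:] * pderiv y)
       + smult ((real j + 1) * (real j - 2 * real k)) (pderiv y)) x = 0" for x by (simp only: poly_0)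
    then show ?case
      by (intro poly_ext_real) (simp add: y_def [symmetric] numeral_2_eq_2 algebra_simps)
  }
qed

lemma higher_pderiv_eq_0:
  fixes g :: "real poly"
  shows "degree g < k \<Longrightarrow> (pderiv ^^ k) g = 0"
proof (induction k arbitrary: g)
  case 0
  then show ?case by simp
next
  case (Suc k)
  show ?case
  proof (cases "degree g = 0")
    case True
    then have "pderiv g = 0" by (simp add: pderiv_eq_0_iff)
    moreover have "(pderiv ^^ k) (0 :: real poly) = 0" by (induction k) auto
    ultimately show ?thesis by (simp add: funpow_Suc_right del: funpow.simps)
  next
    case False
    then have "degree (pderiv g) < k" using Suc.prems by (simp add: degree_pderiv)
    then show ?thesis using Suc.IH by (simp add: funpow_Suc_right del: funpow.simps)
  qed
qed

lemma degree_higher_pderiv: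
  fixes g :: "real poly"
  shows "degree ((pderiv ^^ k) g) = degree g - k"
  by (induction k) (auto simp: degree_pderiv)

text \<open>Each derivative lowers the order of the root \<open>a\<close> by one and multiplies the
  cofactor at \<open>a\<close> by the current order. The case \<open>i < k\<close> yields vanishing
  boundary terms, the case \<open>i = k\<close> the values at the endpoints.\<close>

lemma higher_pderiv_linear_power_mult:
  fixes g :: "real poly"
  assumes "i \<le> k"
  shows "\<exists>h. (pderiv ^^ i) ([:-a, 1:] ^ k * g) = [:-a, 1:] ^ (k - i) * h
            \<and> poly h a = fact k / fact (k - i) * poly g a"
  using assms
proof (induction i)
  case 0
  then show ?case by auto
next
  case (Suc i)
  then obtain h where h: "(pderiv ^^ i) ([:-a, 1:] ^ k * g) = [:-a, 1:] ^ (k - i) * h"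
    "poly h a = fact k / fact (k - i) * poly g a" by auto
  obtain l where l: "k - i = Suc l" using Suc.prems by (metis Suc_diff_Suc Suc_le_lessD)
  have l': "k - Suc i = l" using l by simp
  have "pderiv [:-a, 1:] = 1" by (simp add: pderiv_pCons)
  then have "(pderiv ^^ Suc i) ([:-a, 1:] ^ k * g)
      = [:-a, 1:] ^ l * (smult (real (Suc l)) h + [:-a, 1:] * pderiv h)"
    unfolding funpow.simps o_apply h(1) l pderiv_mult pderiv_power_Suc
    by (simp add: algebra_simps smult_add_left del: mult_pCons_left mult_pCons_right)
  moreover have "poly (smult (real (Suc l)) h + [:-a, 1:] * pderiv h) a
      = fact k / fact (k - Suc i) * poly g a"
  proof -
    have "real (Suc l) * (fact k / fact (Suc l)) = (fact k / fact l :: real)"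
      by (simp add: fact_Suc del: of_nat_Suc)
    then have "real (Suc l) * (fact k / fact (Suc l) * poly g a) = fact k / fact l * poly g a"
      by (simp only: mult.assoc [symmetric])
    then show ?thesis unfolding l' using h(2) by (simp only: l poly_add poly_smult poly_mult) simp
  qed
  ultimately show ?case unfolding l' by blast
qed

text \<open>The factor belonging to the root 0 or to the root 1 is put first, and the root 0 is
  written \<open>[:-0, 1:]\<close>, so that both forms match
  \<open>[:-a, 1:] ^ k * g\<close>.\<close>

lemma legendre_core_factor:
  "legendre_core k = [:-0, 1:] ^ k * [:-1, 1:] ^ k"
  "legendre_core k = [:-1, 1:] ^ k * [:-0, 1:] ^ k"
proof -
  have "[:0, -1, 1::real:] = [:-0, 1:] * [:-1, 1:]" by simp
  then show "legendre_core k = [:-0, 1:] ^ k * [:-1, 1:] ^ k"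
    unfolding legendre_core_def by (metis power_mult_distrib)
  then show "legendre_core k = [:-1, 1:] ^ k * [:-0, 1:] ^ k"
    by (metis mult.commute)
qed

lemma degree_legendre_core: "degree (legendre_core k) = 2 * k"
  by (simp add: legendre_core_def degree_power_eq)

lemma legendre_core_boundary:
  assumes "i < k"
  shows "poly ((pderiv ^^ i) (legendre_core k)) 0 = 0"
    and "poly ((pderiv ^^ i) (legendre_core k)) 1 = 0"
proof -
  have i: "i \<le> k" "k - i > 0" using assms by auto
  obtain h where "(pderiv ^^ i) (legendre_core k) = [:-0, 1:] ^ (k - i) * h"
    using higher_pderiv_linear_power_mult[OF i(1), of 0 "[:-1, 1:] ^ k"]
    unfolding legendre_core_factor(1) by blast
  then show "poly ((pderiv ^^ i) (legendre_core k)) 0 = 0" using i by simp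
  obtain h where "(pderiv ^^ i) (legendre_core k) = [:-1, 1:] ^ (k - i) * h"
    using higher_pderiv_linear_power_mult[OF i(1), of 1 "[:-0, 1:] ^ k"]
    unfolding legendre_core_factor(2) by blast
  then show "poly ((pderiv ^^ i) (legendre_core k)) 1 = 0" using i by simp
qed

text \<open>The shifted Legendre polynomial P_k(2x - 1), with value 1 at x = 1 and without the
  factor sqrt (2k + 1) that makes it orthonormal.\<close>

definition legendre :: "nat \<Rightarrow> real poly" where
  "legendre k = smult (1 / fact k) ((pderiv ^^ k) (legendre_core k))"

lemma legendre_endpoints: "poly (legendre k) 0 = (-1) ^ k" "poly (legendre k) 1 = 1"
proof -
  have k: "k \<le> k" by simp
  show "poly (legendre k) 0 = (-1) ^ k"
    using higher_pderiv_linear_power_mult[OF k, of 0 "[:-1, 1:] ^ k"]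
    unfolding legendre_def legendre_core_factor(1) by (auto simp: poly_power)
  show "poly (legendre k) 1 = 1"
    using higher_pderiv_linear_power_mult[OF k, of 1 "[:-0, 1:] ^ k"]
    unfolding legendre_def legendre_core_factor(2) by (auto simp: poly_power)
qed

lemma degree_legendre: "degree (legendre k) = k"
  by (simp add: legendre_def degree_higher_pderiv degree_legendre_core)

lemma higher_pderiv_smult:
  fixes p :: "real poly"
  shows "(pderiv ^^ i) (smult c p) = smult c ((pderiv ^^ i) p)"
  by (induction i) (auto simp: pderiv_smult)

text \<open>This is \<open>legendre_core_ode\<close> with \<open>j = i + k\<close>. Every derivative
  of a Legendre polynomial thus solves an equation of the shape treated by
  \<open>sonin_bound\<close>, with a = i + 1 and c = (k + i + 1)(k - i).\<close>

lemma legendre_ode: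
  "(x\<^sup>2 - x) * poly ((pderiv ^^ (i + 2)) (legendre k)) x
     + (real i + 1) * (2 * x - 1) * poly ((pderiv ^^ (i + 1)) (legendre k)) x
     - (real k + real i + 1) * (real k - real i) * poly ((pderiv ^^ i) (legendre k)) x = 0"
proof -
  let ?D = "\<lambda>j. (pderiv ^^ j) (legendre_core k)"
  have D: "(pderiv ^^ j) (legendre k) = smult (1 / fact k) (?D (j + k))" for j
    by (simp add: legendre_def higher_pderiv_smult funpow_add)
  have "poly ([:0, -1, 1:] * ?D (i + k + 2)
     + smult (real (i + k) + 1 - real k) ([:-1, 2:] * ?D (i + k + 1))
     + smult ((real (i + k) + 1) * (real (i + k) - 2 * real k)) (?D (i + k))) x = 0"
    by (simp only: legendre_core_ode poly_0)
  then have *: "(x\<^sup>2 - x) * poly (?D (i + k + 2)) x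
     + (real i + 1) * (2 * x - 1) * poly (?D (i + k + 1)) x
     - (real k + real i + 1) * (real k - real i) * poly (?D (i + k)) x = 0"
    by (simp add: power2_eq_square algebra_simps)
  have "(x\<^sup>2 - x) * (1 / fact k * poly (?D (i + k + 2)) x)
     + (real i + 1) * (2 * x - 1) * (1 / fact k * poly (?D (i + k + 1)) x)
     - (real k + real i + 1) * (real k - real i) * (1 / fact k * poly (?D (i + k)) x)
     = 1 / fact k * ((x\<^sup>2 - x) * poly (?D (i + k + 2)) x
     + (real i + 1) * (2 * x - 1) * poly (?D (i + k + 1)) x
     - (real k + real i + 1) * (real k - real i) * poly (?D (i + k)) x)"
    by (simp only: algebra_simps)
  also have "\<dots> = 0" using * by simp
  finally show ?thesis unfolding D poly_smult by (simp only: ac_simps)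
qed

section \<open>Uniform bounds by the Sonin function\<close>

text \<open>The Sonin function \<open>c H\<^sup>2 + (x - x\<^sup>2) H'\<^sup>2\<close> decreases on \<open>[0, 1/2]\<close>, increases on
  \<open>[1/2, 1]\<close> and equals \<open>c H\<^sup>2\<close> at the endpoints.\<close>
lemma sonin_bound:
  fixes H :: "real poly"
  assumes ode: "\<And>x. (x\<^sup>2 - x) * poly (pderiv (pderiv H)) x + a * (2 * x - 1) * poly (pderiv H) x
      - c * poly H x = 0"
    and a: "a \<ge> 1" and c: "c > 0"
    and M: "\<bar>poly H 0\<bar> \<le> M" "\<bar>poly H 1\<bar> \<le> M"
    and x: "x \<in> {0..1}"
  shows "\<bar>poly H x\<bar> \<le> M"
proof -
  define f where "f x = c * (poly H x)\<^sup>2 + (x - x\<^sup>2) * (poly (pderiv H) x)\<^sup>2" for x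
  \<comment> \<open>The derivative of \<open>f\<close> once the second derivative of
    \<open>H\<close> has been eliminated through the equation. As \<open>a \<ge> 1\<close>, it is a
    nonnegative multiple of 2x - 1.\<close>
  define f' where "f' x = (2 * x - 1) * ((2 * a - 1) * (poly (pderiv H) x)\<^sup>2)" for x
  have der: "(f has_real_derivative f' y) (at y)" for y
  proof -
    let ?h = "poly H y" and ?h1 = "poly (pderiv H) y" and ?h2 = "poly (pderiv (pderiv H)) y"
    have "(f has_real_derivative (c * (2 * ?h * ?h1) + ((1 - 2 * y) * ?h1\<^sup>2 + (y - y\<^sup>2) * (2 * ?h1 * ?h2)))) (at y)"
      unfolding f_def by (auto intro!: derivative_eq_intros poly_DERIV)
    moreover have "c * (2 * ?h * ?h1) + ((1 - 2 * y) * ?h1\<^sup>2 + (y - y\<^sup>2) * (2 * ?h1 * ?h2)) = f' y"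
    proof -
      have "c * ?h = (y\<^sup>2 - y) * ?h2 + a * (2 * y - 1) * ?h1" using ode[of y] by simp
      moreover have "c * (2 * ?h * ?h1) = 2 * ?h1 * (c * ?h)" by simp
      ultimately have "c * (2 * ?h * ?h1) = 2 * ?h1 * ((y\<^sup>2 - y) * ?h2 + a * (2 * y - 1) * ?h1)"
        by (simp only:)
      then show ?thesis unfolding f'_def by (simp add: algebra_simps power2_eq_square)
    qed
    ultimately show ?thesis by simp
  qed
  have nn: "(2 * a - 1) * (poly (pderiv H) y)\<^sup>2 \<ge> 0" for y using a by simp
  have "f x \<le> f 0 \<or> f x \<le> f 1"
  proof (cases "x \<le> 1/2")
    case True
    have "f x \<le> f 0"
    proof (rule DERIV_nonpos_imp_nonincreasing[of 0 x f])
      show "0 \<le> x" using x by simp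
      fix y assume "0 \<le> y" "y \<le> x"
      then show "\<exists>z. (f has_real_derivative z) (at y) \<and> z \<le> 0"
        using der[of y] nn[of y] True unfolding f'_def
        by (intro exI[of _ "f' y"]) (auto simp: f'_def mult_le_0_iff)
    qed
    then show ?thesis ..
  next
    case False
    have "f x \<le> f 1"
    proof (rule DERIV_nonneg_imp_nondecreasing[of x 1 f])
      show "x \<le> 1" using x by simp
      fix y assume "x \<le> y" "y \<le> 1"
      then show "\<exists>z. (f has_real_derivative z) (at y) \<and> 0 \<le> z"
        using der[of y] nn[of y] False
        by (intro exI[of _ "f' y"]) (auto simp: f'_def zero_le_mult_iff)
    qed
    then show ?thesis ..
  qed
  moreover have "(poly H 0)\<^sup>2 \<le> M\<^sup>2" "(poly H 1)\<^sup>2 \<le> M\<^sup>2"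
    using M power_mono[OF M(1) abs_ge_zero, of 2] power_mono[OF M(2) abs_ge_zero, of 2] by auto
  ultimately have "f x \<le> c * M\<^sup>2"
    using c unfolding f_def by (auto intro: order_trans mult_left_mono)
  moreover have "c * (poly H x)\<^sup>2 \<le> f x"
  proof -
    have "x * x \<le> x" using x by (simp add: mult_left_le)
    then show ?thesis unfolding f_def by (simp add: power2_eq_square)
  qed
  ultimately have "c * (poly H x)\<^sup>2 \<le> c * M\<^sup>2" by linarith
  then have "(poly H x)\<^sup>2 \<le> M\<^sup>2" using c by simp
  then show ?thesis using M(1) by (simp add: abs_le_square_iff [symmetric])
qed

text \<open>At 0 and 1 the leading coefficient x^2 - x vanishes, so the equation becomes a recursion
  from one derivative to the next; there |2x - 1| = 1.\<close>

lemma legendre_deriv_endpoints: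
  assumes "i \<le> k" "\<bar>poly ((pderiv ^^ i) (legendre k)) x\<bar> \<le> M" "x = 0 \<or> x = 1"
  shows "\<bar>poly ((pderiv ^^ Suc i) (legendre k)) x\<bar> \<le> (real k + real i + 1) * (real k - real i) / (real i + 1) * M"
proof -
  let ?c = "(real k + real i + 1) * (real k - real i)"
  have c: "?c \<ge> 0" using assms by simp
  have "(real i + 1) * \<bar>poly ((pderiv ^^ Suc i) (legendre k)) x\<bar> = \<bar>?c * poly ((pderiv ^^ i) (legendre k)) x\<bar>"
  proof -
    have "(real i + 1) * (2 * x - 1) * poly ((pderiv ^^ Suc i) (legendre k)) x
        = ?c * poly ((pderiv ^^ i) (legendre k)) x"
      using legendre_ode[of x i k] assms(3) by auto
    then have "\<bar>(real i + 1) * (2 * x - 1)\<bar> * \<bar>poly ((pderiv ^^ Suc i) (legendre k)) x\<bar>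
        = \<bar>?c * poly ((pderiv ^^ i) (legendre k)) x\<bar>"
      by (simp only: abs_mult [symmetric])
    moreover have "\<bar>(real i + 1) * (2 * x - 1)\<bar> = real i + 1" using assms(3) by auto
    ultimately show ?thesis by (simp only:)
  qed
  also have "\<dots> \<le> ?c * M" unfolding abs_mult[of ?c] abs_of_nonneg[OF c] by (intro mult_left_mono c assms(2))
  finally show ?thesis by (simp add: field_simps)
qed

text \<open>Below the top order the Sonin argument applies. For \<open>i = k\<close> its constant c
  would be 0, but then the derivative is a constant polynomial.\<close>

lemma legendre_deriv_bound:
  assumes "i \<le> k" "x \<in> {0..1}"
    "\<bar>poly ((pderiv ^^ i) (legendre k)) 0\<bar> \<le> M" "\<bar>poly ((pderiv ^^ i) (legendre k)) 1\<bar> \<le> M"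
  shows "\<bar>poly ((pderiv ^^ i) (legendre k)) x\<bar> \<le> M"
proof (cases "i = k")
  case True
  then have "degree ((pderiv ^^ i) (legendre k)) = 0"
    by (simp add: degree_higher_pderiv degree_legendre)
  then obtain u where "(pderiv ^^ i) (legendre k) = [:u:]" by (metis degree_eq_zeroE)
  then show ?thesis using assms by simp
next
  case False
  show ?thesis
  proof (rule sonin_bound[where a = "real i + 1" and c = "(real k + real i + 1) * (real k - real i)"])
    show "(real k + real i + 1) * (real k - real i) > 0" using False assms(1) by simp
  qed (use legendre_ode[of _ i k] assms in \<open>auto simp: numeral_2_eq_2\<close>)
qed

lemma legendre_bounds:
  assumes "k \<ge> 1" "x \<in> {0..1}"
  shows "\<bar>poly (legendre k) x\<bar> \<le> 1"
    and "\<bar>poly (pderiv (legendre k)) x\<bar> \<le> (real k + 1) * real k"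
    and "\<bar>poly (pderiv (pderiv (legendre k))) x\<bar> \<le> ((real k + 1) * real k)\<^sup>2"
proof -
  define M2 where "M2 = (real k + 2) * (real k - 1) / 2 * ((real k + 1) * real k)"
  have e0: "\<bar>poly ((pderiv ^^ 0) (legendre k)) z\<bar> \<le> 1" if "z = 0 \<or> z = 1" for z :: real
    using that legendre_endpoints[of k] by auto
  have e1: "\<bar>poly ((pderiv ^^ Suc 0) (legendre k)) z\<bar> \<le> (real k + 1) * real k" if "z = 0 \<or> z = 1" for z :: real
    using legendre_deriv_endpoints[OF _ e0[OF that] that] by simp
  have e2: "\<bar>poly ((pderiv ^^ Suc (Suc 0)) (legendre k)) z\<bar> \<le> M2" if "z = 0 \<or> z = 1" for z :: real
    using legendre_deriv_endpoints[OF _ e1[OF that] that] assms by (simp add: M2_def add.commute)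
  show "\<bar>poly (legendre k) x\<bar> \<le> 1"
    using legendre_deriv_bound[of 0 k x 1] e0[of 0] e0[of 1] assms by simp
  show "\<bar>poly (pderiv (legendre k)) x\<bar> \<le> (real k + 1) * real k"
    using legendre_deriv_bound[of "Suc 0" k x "(real k + 1) * real k"] e1[of 0] e1[of 1] assms by simp
  have "\<bar>poly (pderiv (pderiv (legendre k))) x\<bar> \<le> M2"
  proof (cases "k = 1")
    case True
    then have "(pderiv ^^ 2) (legendre k) = 0"
      by (intro higher_pderiv_eq_0) (simp add: degree_legendre)
    then show ?thesis using assms by (simp add: M2_def numeral_2_eq_2)
  next
    case False
    then show ?thesis
      using legendre_deriv_bound[of "Suc (Suc 0)" k x M2] e2[of 0] e2[of 1] assms by simp
  qed
  also have "M2 \<le> ((real k + 1) * real k)\<^sup>2"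
    unfolding M2_def power2_eq_square
    by (intro mult_right_mono) (use assms in \<open>auto simp: algebra_simps\<close>)
  finally show "\<bar>poly (pderiv (pderiv (legendre k))) x\<bar> \<le> ((real k + 1) * real k)\<^sup>2" .
qed

section \<open>Orthogonality and norm of the Legendre polynomials\<close>

lemma poly_integrable_on: "(\<lambda>x::real. poly p x) integrable_on {a..b}"
  by (intro integrable_continuous_interval continuous_intros)

lemma has_integral_poly_pderiv:
  "((\<lambda>x. poly (pderiv p) x) has_integral (poly p 1 - poly p 0)) {0..1::real}"
proof (rule fundamental_theorem_of_calculus)
  fix x :: real
  show "(poly p has_vector_derivative poly (pderiv p) x) (at x within {0..1})"
    unfolding has_real_derivative_iff_has_vector_derivative [symmetric]
    by (rule has_field_derivative_at_within[OF poly_DERIV])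
qed simp

lemma integral_poly_by_parts:
  fixes f g :: "real poly"
  assumes "poly f 0 = 0" "poly f 1 = 0"
  shows "integral {0..1} (\<lambda>x. poly (pderiv f * g) x) = - integral {0..1} (\<lambda>x. poly (f * pderiv g) x)"
proof -
  have "integral {0..1} (poly (pderiv (f * g))) = poly (f * g) 1 - poly (f * g) 0"
    by (rule integral_unique[OF has_integral_poly_pderiv])
  also have "poly (f * g) 1 - poly (f * g) 0 = 0" using assms by simp
  also have "poly (pderiv (f * g)) = (\<lambda>x. poly (pderiv f * g) x + poly (f * pderiv g) x)"
    by (simp add: pderiv_mult fun_eq_iff)
  also have "integral {0..1} \<dots> = integral {0..1} (\<lambda>x. poly (pderiv f * g) x)
      + integral {0..1} (\<lambda>x. poly (f * pderiv g) x)"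
    by (intro integral_add poly_integrable_on)
  finally show ?thesis by linarith
qed

text \<open>Integrating by parts \<open>k\<close> times moves all derivatives from the core
  polynomial to \<open>g\<close>, where the \<open>k\<close>-th one is 0. No boundary terms appear
  because the lower derivatives of the core vanish at 0 and 1.\<close>

lemma legendre_orthogonal_lower:
  assumes "degree g < k"
  shows "integral {0..1} (\<lambda>x. poly (legendre k) x * poly g x) = 0"
proof -
  let ?D = "\<lambda>j. (pderiv ^^ j) (legendre_core k)"
  have "j \<le> k \<Longrightarrow> integral {0..1} (\<lambda>x. poly (?D k * g) x)
      = (-1) ^ j * integral {0..1} (\<lambda>x. poly (?D (k - j) * (pderiv ^^ j) g) x)" for j
  proof (induction j)
    case (Suc j)
    then have "?D (k - j) = pderiv (?D (k - Suc j))"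
    proof -
      have "k - j = Suc (k - Suc j)" using Suc.prems by simp
      then show ?thesis by (simp only: funpow.simps o_apply)
    qed
    then show ?case
      using Suc integral_poly_by_parts[OF legendre_core_boundary[of "k - Suc j" k], of "(pderiv ^^ j) g"]
      by (simp del: poly_mult)
  qed simp
  from this[of k] have "integral {0..1} (\<lambda>x. poly (?D k * g) x) = 0"
    using higher_pderiv_eq_0[OF assms] by simp
  then show ?thesis by (simp add: legendre_def)
qed

text \<open>Integrate the derivative of x P^2, which is P^2 + 2x P P'. Since x P' - k P has degree
  below k, it is orthogonal to P, so x P' may be replaced by k P; the boundary value is P(1)^2 =
  1.\<close>

lemma legendre_norm: "(2 * real k + 1) * integral {0..1} (\<lambda>x. poly (legendre k) x * poly (legendre k) x) = 1"
proof -
  let ?P = "legendre k"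
  define g where "g = [:0, 1:] * pderiv ?P - smult (real k) ?P"
  have g0: "integral {0..1} (\<lambda>x. poly ?P x * poly g x) = 0"
  \<comment> \<open>No degree lies below 0, so \<open>k = 0\<close> is separate: there
    \<open>g\<close> itself is 0.\<close>
  proof (cases "k = 0")
    case True
    then have "pderiv ?P = 0" using degree_legendre[of k] by (simp add: pderiv_eq_0_iff)
    then show ?thesis using True by (simp add: g_def)
  next
    case False
    have "coeff g i = 0" if "i \<ge> k" for i
    proof (cases "i = k")
      case True
      then show ?thesis using False by (cases k) (auto simp: g_def coeff_pderiv coeff_pCons)
    next
      case False
      then have "coeff ?P i = 0" using that by (intro coeff_eq_0) (simp add: degree_legendre)
      then show ?thesis by (cases i) (auto simp: g_def coeff_pderiv coeff_pCons)
    qed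
    then have "degree g < k"
      using False by (metis degree_le leI le_degree leading_coeff_0_iff degree_0 neq0_conv)
    then show ?thesis by (rule legendre_orthogonal_lower)
  qed
  have "((\<lambda>x. poly (pderiv ([:0, 1:] * ?P * ?P)) x) has_integral
      (poly ([:0, 1:] * ?P * ?P) 1 - poly ([:0, 1:] * ?P * ?P) 0)) {0..1}"
    by (rule has_integral_poly_pderiv)
  then have "integral {0..1} (\<lambda>x. poly (pderiv ([:0, 1:] * ?P * ?P)) x) = 1"
    by (simp add: integral_unique legendre_endpoints)
  moreover have "poly (pderiv ([:0, 1:] * ?P * ?P)) x
      = (2 * real k + 1) * (poly ?P x * poly ?P x) + 2 * (poly ?P x * poly g x)" for x
    by (simp add: g_def pderiv_mult pderiv_pCons algebra_simps)
  ultimately have "integral {0..1} (\<lambda>x. (2 * real k + 1) * (poly ?P x * poly ?P x) + 2 * (poly ?P x * poly g x)) = 1"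
    by simp
  then show ?thesis
    using g0 by (subst (asm) integral_add) (auto intro!: integrable_continuous_interval continuous_intros)
qed

section \<open>Common bounds and orthonormality of both systems\<close>

lemma psi_Legendre: "psi Legendre k z = sqrt (2 * real k + 1) * poly (legendre k) z"
  by (simp add: psi_def legendre_def legendre_core_def)

text \<open>This and the next two definitions are the bounds B, L and Q. The numerical factors come
  from the crude estimates sqrt 2 \<le> 2, pi \<le> 4 and sqrt (2k + 1) \<le> 2 sqrt d.\<close>

definition psi_bd :: "basis \<Rightarrow> nat \<Rightarrow> real" where
  "psi_bd b d = (case b of Trig \<Rightarrow> 2 | Legendre \<Rightarrow> 2 * sqrt d)"

definition psi_bd1 :: "basis \<Rightarrow> nat \<Rightarrow> real" where
  "psi_bd1 b d = (case b of Trig \<Rightarrow> 8 * real d | Legendre \<Rightarrow> 4 * real d ^ 2 * sqrt d)"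

definition psi_bd2 :: "basis \<Rightarrow> nat \<Rightarrow> real" where
  "psi_bd2 b d = (case b of Trig \<Rightarrow> 32 * real d ^ 2 | Legendre \<Rightarrow> 8 * real d ^ 4 * sqrt d)"

text \<open>The derivatives are obtained as unnamed functions, so that the probabilistic part can
  treat both systems at once. Differentiability holds on the whole line, the bounds only on
  [0,1].\<close>

lemma psi_regular:
  assumes k: "1 \<le> k" "k \<le> d"
  obtains p1 p2 where
    "\<And>x. (psi b k has_real_derivative p1 x) (at x)"
    "\<And>x. (p1 has_real_derivative p2 x) (at x)"
    "\<And>x. x \<in> {0..1} \<Longrightarrow> \<bar>psi b k x\<bar> \<le> psi_bd b d"
    "\<And>x. x \<in> {0..1} \<Longrightarrow> \<bar>p1 x\<bar> \<le> psi_bd1 b d"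
    "\<And>x. x \<in> {0..1} \<Longrightarrow> \<bar>p2 x\<bar> \<le> psi_bd2 b d"
proof (cases b)
  case Trig
  have s2: "sqrt 2 \<le> 2" using sqrt2_less_2 by simp
  have kd: "real k \<le> real d" using k by simp
  have pi4: "pi \<le> 4" using pi_less_4 by simp
  have c1: "sqrt 2 * (pi * real k) \<le> 8 * real d"
  proof -
    have "sqrt 2 * (pi * real k) \<le> 2 * (4 * real d)"
      by (intro mult_mono s2 pi4 kd) auto
    then show ?thesis by simp
  qed
  have c2: "sqrt 2 * (pi * real k)^2 \<le> 32 * real d ^ 2"
  proof -
    have "sqrt 2 * (pi * real k)^2 \<le> 2 * (4 * real d)^2"
      by (intro mult_mono power_mono s2 pi4 kd) auto
    then show ?thesis by (simp add: power_mult_distrib)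
  qed
  show ?thesis
  proof (rule that[of "\<lambda>x. - sqrt 2 * (pi * real k) * sin (pi * real k * x)"
        "\<lambda>x. - sqrt 2 * (pi * real k)^2 * cos (pi * real k * x)"])
    fix x :: real
    show "(psi b k has_real_derivative - sqrt 2 * (pi * real k) * sin (pi * real k * x)) (at x)"
      unfolding psi_def Trig basis.case by (auto intro!: derivative_eq_intros)
    show "((\<lambda>x. - sqrt 2 * (pi * real k) * sin (pi * real k * x)) has_real_derivative
        - sqrt 2 * (pi * real k)^2 * cos (pi * real k * x)) (at x)"
      by (auto intro!: derivative_eq_intros simp: power2_eq_square)
    have "sqrt 2 * \<bar>cos (pi * real k * x)\<bar> \<le> 2 * 1"
      by (intro mult_mono s2) auto
    then show "\<bar>psi b k x\<bar> \<le> psi_bd b d" by (simp add: psi_def psi_bd_def Trig abs_mult)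
    have "sqrt 2 * (pi * real k) * \<bar>sin (pi * real k * x)\<bar> \<le> 8 * real d * 1"
      by (intro mult_mono c1) auto
    then show "\<bar>- sqrt 2 * (pi * real k) * sin (pi * real k * x)\<bar> \<le> psi_bd1 b d"
      by (simp add: psi_bd1_def Trig abs_mult)
    have "sqrt 2 * (pi * real k)^2 * \<bar>cos (pi * real k * x)\<bar> \<le> 32 * real d ^ 2 * 1"
      by (intro mult_mono c2) auto
    then show "\<bar>- sqrt 2 * (pi * real k)^2 * cos (pi * real k * x)\<bar> \<le> psi_bd2 b d"
      by (simp add: psi_bd2_def Trig abs_mult)
  qed
next
  case Legendre
  have kd: "real k \<le> real d" "real d \<ge> 1" using k by simp_all
  have s: "sqrt (2 * real k + 1) \<le> 2 * sqrt d"
  proof -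
    have "sqrt (2 * real k + 1) \<le> sqrt (4 * d)" using kd by (intro real_sqrt_le_mono) simp
    then show ?thesis by (simp add: real_sqrt_mult)
  qed
  have k2: "(real k + 1) * real k \<le> 2 * real d ^ 2"
  proof -
    have "(real k + 1) * real k \<le> (2 * real d) * real d" using kd by (intro mult_mono) auto
    then show ?thesis by (simp add: power2_eq_square)
  qed
  have k4: "((real k + 1) * real k)\<^sup>2 \<le> 4 * real d ^ 4"
  proof -
    have "((real k + 1) * real k)\<^sup>2 \<le> (2 * real d ^ 2)\<^sup>2" by (intro power_mono k2) auto
    then show ?thesis by (simp add: power_mult_distrib)
  qed
  show ?thesis
  proof (rule that[of "\<lambda>x. sqrt (2 * real k + 1) * poly (pderiv (legendre k)) x"
        "\<lambda>x. sqrt (2 * real k + 1) * poly (pderiv (pderiv (legendre k))) x"])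
    fix x :: real
    show "(psi b k has_real_derivative sqrt (2 * real k + 1) * poly (pderiv (legendre k)) x) (at x)"
      unfolding Legendre psi_Legendre[abs_def] by (intro DERIV_cmult poly_DERIV)
    show "((\<lambda>x. sqrt (2 * real k + 1) * poly (pderiv (legendre k)) x) has_real_derivative
        sqrt (2 * real k + 1) * poly (pderiv (pderiv (legendre k))) x) (at x)"
      by (intro DERIV_cmult poly_DERIV)
    assume x: "x \<in> {0..1}"
    note b = legendre_bounds[OF k(1) x]
    have "sqrt (2 * real k + 1) * \<bar>poly (legendre k) x\<bar> \<le> 2 * sqrt d * 1"
      by (intro mult_mono s b) auto
    then show "\<bar>psi b k x\<bar> \<le> psi_bd b d" by (simp add: Legendre psi_Legendre psi_bd_def abs_mult)
    have "sqrt (2 * real k + 1) * \<bar>poly (pderiv (legendre k)) x\<bar> \<le> 2 * sqrt d * (2 * real d ^ 2)"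
      by (intro mult_mono s order_trans[OF b(2) k2]) auto
    then show "\<bar>sqrt (2 * real k + 1) * poly (pderiv (legendre k)) x\<bar> \<le> psi_bd1 b d"
      by (simp add: Legendre psi_bd1_def abs_mult mult_ac)
    have "sqrt (2 * real k + 1) * \<bar>poly (pderiv (pderiv (legendre k))) x\<bar> \<le> 2 * sqrt d * (4 * real d ^ 4)"
      by (intro mult_mono s order_trans[OF b(3) k4]) auto
    then show "\<bar>sqrt (2 * real k + 1) * poly (pderiv (pderiv (legendre k))) x\<bar> \<le> psi_bd2 b d"
      by (simp add: Legendre psi_bd2_def abs_mult mult_ac)
  qed
qed

lemma continuous_on_psi [continuous_intros]: "continuous_on A (psi b k)"
  by (cases b) (auto simp: psi_Legendre[abs_def] psi_def[abs_def] intro!: continuous_intros)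

text \<open>The frequency is an integer and not a natural number, because the product formula for
  cosines produces the difference j - k.\<close>

lemma integral_cos_pi_multiple:
  "integral {0..1} (\<lambda>x. cos (pi * of_int j * x)) = (if j = 0 then 1 else 0)"
proof (cases "j = 0")
  case False
  have "((\<lambda>x. cos (pi * of_int j * x)) has_integral
      (sin (pi * of_int j * 1) / (pi * of_int j) - sin (pi * of_int j * 0) / (pi * of_int j))) {0..1}"
    using False
    by (intro fundamental_theorem_of_calculus)
       (auto simp: has_real_derivative_iff_has_vector_derivative [symmetric]
         intro!: derivative_eq_intros)
  moreover have "sin (pi * of_int j) = 0" by (simp add: sin_zero_iff_int2 mult.commute)
  ultimately show ?thesis using False by (simp add: integral_unique)
qed simp

lemma psi_mean_zero:
  assumes "k \<ge> 1"
  shows "integral {0..1} (psi b k) = 0"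
proof (cases b)
  case Trig
  then show ?thesis using integral_cos_pi_multiple[of "int k"] assms by (simp add: psi_def[abs_def])
next
  case Legendre
  then show ?thesis
    using legendre_orthogonal_lower[of 1 k] assms by (simp add: psi_Legendre[abs_def])
qed

lemma psi_orthonormal:
  assumes "j \<ge> 1" "k \<ge> 1"
  shows "integral {0..1} (\<lambda>x. psi b j x * psi b k x) = (if j = k then 1 else 0)"
proof (cases b)
  case Trig
  have "psi b j x * psi b k x = cos (pi * of_int (int j - int k) * x) + cos (pi * of_int (int j + int k) * x)" for x
  proof -
    have "psi b j x * psi b k x = (sqrt 2 * sqrt 2) * (cos (pi * real j * x) * cos (pi * real k * x))"
      by (simp only: psi_def Trig basis.case mult_ac)
    then show ?thesis by (simp add: cos_times_cos algebra_simps)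
  qed
  moreover have "integral {0..1} (\<lambda>x. cos (pi * of_int (int j - int k) * x) + cos (pi * of_int (int j + int k) * x))
     = integral {0..1} (\<lambda>x. cos (pi * of_int (int j - int k) * x))
      + integral {0..1} (\<lambda>x. cos (pi * of_int (int j + int k) * x))"
    by (intro integral_add integrable_continuous_interval continuous_intros)
  ultimately show ?thesis using assms by (simp only: integral_cos_pi_multiple) auto
next
  case Legendre
  define c where "c = sqrt (2 * real j + 1) * sqrt (2 * real k + 1)"
  have "psi b j x * psi b k x = c * (poly (legendre j) x * poly (legendre k) x)" for x
    by (simp add: psi_Legendre Legendre c_def)
  then have *: "integral {0..1} (\<lambda>x. psi b j x * psi b k x) = c * integral {0..1} (\<lambda>x. poly (legendre j) x * poly (legendre k) x)"
    by simp
  consider "j = k" | "j < k" | "k < j" by linarith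
  then show ?thesis
  proof cases
    case 1
    then show ?thesis using legendre_norm[of k] * by (simp add: c_def)
  next
    case 2
    then show ?thesis using legendre_orthogonal_lower[of "legendre j" k] *
      by (simp add: degree_legendre mult.commute)
  next
    case 3
    then show ?thesis using legendre_orthogonal_lower[of "legendre k" j] *
      by (simp add: degree_legendre)
  qed
qed

section \<open>Normal quantiles\<close>

lemma std_normal_set_integrable: "A \<in> sets borel \<Longrightarrow> set_integrable lborel A std_normal_density"
  unfolding set_integrable_def by (intro integrable_mult_indicator) auto

text \<open>For 0 \<le> x \<le> t the difference t^2 - x^2 - (t - x)^2 equals 2x(t - x) and is
  nonnegative. The tail bound follows, since the translated density has total mass 1.\<close>

lemma std_normal_density_shift_le:
  assumes "0 \<le> x" "x \<le> t"
  shows "std_normal_density t \<le> exp (- x\<^sup>2 / 2) * std_normal_density (t - x)"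
proof -
  have "x * x \<le> x * t" using assms by (intro mult_left_mono)
  then have "- t\<^sup>2 / 2 \<le> - x\<^sup>2 / 2 + - (t - x)\<^sup>2 / 2"
    by (simp add: power2_eq_square algebra_simps)
  then have "exp (- t\<^sup>2 / 2) \<le> exp (- x\<^sup>2 / 2) * exp (- (t - x)\<^sup>2 / 2)"
    by (simp only: exp_add [symmetric] exp_le_cancel_iff)
  then show ?thesis by (simp add: std_normal_density_def divide_right_mono)
qed

lemma Phi_complement: "1 - Phi x = (LBINT t:{x<..}. std_normal_density t)"
proof -
  have "(LBINT t:{..x} \<union> {x<..}. std_normal_density t) = Phi x + (LBINT t:{x<..}. std_normal_density t)"
    unfolding Phi_def by (intro set_integral_Un std_normal_set_integrable) auto
  moreover have "{..x} \<union> {x<..} = UNIV" by auto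
  ultimately show ?thesis by (simp add: set_lebesgue_integral_def)
qed

lemma Phi_tail:
  assumes "0 \<le> x"
  shows "1 - Phi x \<le> exp (- x\<^sup>2 / 2)"
proof -
  have i: "integrable lborel (\<lambda>t. std_normal_density (t - x))"
    using lborel_integrable_real_affine[of std_normal_density 1 "- x"] by simp
  have "(\<integral>t. std_normal_density (t - x) \<partial>lborel) = 1"
    using lborel_integral_real_affine[of 1 std_normal_density "- x"] by simp
  moreover have "(LBINT t:{x<..}. std_normal_density t)
      \<le> (\<integral>t. exp (- x\<^sup>2 / 2) * std_normal_density (t - x) \<partial>lborel)"
    unfolding set_lebesgue_integral_def
  proof (intro integral_mono)
    show "integrable lborel (\<lambda>t. indicat_real {x<..} t *\<^sub>R std_normal_density t)"
      using std_normal_set_integrable[of "{x<..}"] by (simp add: set_integrable_def)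
    show "integrable lborel (\<lambda>t. exp (- x\<^sup>2 / 2) * std_normal_density (t - x))"
      using i by (rule integrable_mult_right)
    show "indicat_real {x<..} t *\<^sub>R std_normal_density t \<le> exp (- x\<^sup>2 / 2) * std_normal_density (t - x)" for t
      using std_normal_density_shift_le[OF assms, of t]
      by (cases "t > x") (simp_all add: normal_density_nonneg)
  qed
  ultimately show ?thesis by (simp add: Phi_complement)
qed

text \<open>Makes the limit at minus infinity and the continuity criterion of distribution functions
  available for \<open>Phi\<close>.\<close>

lemma Phi_cdf: "Phi = cdf (density lborel std_normal_density)"
proof
  fix x
  have "measure (density lborel std_normal_density) {..x}
      = (\<integral>t. indicat_real {..x} t \<partial>density lborel std_normal_density)" by simp
  also have "\<dots> = Phi x"
    unfolding Phi_def set_lebesgue_integral_def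
    by (subst integral_density) (auto simp: mult.commute)
  finally have "measure (density lborel std_normal_density) {..x} = Phi x" .
  then show "Phi x = cdf (density lborel std_normal_density) x" by (simp add: cdf_def)
qed

lemma std_normal_real_distribution: "real_distribution (density lborel std_normal_density)"
proof -
  interpret prob_space "density lborel std_normal_density"
    by (rule prob_space_normal_density) simp
  show ?thesis by unfold_locales simp
qed

lemma Phi_continuous: "isCont Phi x"
proof -
  interpret real_distribution "density lborel std_normal_density"
    by (rule std_normal_real_distribution)
  have "(\<integral>\<^sup>+ t. ennreal (std_normal_density t) * indicator {x} t \<partial>lborel) = 0"
    by (rule nn_integral_null_set) (simp add: null_sets_def)
  then have "emeasure (density lborel std_normal_density) {x} = 0"
    by (simp add: emeasure_density)
  then show ?thesis unfolding Phi_cdf isCont_cdf by (simp add: measure_def)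
qed

lemma Phi_strict_mono:
  assumes "x < y"
  shows "Phi x < Phi y"
proof -
  define l where "l = std_normal_density (max \<bar>x\<bar> \<bar>y\<bar>)"
  have l: "l > 0" unfolding l_def by (rule normal_density_pos) simp
  have ll: "l \<le> std_normal_density t" if "t \<in> {x<..y}" for t
  proof -
    have "\<bar>t\<bar> \<le> max \<bar>x\<bar> \<bar>y\<bar>" using that by auto
    then have "t\<^sup>2 \<le> (max \<bar>x\<bar> \<bar>y\<bar>)\<^sup>2" using abs_le_square_iff by fastforce
    then show ?thesis unfolding l_def std_normal_density_def by (intro mult_left_mono) auto
  qed
  have "(LBINT t:{..x} \<union> {x<..y}. std_normal_density t) = Phi x + (LBINT t:{x<..y}. std_normal_density t)"
    unfolding Phi_def by (intro set_integral_Un std_normal_set_integrable) auto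
  moreover have "{..x} \<union> {x<..y} = {..y}" using assms by auto
  ultimately have "Phi y = Phi x + (LBINT t:{x<..y}. std_normal_density t)" by (simp add: Phi_def)
  moreover have "integrable lborel (indicat_real {x<..y})"
    using assms by (intro integrable_real_indicator) auto
  then have "(LBINT t:{x<..y}. l) \<le> (LBINT t:{x<..y}. std_normal_density t)"
    using ll by (intro set_integral_mono std_normal_set_integrable) (auto simp: set_integrable_def)
  moreover have "(LBINT t:{x<..y}. l) = l * (y - x)"
    using assms by (simp add: set_lebesgue_integral_def)
  moreover have "l * (y - x) > 0" using l assms by simp
  ultimately show ?thesis by linarith
qed

text \<open>As \<open>Phi_inv\<close> is a definite description, the quantile must first be shown to
  exist, by the intermediate value theorem, and to be unique, by strict monotonicity.\<close>

lemma Phi_inv_less: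
  assumes "0 < p" "p < Phi x"
  shows "Phi_inv p < x"
proof -
  interpret real_distribution "density lborel std_normal_density"
    by (rule std_normal_real_distribution)
  have "eventually (\<lambda>z. Phi z < p) at_bot"
    using cdf_lim_at_bot assms(1) unfolding Phi_cdf by (rule order_tendstoD(2))
  then obtain z where z: "Phi z < p" "z \<le> x"
    unfolding eventually_at_bot_linorder by (metis min.cobounded1 min.cobounded2)
  obtain q where q: "Phi q = p"
    using IVT'[of Phi z p x] z assms(2) Phi_continuous
    by (auto intro: continuous_at_imp_continuous_on)
  have inj: "Phi u = Phi v \<Longrightarrow> u = v" for u v
    using Phi_strict_mono[of u v] Phi_strict_mono[of v u] by linarith
  have "Phi_inv p = q" unfolding Phi_inv_def using q inj by blast
  moreover have "q < x"
  proof (rule ccontr)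
    assume "\<not> q < x"
    then have "Phi x \<le> Phi q" using Phi_strict_mono[of x q] by (cases "x = q") auto
    then show False using q assms(2) by simp
  qed
  ultimately show ?thesis by simp
qed

text \<open>The level \<open>p\<close> of the quantile lies below 1 by at least a constant times
  1/d, whereas the normal tail at (1 + \<delta>) sqrt (2 ln d) is at most d to the power -(1 +
  \<delta>)^2, which is o(1/d).\<close>

lemma crit_upper_bound:
  assumes "0 < \<alpha>" "\<alpha> < 1" "0 < \<delta>"
  shows "eventually (\<lambda>d. crit \<alpha> d \<le> (1 + \<delta>) * sqrt (2 * ln (real d))) sequentially"
proof -
  \<comment> \<open>Chosen so that the power of 1 - \<alpha> in \<open>crit\<close> becomes exp (-
    s/d).\<close>
  define s where "s = - ln (1 - \<alpha>)"
  have s: "s > 0" using assms by (simp add: s_def)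
  have "((\<lambda>d::nat. real d * real d powr (- ((1 + \<delta>)\<^sup>2))) \<longlongrightarrow> 0) sequentially"
    using assms by real_asymp
  then have "eventually (\<lambda>d. real d * real d powr (- ((1 + \<delta>)\<^sup>2)) < s / (2 * (1 + s))) sequentially"
    by (rule order_tendstoD(2)) (use s in simp)
  moreover have "eventually (\<lambda>d::nat. d \<ge> 1) sequentially" by (rule eventually_ge_at_top)
  ultimately show ?thesis
  proof eventually_elim
    case (elim d)
    define x where "x = (1 + \<delta>) * sqrt (2 * ln (real d))"
    have d: "real d \<ge> 1" using elim by simp
    have x0: "x \<ge> 0" using assms d by (simp add: x_def)
    have "x\<^sup>2 = (1 + \<delta>)\<^sup>2 * (2 * ln (real d))" using d by (simp add: x_def power_mult_distrib)
    then have "exp (- x\<^sup>2 / 2) = real d powr (- ((1 + \<delta>)\<^sup>2))" using d by (simp add: powr_def)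
    with Phi_tail[OF x0] have t: "1 - Phi x \<le> real d powr (- ((1 + \<delta>)\<^sup>2))" by simp
    define p where "p = 1 / 2 + (1 - \<alpha>) powr (1 / real d) / 2"
    have e: "(1 - \<alpha>) powr (1 / real d) = exp (- s / real d)"
      using assms by (simp add: powr_def s_def)
    have "exp (- s / real d) \<le> 1 / (1 + s / real d)"
    proof -
      have "1 + s / real d \<le> exp (s / real d)" by (rule exp_ge_add_one_self)
      then show ?thesis using s d by (simp add: exp_minus field_simps)
    qed
    also have "\<dots> = 1 - s / (real d + s)" using s d by (simp add: field_simps)
    \<comment> \<open>Because d \<ge> 1, d + s is at most (1 + s) d.\<close>
    also have "\<dots> \<le> 1 - s / ((1 + s) * real d)"
      using s d by (intro diff_left_mono divide_left_mono mult_pos_pos) (auto simp: algebra_simps)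
    finally have "exp (- s / real d) \<le> 1 - s / ((1 + s) * real d)" .
    moreover have "s / (2 * (1 + s)) / real d = s / ((1 + s) * real d) / 2" by simp
    moreover have "E \<le> 1 - A \<Longrightarrow> B = A / 2 \<Longrightarrow> B \<le> 1 - (1 / 2 + E / 2)" for A B E :: real by linarith
    ultimately have "1 - p \<ge> s / (2 * (1 + s)) / real d" unfolding p_def e by blast
    moreover have "real d powr (- ((1 + \<delta>)\<^sup>2)) < s / (2 * (1 + s)) / real d"
    proof -
      have "real d > 0" using d by linarith
      then show ?thesis using elim(1) by (simp only: pos_less_divide_eq mult.commute)
    qed
    ultimately have "p < Phi x" using t by linarith
    moreover have "p > 0" by (simp add: p_def e add_pos_pos)
    ultimately have "Phi_inv p < x" by (intro Phi_inv_less)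
    then show ?case by (simp add: crit_def p_def x_def)
  qed
qed

section \<open>The exponential family\<close>

lemma exp_quadratic_upper:
  fixes u :: real
  assumes "\<bar>u\<bar> \<le> 1"
  shows "exp u \<le> 1 + u + u\<^sup>2"
proof (cases "u \<ge> 0")
  case True
  then show ?thesis using assms by (intro exp_bound) auto
next
  case False
  define v where "v = - u"
  have v: "v > 0" using False by (simp add: v_def)
  \<comment> \<open>The claim for u = -v amounts to 1 \<le> (1 - v + v^2) exp v; it already holds
    with exp v replaced by its quadratic Taylor polynomial, as the product has only nonnegative
    extra terms.\<close>
  have "1 \<le> 1 + v\<^sup>2 / 2 + v^3 / 2 + v^4 / 2" using v by simp
  also have "\<dots> = (1 - v + v\<^sup>2) * (1 + v + v\<^sup>2 / 2)"
    by (simp add: field_simps power2_eq_square power3_eq_cube power4_eq_xxxx)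
  also have "\<dots> \<le> (1 - v + v\<^sup>2) * exp v"
  proof (rule mult_left_mono)
    show "1 + v + v\<^sup>2 / 2 \<le> exp v" using v by (intro exp_lower_Taylor_quadratic) simp
    show "0 \<le> 1 - v + v\<^sup>2" using assms v by (simp add: v_def)
  qed
  finally show ?thesis by (simp add: v_def exp_minus field_simps)
qed

lemma exp_quadratic_error:
  fixes u :: real
  assumes "\<bar>u\<bar> \<le> 1"
  shows "\<bar>exp u - 1 - u\<bar> \<le> u\<^sup>2"
  using exp_quadratic_upper[OF assms] exp_ge_add_one_self[of u] by linarith

locale exp_family =
  fixes b :: basis and d :: nat and \<theta> :: "nat \<Rightarrow> real"
  assumes d: "d \<ge> 1"
begin

abbreviation "B \<equiv> psi_bd b d"

definition S :: "real \<Rightarrow> real" where "S z = (\<Sum>k=1..d. \<theta> k * psi b k z)"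
definition T :: real where "T = (\<Sum>k=1..d. \<bar>\<theta> k\<bar>)"
text \<open>By orthonormality this is the squared L2 norm of \<open>S\<close>, see
  \<open>integral_S_squared\<close>.\<close>

definition N :: real where "N = (\<Sum>k=1..d. (\<theta> k)\<^sup>2)"
text \<open>Normalizer of the density proportional to exp (t S). The parameter \<open>t\<close>
  joins the uniform density at t = 0 to \<open>rho\<close> at t = 1.\<close>

definition Z :: "real \<Rightarrow> real" where "Z t = integral {0..1} (\<lambda>z. exp (t * S z))"

lemma S_cont [continuous_intros]: "continuous_on A S"
  unfolding S_def by (intro continuous_intros)

lemma psi_le_B: "k \<in> {1..d} \<Longrightarrow> z \<in> {0..1} \<Longrightarrow> \<bar>psi b k z\<bar> \<le> B"
  by (rule psi_regular[of k d b]) auto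

lemma B_ge_2: "B \<ge> 2"
  using d by (cases b) (auto simp: psi_bd_def)

lemma T_nonneg: "T \<ge> 0" by (simp add: T_def sum_nonneg)
lemma N_nonneg: "N \<ge> 0" by (simp add: N_def sum_nonneg)

lemma S_bound:
  assumes "z \<in> {0..1}"
  shows "\<bar>S z\<bar> \<le> B * T"
proof -
  have "\<bar>S z\<bar> \<le> (\<Sum>k=1..d. \<bar>\<theta> k * psi b k z\<bar>)" unfolding S_def by (rule sum_abs)
  also have "\<dots> \<le> (\<Sum>k=1..d. \<bar>\<theta> k\<bar> * B)"
    using assms by (intro sum_mono) (auto simp: abs_mult intro!: mult_left_mono psi_le_B)
  also have "\<dots> = B * T" by (simp add: T_def sum_distrib_left mult.commute)
  finally show ?thesis .
qed

lemma integral_S: "integral {0..1} S = 0"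
proof -
  have "integral {0..1} S = (\<Sum>k=1..d. integral {0..1} (\<lambda>z. \<theta> k * psi b k z))"
    unfolding S_def
    by (rule integral_sum) (auto intro!: integrable_continuous_interval continuous_intros)
  also have "\<dots> = 0" using psi_mean_zero[of _ b] by (intro sum.neutral) auto
  finally show ?thesis .
qed

lemma integral_psi_S:
  assumes "j \<in> {1..d}"
  shows "integral {0..1} (\<lambda>z. psi b j z * S z) = \<theta> j"
proof -
  have "integral {0..1} (\<lambda>z. psi b j z * S z) = integral {0..1} (\<lambda>z. \<Sum>k=1..d. \<theta> k * (psi b j z * psi b k z))"
    by (simp add: S_def sum_distrib_left mult_ac)
  also have "\<dots> = (\<Sum>k=1..d. integral {0..1} (\<lambda>z. \<theta> k * (psi b j z * psi b k z)))"
    by (rule integral_sum) (auto intro!: integrable_continuous_interval continuous_intros)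
  also have "\<dots> = (\<Sum>k=1..d. \<theta> k * (if j = k then 1 else 0))"
    using assms psi_orthonormal[of j _ b] by (intro sum.cong) auto
  also have "\<dots> = \<theta> j" using assms by (simp add: if_distrib[of "\<lambda>x. _ * x"] cong: if_cong)
  finally show ?thesis .
qed

lemma integral_mult_S:
  assumes "continuous_on {0..1} h"
  shows "integral {0..1} (\<lambda>z. h z * S z) = (\<Sum>k=1..d. \<theta> k * integral {0..1} (\<lambda>z. h z * psi b k z))"
proof -
  have "integral {0..1} (\<lambda>z. h z * S z) = integral {0..1} (\<lambda>z. \<Sum>k=1..d. \<theta> k * (h z * psi b k z))"
    by (simp add: S_def sum_distrib_left mult_ac)
  also have "\<dots> = (\<Sum>k=1..d. integral {0..1} (\<lambda>z. \<theta> k * (h z * psi b k z)))"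
    by (rule integral_sum) (auto intro!: integrable_continuous_interval continuous_intros assms)
  finally show ?thesis by simp
qed

lemma integral_S_squared: "integral {0..1} (\<lambda>z. (S z)\<^sup>2) = N"
proof -
  have "integral {0..1} (\<lambda>z. (S z)\<^sup>2) = (\<Sum>k=1..d. \<theta> k * integral {0..1} (\<lambda>z. S z * psi b k z))"
    using integral_mult_S[OF S_cont] by (simp add: power2_eq_square)
  also have "\<dots> = (\<Sum>k=1..d. \<theta> k * \<theta> k)"
    using integral_psi_S by (intro sum.cong) (auto simp: mult.commute)
  finally show ?thesis by (simp add: N_def power2_eq_square)
qed

lemma integrable_exp_S: "(\<lambda>z. exp (t * S z)) integrable_on {0..1}"
  by (intro integrable_continuous_interval continuous_intros)

text \<open>Jensen's inequality in elementary form: exp u \<ge> 1 + u, and \<open>S\<close> has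
  integral 0.\<close>

lemma Z_ge_1: "Z t \<ge> 1"
proof -
  have "integral {0..1} (\<lambda>z. 1 + t * S z) \<le> Z t"
    unfolding Z_def
    by (intro integral_le integrable_exp_S integrable_continuous_interval continuous_intros)
       (simp add: exp_ge_add_one_self)
  moreover have "integral {0..1} (\<lambda>z. 1 + t * S z) = 1"
    using integral_S
    by (subst integral_add) (auto intro!: integrable_continuous_interval continuous_intros)
  ultimately show ?thesis by simp
qed

lemma Z_le_exp:
  assumes "\<And>z. z \<in> {0..1} \<Longrightarrow> t * S z \<le> x"
  shows "Z t \<le> exp x"
proof -
  have "Z t \<le> integral {0..1} (\<lambda>z::real. exp x)"
    unfolding Z_def using assms by (intro integral_le integrable_exp_S) auto
  then show ?thesis by simp
qed

lemma rho_eq: "rho b d \<theta> z = exp (S z) / Z 1"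
  by (simp add: rho_def C_d_def S_def Z_def divide_inverse mult.commute)

lemma rho_cont [continuous_intros]: "continuous_on A (rho b d \<theta>)"
  unfolding rho_eq[abs_def] using Z_ge_1[of 1] by (intro continuous_intros) auto

lemma rho_nonneg: "rho b d \<theta> z \<ge> 0"
  unfolding rho_eq using Z_ge_1[of 1] by simp

definition e :: "nat \<Rightarrow> real" where
  "e k = integral {0..1} (\<lambda>z. rho b d \<theta> z * psi b k z)"

text \<open>With x = B T, the numerator lies between exp (-x) and exp x and the normalizer between 1
  and exp x.\<close>

lemma rho_near_1:
  assumes "B * T \<le> 1/4" "z \<in> {0..1}"
  shows "\<bar>rho b d \<theta> z - 1\<bar> \<le> 2 * (B * T)"
proof -
  define x where "x = B * T"
  have x: "0 \<le> x" "x \<le> 1/4" using assms B_ge_2 T_nonneg by (auto simp: x_def)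
  have S: "\<bar>S z\<bar> \<le> x" using S_bound[OF assms(2)] by (simp add: x_def)
  have Zx: "Z 1 \<le> exp x" using S_bound by (intro Z_le_exp) (auto simp: x_def intro: order_trans[OF abs_ge_self])
  have "rho b d \<theta> z \<le> exp x / 1"
    unfolding rho_eq using S Z_ge_1[of 1] by (intro frac_le) auto
  also have "exp x \<le> 1 + 2 * x"
  proof -
    have "x * x \<le> 1 * x" using x by (intro mult_right_mono) auto
    then show ?thesis using exp_quadratic_upper[of x] x by (simp add: power2_eq_square)
  qed
  finally have up: "rho b d \<theta> z \<le> 1 + 2 * x" by simp
  have "1 - 2 * x \<le> exp (- 2 * x)" using exp_ge_add_one_self[of "- 2 * x"] by simp
  also have "\<dots> = exp (- x) / exp x" by (simp flip: exp_diff)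
  also have "\<dots> \<le> rho b d \<theta> z"
    unfolding rho_eq using S Zx Z_ge_1[of 1] by (intro frac_le) auto
  finally show ?thesis using up by (simp add: x_def)
qed

text \<open>Subtracting the constant and linear terms of exp S, which contribute 0 and
  \<open>\<theta> k\<close> to the numerator, leaves an error of at most B N \<le> \<delta>
  |\<open>\<theta> k\<close>|. The normalizer is at most 1 + \<delta>, and (1 - 2 \<delta>)(1 +
  \<delta>) \<le> 1 - \<delta>.\<close>

lemma e_small_theta:
  assumes \<delta>: "B * T \<le> \<delta>" "\<delta> \<le> 1/4" and k: "k \<in> {1..d}" and max: "\<And>j. j \<in> {1..d} \<Longrightarrow> \<bar>\<theta> j\<bar> \<le> \<bar>\<theta> k\<bar>"
  shows "\<bar>e k\<bar> \<ge> (1 - 2 * \<delta>) * \<bar>\<theta> k\<bar>"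
proof -
  define \<tau> where "\<tau> = \<bar>\<theta> k\<bar>"
  have \<delta>0: "\<delta> \<ge> 0" using \<delta> B_ge_2 T_nonneg by (meson mult_nonneg_nonneg order_trans zero_le_numeral)
  have Sd: "\<bar>S z\<bar> \<le> \<delta>" if "z \<in> {0..1}" for z using S_bound[OF that] \<delta> by linarith
  \<comment> \<open>Maximality of coordinate \<open>k\<close> enters here: it makes the quadratic
    error small relative to \<open>\<tau>\<close>, not merely in absolute size.\<close>
  have N: "N \<le> T * \<tau>"
  proof -
    have "(\<theta> j)\<^sup>2 \<le> \<bar>\<theta> j\<bar> * \<tau>" if "j \<in> {1..d}" for j
    proof -
      have "(\<theta> j)\<^sup>2 = \<bar>\<theta> j\<bar> * \<bar>\<theta> j\<bar>" by (simp add: power2_eq_square)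
      also have "\<dots> \<le> \<bar>\<theta> j\<bar> * \<tau>" using max[OF that] unfolding \<tau>_def by (intro mult_left_mono) auto
      finally show ?thesis .
    qed
    then show ?thesis unfolding N_def T_def sum_distrib_right by (intro sum_mono)
  qed
  have BN: "B * N \<le> \<delta> * \<tau>"
  proof -
    have "B * N \<le> B * (T * \<tau>)" using N B_ge_2 by (intro mult_left_mono) auto
    also have "\<dots> = (B * T) * \<tau>" by simp
    also have "\<dots> \<le> \<delta> * \<tau>" using \<delta> by (intro mult_right_mono) (auto simp: \<tau>_def)
    finally show ?thesis .
  qed
  have Nd: "N \<le> \<delta>"
  proof -
    have "N \<le> integral {0..1} (\<lambda>z::real. \<delta>\<^sup>2)"
      unfolding integral_S_squared [symmetric]
    proof (intro integral_le integrable_continuous_interval continuous_intros)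
      fix z :: real assume "z \<in> {0..1}"
      then show "(S z)\<^sup>2 \<le> \<delta>\<^sup>2" using power_mono[OF Sd abs_ge_zero, of z 2] by simp
    qed
    then have "N \<le> \<delta> * \<delta>" by (simp add: power2_eq_square)
    also have "\<dots> \<le> 1 * \<delta>" using \<delta> \<delta>0 by (intro mult_right_mono) auto
    finally show ?thesis by simp
  qed
  have Zup: "Z 1 \<le> 1 + \<delta>"
  proof -
    have "Z 1 \<le> integral {0..1} (\<lambda>z. (1 + S z) + (S z)\<^sup>2)"
      unfolding Z_def
    proof (intro integral_le integrable_exp_S integrable_continuous_interval continuous_intros)
      fix z :: real assume "z \<in> {0..1}"
      then have "\<bar>S z\<bar> \<le> 1" using Sd[of z] \<delta> by simp
      then show "exp (1 * S z) \<le> (1 + S z) + (S z)\<^sup>2" using exp_quadratic_upper[of "S z"] by simp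
    qed
    also have "\<dots> = integral {0..1} (\<lambda>z. 1 + S z) + N"
      unfolding integral_S_squared [symmetric]
      by (intro integral_add integrable_continuous_interval continuous_intros)
    also have "integral {0..1} (\<lambda>z. 1 + S z) = 1"
      using integral_S by (subst integral_add) (auto intro!: integrable_continuous_interval continuous_intros)
    finally show ?thesis using Nd by simp
  qed
  define I where "I = integral {0..1} (\<lambda>z. exp (S z) * psi b k z)"
  have Ie: "e k = I / Z 1"
    by (simp add: e_def rho_eq I_def)
  have "\<bar>I - \<theta> k\<bar> \<le> \<delta> * \<tau>"
  proof -
    have "I - \<theta> k = integral {0..1} (\<lambda>z. exp (S z) * psi b k z - psi b k z * S z)"
      unfolding I_def integral_psi_S[OF k, symmetric]
      by (rule integral_diff [symmetric]) (intro integrable_continuous_interval continuous_intros)+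
    also have "\<dots> = integral {0..1} (\<lambda>z. (exp (S z) * psi b k z - psi b k z * S z) - psi b k z)"
      using psi_mean_zero[of k b] k
      by (subst integral_diff[of _ _ "psi b k"]) (auto intro!: integrable_continuous_interval continuous_intros)
    also have "norm \<dots> \<le> integral {0..1} (\<lambda>z. B * (S z)\<^sup>2)"
    proof (rule Henstock_Kurzweil_Integration.integral_norm_bound_integral)
      fix z :: real assume z: "z \<in> {0..1}"
      have "(exp (S z) * psi b k z - psi b k z * S z) - psi b k z = psi b k z * (exp (S z) - 1 - S z)"
        by (simp add: algebra_simps)
      moreover have "\<bar>psi b k z\<bar> * \<bar>exp (S z) - 1 - S z\<bar> \<le> B * (S z)\<^sup>2"
        using Sd[OF z] \<delta> B_ge_2 by (intro mult_mono psi_le_B k z exp_quadratic_error) auto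
      ultimately show "norm ((exp (S z) * psi b k z - psi b k z * S z) - psi b k z) \<le> B * (S z)\<^sup>2"
        by (simp add: abs_mult)
    qed (intro integrable_continuous_interval continuous_intros)+
    also have "\<dots> = B * N" by (simp add: integral_S_squared)
    finally show ?thesis using BN by simp
  qed
  then have "\<bar>I\<bar> \<ge> (1 - \<delta>) * \<tau>" unfolding \<tau>_def by (simp add: algebra_simps)
  have "(1 - 2 * \<delta>) * \<tau> * Z 1 \<le> (1 - 2 * \<delta>) * \<tau> * (1 + \<delta>)"
    using Zup \<delta> by (intro mult_left_mono) (auto simp: \<tau>_def)
  also have "\<dots> = (1 - \<delta>) * \<tau> - 2 * \<delta> * \<delta> * \<tau>" by (simp add: algebra_simps)
  also have "\<dots> \<le> \<bar>I\<bar>" using \<open>\<bar>I\<bar> \<ge> (1 - \<delta>) * \<tau>\<close> \<delta>0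
    by (smt (verit) \<tau>_def abs_ge_zero mult_nonneg_nonneg)
  finally show ?thesis unfolding Ie \<tau>_def using Z_ge_1[of 1] by (simp add: pos_le_divide_eq)
qed

text \<open>\<open>S\<close> and \<open>exp ((1 - t) S)\<close> are comonotone, hence positively correlated under the density
  proportional to \<open>exp (t S)\<close>; so the mean of \<open>S\<close> only grows along the ray from \<open>t \<theta>\<close> to \<open>\<theta>\<close>.\<close>
lemma mean_S_mono:
  assumes t: "0 \<le> t" "t \<le> 1"
  shows "integral {0..1} (\<lambda>z. exp (t * S z) * S z) / Z t \<le> integral {0..1} (\<lambda>z. rho b d \<theta> z * S z)"
proof -
  define c where "c = integral {0..1} (\<lambda>z. exp (t * S z) * S z) / Z t"
  \<comment> \<open>The value of exp ((1 - t) s) at s = c, so that S - c and exp ((1 - t) S) - K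
    always have the same sign. Since \<open>c\<close> is the mean under exp (t S), the terms
    containing \<open>K\<close> integrate to 0.\<close>
  define K where "K = exp ((1 - t) * c)"
  have Zt: "Z t > 0" "Z 1 > 0" using Z_ge_1[of t] Z_ge_1[of 1] by auto
  have eq: "(exp (S z) * S z - c * exp (S z)) - (K * (exp (t * S z) * S z) - (K * c) * exp (t * S z))
      = exp (t * S z) * ((S z - c) * (exp ((1 - t) * S z) - K))" for z
  proof -
    have "exp (S z) = exp (t * S z) * exp ((1 - t) * S z)" by (simp flip: exp_add add: algebra_simps)
    then show ?thesis by (simp only: algebra_simps)
  qed
  have nn: "0 \<le> exp (t * S z) * ((S z - c) * (exp ((1 - t) * S z) - K))" for z
  proof (cases "S z \<ge> c")
    case True
    then have "exp ((1 - t) * S z) \<ge> K" unfolding K_def using t by (simp add: mult_left_mono)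
    then show ?thesis using True by simp
  next
    case False
    then have "exp ((1 - t) * S z) \<le> K" unfolding K_def using t by (simp add: mult_left_mono)
    then show ?thesis using False by (intro mult_nonneg_nonneg mult_nonpos_nonpos) auto
  qed
  have "0 \<le> integral {0..1} (\<lambda>z. exp (t * S z) * ((S z - c) * (exp ((1 - t) * S z) - K)))"
    by (intro integral_nonneg integrable_continuous_interval continuous_intros nn)
  also have "\<dots> = integral {0..1} (\<lambda>z. (exp (S z) * S z - c * exp (S z)) - (K * (exp (t * S z) * S z) - (K * c) * exp (t * S z)))"
    by (simp only: eq)
  also have "\<dots> = integral {0..1} (\<lambda>z. exp (S z) * S z - c * exp (S z))
      - integral {0..1} (\<lambda>z. K * (exp (t * S z) * S z) - (K * c) * exp (t * S z))"
    by (rule integral_diff) (intro integrable_continuous_interval continuous_intros)+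
  also have "integral {0..1} (\<lambda>z. exp (S z) * S z - c * exp (S z)) = integral {0..1} (\<lambda>z. exp (S z) * S z) - c * Z 1"
    by (subst integral_diff) (auto intro!: integrable_continuous_interval continuous_intros simp: Z_def)
  also have "integral {0..1} (\<lambda>z. K * (exp (t * S z) * S z) - (K * c) * exp (t * S z))
      = K * integral {0..1} (\<lambda>z. exp (t * S z) * S z) - K * c * Z t"
    by (subst integral_diff) (auto intro!: integrable_continuous_interval continuous_intros simp: Z_def)
  also have "\<dots> = 0" unfolding c_def using Zt by simp
  finally have "c * Z 1 \<le> integral {0..1} (\<lambda>z. exp (S z) * S z)" by simp
  then have "c \<le> integral {0..1} (\<lambda>z. exp (S z) * S z) / Z 1" using Zt by (simp add: pos_le_divide_eq)
  also have "\<dots> = integral {0..1} (\<lambda>z. rho b d \<theta> z * S z)" by (simp add: rho_eq)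
  finally show ?thesis by (simp add: c_def)
qed

text \<open>If all |e_k| were below s = \<delta> / (2 B d), the mean of \<open>S\<close> under
  \<open>rho\<close> would be less than T s. Monotonicity in t bounds that mean below by t N / 2,
  and T^2 \<le> N d turns this into at least T s.\<close>

lemma e_large_theta:
  assumes \<delta>: "B * T > \<delta>" "0 < \<delta>" "\<delta> \<le> 1/4"
  shows "\<exists>k\<in>{1..d}. \<bar>e k\<bar> \<ge> \<delta> / (2 * B * d)"
proof (rule ccontr)
  assume neg: "\<not> ?thesis"
  \<comment> \<open>The point on the ray at which t |S| \<le> \<delta> on [0,1], so that the
    quadratic expansion of the exponential is valid.\<close>
  define t where "t = \<delta> / (B * T)"
  have BT: "B * T > 0" using \<delta> by linarith
  have B0: "B > 0" using B_ge_2 by simp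
  have Tp: "T > 0" using BT B0 by (simp add: zero_less_mult_iff)
  have t: "0 < t" "t \<le> 1" using \<delta> BT by (auto simp: t_def)
  have tS: "\<bar>t * S z\<bar> \<le> \<delta>" if "z \<in> {0..1}" for z
  proof -
    have "t * \<bar>S z\<bar> \<le> t * (B * T)" using S_bound[OF that] t by (intro mult_left_mono) auto
    moreover have "t * (B * T) = \<delta>" using B0 Tp by (simp add: t_def)
    ultimately show ?thesis unfolding abs_mult abs_of_pos[OF t(1)] by simp
  qed
  \<comment> \<open>With u = t S, the product S exp u is S + t S^2 up to an error of |u| t S^2, at
    most a quarter of t S^2. The term S integrates to 0.\<close>
  have low: "3/4 * t * N \<le> integral {0..1} (\<lambda>z. exp (t * S z) * S z)"
  proof -
    have "integral {0..1} (\<lambda>z. S z + 3/4 * t * (S z)\<^sup>2) \<le> integral {0..1} (\<lambda>z. exp (t * S z) * S z)"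
    proof (intro integral_le integrable_continuous_interval continuous_intros)
      fix z :: real assume z: "z \<in> {0..1}"
      let ?u = "t * S z"
      have "\<bar>exp ?u - 1 - ?u\<bar> \<le> ?u\<^sup>2" using tS[OF z] \<delta> by (intro exp_quadratic_error) auto
      then have "\<bar>S z\<bar> * \<bar>exp ?u - 1 - ?u\<bar> \<le> \<bar>S z\<bar> * ?u\<^sup>2" by (intro mult_left_mono) auto
      also have "\<dots> = \<bar>?u\<bar> * (t * (S z)\<^sup>2)"
        using t by (simp add: abs_mult power2_eq_square mult_ac)
      also have "\<dots> \<le> 1/4 * (t * (S z)\<^sup>2)" using tS[OF z] \<delta> t by (intro mult_right_mono) auto
      finally have "\<bar>S z * (exp ?u - 1 - ?u)\<bar> \<le> 1/4 * (t * (S z)\<^sup>2)" by (simp add: abs_mult)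
      then have "S z * (exp ?u - 1 - ?u) \<ge> - (1/4 * (t * (S z)\<^sup>2))" by linarith
      moreover have "S z * (exp ?u - 1 - ?u) = exp ?u * S z - S z - t * (S z)\<^sup>2"
        by (simp add: algebra_simps power2_eq_square)
      ultimately show "S z + 3/4 * t * (S z)\<^sup>2 \<le> exp ?u * S z" by linarith
    qed
    moreover have "integral {0..1} (\<lambda>z. S z + 3/4 * t * (S z)\<^sup>2) = 3/4 * t * N"
      using integral_S integral_S_squared
      by (subst integral_add) (auto intro!: integrable_continuous_interval continuous_intros)
    ultimately show ?thesis by simp
  qed
  have "Z t \<le> exp \<delta>" using tS by (intro Z_le_exp) (auto intro: order_trans[OF abs_ge_self])
  also have "exp \<delta> \<le> 3/2"
  proof -
    have "\<delta> * \<delta> \<le> 1/4 * (1/4)" using \<delta> by (intro mult_mono) auto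
    then show ?thesis using exp_quadratic_upper[of \<delta>] \<delta> by (simp add: power2_eq_square)
  qed
  finally have Zt: "Z t \<le> 3/2" .
  have "t * N / 2 = (3/4 * t * N) / (3/2)" by simp
  also have "\<dots> \<le> integral {0..1} (\<lambda>z. exp (t * S z) * S z) / Z t"
    using low Zt Z_ge_1[of t] t N_nonneg by (intro frac_le) (auto intro: order_trans[OF _ low])
  also have "\<dots> \<le> integral {0..1} (\<lambda>z. rho b d \<theta> z * S z)" using t by (intro mean_S_mono) auto
  also have "\<dots> = (\<Sum>k=1..d. \<theta> k * e k)"
    unfolding e_def by (intro integral_mult_S rho_cont)
  finally have lower: "t * N / 2 \<le> (\<Sum>k=1..d. \<theta> k * e k)" .
  define s where "s = \<delta> / (2 * B * d)"
  have "T\<^sup>2 \<le> N * d"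
    unfolding T_def N_def using sum_squared_le_sum_of_squares[of "\<lambda>k. \<bar>\<theta> k\<bar>" "{1..d}"] by simp
  then have "T * s \<le> t * N / 2"
    using BT B0 Tp \<delta> d by (simp add: s_def t_def field_simps power2_eq_square)
  \<comment> \<open>Both bounds may coincide at T s, so a contradiction needs a strict inequality; a
    nonzero coordinate supplies it.\<close>
  obtain k0 where k0: "k0 \<in> {1..d}" "\<bar>\<theta> k0\<bar> > 0"
  proof -
    have "\<not> (\<forall>k\<in>{1..d}. \<bar>\<theta> k\<bar> = 0)" using Tp unfolding T_def by (metis less_irrefl sum.neutral)
    then show ?thesis using that by auto
  qed
  have "(\<Sum>k=1..d. \<theta> k * e k) < (\<Sum>k=1..d. \<bar>\<theta> k\<bar> * s)"
  proof (rule sum_strict_mono_ex1)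
    have es: "\<bar>e k\<bar> < s" if "k \<in> {1..d}" for k using neg that unfolding s_def by (meson not_le)
    show "\<forall>k\<in>{1..d}. \<theta> k * e k \<le> \<bar>\<theta> k\<bar> * s"
    proof
      fix k assume "k \<in> {1..d}"
      then have "\<bar>\<theta> k\<bar> * \<bar>e k\<bar> \<le> \<bar>\<theta> k\<bar> * s" using es[of k] by (intro mult_left_mono) auto
      then show "\<theta> k * e k \<le> \<bar>\<theta> k\<bar> * s" by (metis abs_ge_self abs_mult order_trans)
    qed
    have "\<bar>\<theta> k0\<bar> * \<bar>e k0\<bar> < \<bar>\<theta> k0\<bar> * s" using es[OF k0(1)] k0(2) by (intro mult_strict_left_mono)
    then have "\<theta> k0 * e k0 < \<bar>\<theta> k0\<bar> * s" by (metis abs_ge_self abs_mult le_less_trans)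
    then show "\<exists>k\<in>{1..d}. \<theta> k * e k < \<bar>\<theta> k\<bar> * s" using k0(1) by blast
  qed simp
  also have "\<dots> = T * s" by (simp add: T_def sum_distrib_right)
  finally show False using lower \<open>T * s \<le> t * N / 2\<close> by linarith
qed

end

section \<open>Fluctuations of two-sample rank averages\<close>

text \<open>Otherwise \<open>simp\<close> rewrites the index sets \<open>{1..n}\<close> of the product measures to \<open>{Suc 0..n}\<close>.\<close>
declare One_nat_def [simp del]

section \<open>First and second moments of i.i.d. means\<close>

lemma (in prob_space) expectation_abs_le_sqrt:
  fixes f :: "'a \<Rightarrow> real"
  assumes "integrable M f" "integrable M (\<lambda>x. (f x)\<^sup>2)"
  shows "(\<integral>x. \<bar>f x\<bar> \<partial>M) \<le> sqrt (\<integral>x. (f x)\<^sup>2 \<partial>M)"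
proof -
  have "0 \<le> variance (\<lambda>x. \<bar>f x\<bar>)" by (rule variance_positive)
  also have "variance (\<lambda>x. \<bar>f x\<bar>) = (\<integral>x. (f x)\<^sup>2 \<partial>M) - (\<integral>x. \<bar>f x\<bar> \<partial>M)\<^sup>2"
    using assms by (subst variance_eq) auto
  finally show ?thesis by (intro real_le_rsqrt) simp
qed

lemma (in prob_space) integrable_bounded_real:
  fixes f :: "'a \<Rightarrow> real"
  assumes "f \<in> borel_measurable M" "\<And>x. x \<in> space M \<Longrightarrow> \<bar>f x\<bar> \<le> K"
  shows "integrable M f"
  using assms by (intro integrable_const_bound[of _ K]) auto

lemma integral_PiM_component:
  fixes g :: "'a \<Rightarrow> real"
  assumes "prob_space M" "i \<in> I" "g \<in> borel_measurable M"
  shows "(\<integral>\<omega>. g (\<omega> i) \<partial>PiM I (\<lambda>_. M)) = (\<integral>x. g x \<partial>M)"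
proof -
  have "(\<integral>x. g x \<partial>distr (PiM I (\<lambda>_. M)) M (\<lambda>\<omega>. \<omega> i)) = (\<integral>\<omega>. g (\<omega> i) \<partial>PiM I (\<lambda>_. M))"
    using assms by (intro integral_distr) auto
  then show ?thesis using assms by (simp add: distr_PiM_component[where M = "\<lambda>_. M"])
qed

text \<open>After expanding the square, independence and the zero mean remove every off-diagonal
  term.\<close>

lemma iid_mean_second_moment:
  fixes h :: "'a \<Rightarrow> real"
  assumes M: "prob_space M" and h [measurable]: "h \<in> borel_measurable M"
    and K: "\<And>x. x \<in> space M \<Longrightarrow> \<bar>h x\<bar> \<le> K"
    and h0: "(\<integral>x. h x \<partial>M) = 0" and n: "n \<ge> 1"
  shows "(\<integral>\<omega>. ((\<Sum>i=1..n. h (\<omega> i)) / real n)\<^sup>2 \<partial>PiM {1..n} (\<lambda>_. M)) = (\<integral>x. (h x)\<^sup>2 \<partial>M) / real n"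
proof -
  interpret M: prob_space M by fact
  interpret P: product_prob_space "\<lambda>_. M" "{1..n}" by unfold_locales
  let ?P = "PiM {1..n} (\<lambda>_. M)"
  have sp: "\<omega> i \<in> space M" if "\<omega> \<in> space ?P" "i \<in> {1..n}" for \<omega> i
    using that by (auto simp: space_PiM)
  have int: "integrable ?P (\<lambda>\<omega>. h (\<omega> i) * h (\<omega> j))" if "i \<in> {1..n}" "j \<in> {1..n}" for i j
  proof (rule P.P.integrable_bounded_real[of _ "\<bar>K\<bar> * \<bar>K\<bar>"])
    show "(\<lambda>\<omega>. h (\<omega> i) * h (\<omega> j)) \<in> borel_measurable ?P" using that by measurable
    fix \<omega> assume "\<omega> \<in> space ?P"
    then have "\<bar>h (\<omega> i)\<bar> \<le> \<bar>K\<bar>" "\<bar>h (\<omega> j)\<bar> \<le> \<bar>K\<bar>"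
      using K[OF sp, of \<omega>] that by (meson abs_ge_self order_trans)+
    then show "\<bar>h (\<omega> i) * h (\<omega> j)\<bar> \<le> \<bar>K\<bar> * \<bar>K\<bar>" by (simp only: abs_mult) (intro mult_mono, auto)
  qed
  have hi: "integrable M h" using K by (intro M.integrable_bounded_real) auto
  have val: "(\<integral>\<omega>. h (\<omega> i) * h (\<omega> j) \<partial>?P) = (if i = j then (\<integral>x. (h x)\<^sup>2 \<partial>M) else 0)"
    if ij: "i \<in> {1..n}" "j \<in> {1..n}" for i j
  proof (cases "i = j")
    case True
    then show ?thesis using integral_PiM_component[OF M ij(1), of "\<lambda>x. h x * h x"]
      by (simp add: power2_eq_square)
  next
    case False
    \<comment> \<open>Padding with the constant 1 writes the product of two coordinates as a product
      over all coordinates, the form to which the product integral applies.\<close>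
    define f where "f l = (if l = i \<or> l = j then h else (\<lambda>_. 1))" for l
    have "h (\<omega> i) * h (\<omega> j) = (\<Prod>l\<in>{1..n}. f l (\<omega> l))" for \<omega> :: "nat \<Rightarrow> 'a"
    proof -
      have "(\<Prod>l\<in>{1..n}. f l (\<omega> l)) = (\<Prod>l\<in>{i, j}. f l (\<omega> l))"
        using ij by (intro prod.mono_neutral_right) (auto simp: f_def)
      then show ?thesis using False by (simp add: f_def)
    qed
    then have "(\<integral>\<omega>. h (\<omega> i) * h (\<omega> j) \<partial>?P) = (\<Prod>l\<in>{1..n}. \<integral>x. f l x \<partial>M)"
      using hi by (simp only:) (intro P.product_integral_prod, auto simp: f_def)
    also have "\<dots> = 0" using ij h0 by (intro prod_zero) (auto simp: f_def)
    finally show ?thesis using False by simp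
  qed
  have "(\<integral>\<omega>. ((\<Sum>i=1..n. h (\<omega> i)) / real n)\<^sup>2 \<partial>?P)
      = (\<integral>\<omega>. (\<Sum>i=1..n. \<Sum>j=1..n. h (\<omega> i) * h (\<omega> j)) / (real n)\<^sup>2 \<partial>?P)"
    by (simp add: power_divide power2_eq_square sum_product)
  also have "\<dots> = (\<Sum>i=1..n. \<Sum>j=1..n. (\<integral>\<omega>. h (\<omega> i) * h (\<omega> j) \<partial>?P)) / (real n)\<^sup>2"
    unfolding integral_divide_zero
    by (subst Bochner_Integration.integral_sum; intro Bochner_Integration.integrable_sum int
        arg_cong2[of _ _ _ _ "(/)"] sum.cong refl Bochner_Integration.integral_sum)
  also have "\<dots> = (\<Sum>i=1..n. \<Sum>j=1..n. if i = j then (\<integral>x. (h x)\<^sup>2 \<partial>M) else 0) / (real n)\<^sup>2"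
    by (intro arg_cong2[of _ _ _ _ "(/)"] sum.cong val refl)
  also have "\<dots> = (\<integral>x. (h x)\<^sup>2 \<partial>M) / real n"
    using n by (simp add: power2_eq_square)
  finally show ?thesis .
qed

text \<open>The mean absolute value is at most the root mean square, and the variance is at most the
  raw second moment.\<close>

lemma iid_mean_abs_deviation:
  fixes g :: "'a \<Rightarrow> real"
  assumes M: "prob_space M" and g [measurable]: "g \<in> borel_measurable M"
    and K: "\<And>x. x \<in> space M \<Longrightarrow> \<bar>g x\<bar> \<le> K" and n: "n \<ge> 1"
  shows "(\<integral>\<omega>. \<bar>(\<Sum>i=1..n. g (\<omega> i)) / real n - (\<integral>x. g x \<partial>M)\<bar> \<partial>PiM {1..n} (\<lambda>_. M))
     \<le> sqrt ((\<integral>x. (g x)\<^sup>2 \<partial>M) / real n)"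
proof -
  interpret M: prob_space M by fact
  interpret P: product_prob_space "\<lambda>_. M" "{1..n}" by unfold_locales
  let ?P = "PiM {1..n} (\<lambda>_. M)"
  define h where "h x = g x - (\<integral>x. g x \<partial>M)" for x
  define K' where "K' = K + \<bar>\<integral>x. g x \<partial>M\<bar>"
  have h [measurable]: "h \<in> borel_measurable M" unfolding h_def by measurable
  have hK: "\<bar>h x\<bar> \<le> K'" if "x \<in> space M" for x
    using K[OF that] unfolding h_def K'_def by linarith
  have gi: "integrable M g" using K by (intro M.integrable_bounded_real) auto
  have gi2: "integrable M (\<lambda>x. (g x)\<^sup>2)"
  proof (intro M.integrable_bounded_real[of _ "K\<^sup>2"])
    fix x assume "x \<in> space M"
    then show "\<bar>(g x)\<^sup>2\<bar> \<le> K\<^sup>2" using power_mono[OF K abs_ge_zero, of x 2] by simp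
  qed simp
  have h0: "(\<integral>x. h x \<partial>M) = 0" unfolding h_def using gi by (simp add: M.prob_space)
  have h2: "(\<integral>x. (h x)\<^sup>2 \<partial>M) \<le> (\<integral>x. (g x)\<^sup>2 \<partial>M)"
    using M.variance_eq[OF gi gi2] by (simp add: h_def)
  define Z where "Z \<omega> = (\<Sum>i=1..n. h (\<omega> i)) / real n" for \<omega>
  have Zm [measurable]: "Z \<in> borel_measurable ?P" unfolding Z_def by measurable
  have ZK: "\<bar>Z \<omega>\<bar> \<le> K'" if "\<omega> \<in> space ?P" for \<omega>
  proof -
    have "\<bar>\<Sum>i=1..n. h (\<omega> i)\<bar> \<le> (\<Sum>i=1..n. \<bar>h (\<omega> i)\<bar>)" by (rule sum_abs)
    also have "\<dots> \<le> (\<Sum>i=1..n. K')" using that by (intro sum_mono hK) (auto simp: space_PiM)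
    finally show ?thesis using n by (simp add: Z_def field_simps)
  qed
  have "(\<Sum>i=1..n. g (\<omega> i)) / real n - (\<integral>x. g x \<partial>M) = Z \<omega>" for \<omega>
    using n by (simp add: Z_def h_def sum_subtractf field_simps)
  then have "(\<integral>\<omega>. \<bar>(\<Sum>i=1..n. g (\<omega> i)) / real n - (\<integral>x. g x \<partial>M)\<bar> \<partial>?P) = (\<integral>\<omega>. \<bar>Z \<omega>\<bar> \<partial>?P)"
    by simp
  also have "\<dots> \<le> sqrt (\<integral>\<omega>. (Z \<omega>)\<^sup>2 \<partial>?P)"
  proof (rule P.P.expectation_abs_le_sqrt)
    show "integrable ?P Z" using ZK by (intro P.P.integrable_bounded_real) auto
    show "integrable ?P (\<lambda>\<omega>. (Z \<omega>)\<^sup>2)"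
    proof (rule P.P.integrable_bounded_real[of _ "K'\<^sup>2"])
      fix \<omega> assume "\<omega> \<in> space ?P"
      then show "\<bar>(Z \<omega>)\<^sup>2\<bar> \<le> K'\<^sup>2" using power_mono[OF ZK abs_ge_zero, of \<omega> 2] by simp
    qed simp
  qed
  also have "(\<integral>\<omega>. (Z \<omega>)\<^sup>2 \<partial>?P) = (\<integral>x. (h x)\<^sup>2 \<partial>M) / real n"
    unfolding Z_def by (rule iid_mean_second_moment[OF M h hK h0 n])
  also have "sqrt \<dots> \<le> sqrt ((\<integral>x. (g x)\<^sup>2 \<partial>M) / real n)"
    using h2 by (intro real_sqrt_le_mono divide_right_mono) auto
  finally show ?thesis .
qed

lemma emp_cdf_range: "emp_cdf n X x \<in> {0..1}"
proof -
  have "(\<Sum>i=1..n. if X i \<le> x then 1 else 0) \<le> (\<Sum>i=1..n. 1::real)" by (intro sum_mono) auto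
  then show ?thesis unfolding emp_cdf_def by (auto intro!: sum_nonneg divide_nonneg_nonneg simp: divide_le_eq_1)
qed

text \<open>Measurability is joint in the sample and in the evaluation point, as the later uses of
  Fubini require.\<close>

lemma emp_cdf_measurable [measurable (raw)]:
  assumes f: "f \<in> measurable N (PiM {1..n} (\<lambda>_. M))" and M: "sets M = sets borel"
    and [measurable]: "g \<in> borel_measurable N"
  shows "(\<lambda>p. emp_cdf n (f p) (g p)) \<in> borel_measurable N"
proof -
  have [measurable]: "(\<lambda>p. f p i) \<in> borel_measurable N" if "i \<in> {1..n}" for i
    using measurable_compose[OF f measurable_component_singleton[OF that]]
    by (simp add: measurable_cong_sets[OF refl M])
  show ?thesis unfolding emp_cdf_def
    by (intro borel_measurable_divide borel_measurable_sum borel_measurable_const measurable_If)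
       measurable
qed

section \<open>Deviation of the statistic for fixed sample sizes\<close>

locale two_sample = X: real_distribution \<mu> + Y: real_distribution \<nu>
  for \<mu> \<nu> :: "real measure" +
  fixes n m :: nat
  assumes n: "n \<ge> 1" and m: "m \<ge> 1"
begin

abbreviation PX :: "(nat \<Rightarrow> real) measure" where "PX \<equiv> PiM {1..n} (\<lambda>_. \<mu>)"
abbreviation PY :: "(nat \<Rightarrow> real) measure" where "PY \<equiv> PiM {1..m} (\<lambda>_. \<nu>)"

text \<open>This is \<open>psi_hat\<close> with an arbitrary score \<open>f\<close> in place of the
  basis functions.\<close>

definition stat :: "(real \<Rightarrow> real) \<Rightarrow> (nat \<Rightarrow> real) \<Rightarrow> (nat \<Rightarrow> real) \<Rightarrow> real" where
  "stat f x y = (\<Sum>j=1..m. f (emp_cdf n x (y j))) / real m"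

definition pop_mean :: "(real \<Rightarrow> real) \<Rightarrow> real" where
  "pop_mean f = (\<integral>y. f (cdf \<mu> y) \<partial>\<nu>)"

sublocale PX: product_prob_space "\<lambda>_. \<mu>" "{1..n}" by unfold_locales
sublocale PY: product_prob_space "\<lambda>_. \<nu>" "{1..m}" by unfold_locales
sublocale PXY: pair_prob_space PX PY by unfold_locales
sublocale PX\<nu>: pair_prob_space PX \<nu> by unfold_locales

lemma cdf_range: "cdf \<mu> x \<in> {0..1}"
  using X.cdf_nonneg X.cdf_bounded_prob by simp

lemma cdf_measurable [measurable]: "cdf \<mu> \<in> borel_measurable borel"
  by (rule borel_measurable_mono) (auto simp: mono_def X.cdf_nondecreasing)

lemma emp_cdf_meas [measurable (raw)]:
  assumes "f \<in> measurable N PX" "g \<in> borel_measurable N"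
  shows "(\<lambda>p. emp_cdf n (f p) (g p)) \<in> borel_measurable N"
  using emp_cdf_measurable[OF assms(1) X.events_eq_borel assms(2)] .

lemma emp_cdf_error_le_1: "\<bar>emp_cdf n x y - cdf \<mu> y\<bar> \<le> 1"
  using emp_cdf_range[of n x y] cdf_range[of y] by auto

lemma emp_cdf_error_sq_le_1: "(emp_cdf n x y - cdf \<mu> y)\<^sup>2 \<le> 1"
  using emp_cdf_error_le_1[of x y] by (simp add: abs_square_le_1)

lemma integral_le_indicator: "(\<integral>u. (if u \<le> y then 1 else 0 :: real) \<partial>\<mu>) = cdf \<mu> y"
proof -
  have "(\<integral>u. (if u \<le> y then 1 else 0 :: real) \<partial>\<mu>) = (\<integral>u. indicat_real {..y} u \<partial>\<mu>)"
    by (intro Bochner_Integration.integral_cong) auto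
  also have "\<dots> = cdf \<mu> y" by (simp add: cdf_def)
  finally show ?thesis .
qed

text \<open>The error is an i.i.d. mean of centred indicators, each bounded by 1.\<close>

lemma emp_cdf_second_moment: "(\<integral>x. (emp_cdf n x y - cdf \<mu> y)\<^sup>2 \<partial>PX) \<le> 1 / real n"
proof -
  define h where "h u = (if u \<le> y then 1 else 0) - cdf \<mu> y" for u
  have hm: "h \<in> borel_measurable \<mu>" unfolding h_def by measurable
  have h1: "\<bar>h u\<bar> \<le> 1" for u using cdf_range[of y] by (auto simp: h_def)
  have h0: "(\<integral>u. h u \<partial>\<mu>) = 0"
    unfolding h_def
    by (subst Bochner_Integration.integral_diff)
       (auto intro!: X.integrable_bounded_real[of _ 1] simp: X.prob_space[simplified] integral_le_indicator)
  have "emp_cdf n x y - cdf \<mu> y = (\<Sum>i=1..n. h (x i)) / real n" for x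
    using n by (simp add: emp_cdf_def h_def sum_subtractf field_simps)
  then have "(\<integral>x. (emp_cdf n x y - cdf \<mu> y)\<^sup>2 \<partial>PX) = (\<integral>u. (h u)\<^sup>2 \<partial>\<mu>) / real n"
    using iid_mean_second_moment[OF X.prob_space_axioms hm h1 h0 n] by simp
  also have "(\<integral>u. (h u)\<^sup>2 \<partial>\<mu>) \<le> (\<integral>u. 1 \<partial>\<mu>)"
    using hm h1
    by (intro integral_mono X.integrable_bounded_real[of _ 1]) (auto simp: abs_square_le_1)
  finally show ?thesis using n by (simp add: divide_right_mono X.prob_space[simplified])
qed

lemma emp_cdf_integrable:
  "integrable (PX \<Otimes>\<^sub>M \<nu>) (\<lambda>(x, y). (emp_cdf n x y - cdf \<mu> y)\<^sup>2)"
  by (rule PX\<nu>.P.integrable_bounded_real[of _ 1]) (auto simp: emp_cdf_error_sq_le_1)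

lemma emp_cdf_mean_square: "(\<integral>x. (\<integral>y. (emp_cdf n x y - cdf \<mu> y)\<^sup>2 \<partial>\<nu>) \<partial>PX) \<le> 1 / real n"
proof -
  have "(\<integral>x. (\<integral>y. (emp_cdf n x y - cdf \<mu> y)\<^sup>2 \<partial>\<nu>) \<partial>PX)
      = (\<integral>y. (\<integral>x. (emp_cdf n x y - cdf \<mu> y)\<^sup>2 \<partial>PX) \<partial>\<nu>)"
    by (rule PX\<nu>.Fubini_integral[symmetric]) (rule emp_cdf_integrable)
  also have "\<dots> \<le> (\<integral>y. 1 / real n \<partial>\<nu>)"
    by (intro integral_mono emp_cdf_second_moment PX\<nu>.integrable_snd emp_cdf_integrable) simp
  finally show ?thesis by (simp add: Y.prob_space[simplified])
qed


text \<open>Squared L2 distance of the empirical from the true distribution function under the law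
  of Y. It depends on the first sample only, and its mean of at most 1/n controls both the Lipschitz
  and the quadratic error.\<close>

definition sq_err :: "(nat \<Rightarrow> real) \<Rightarrow> real" where
  "sq_err x = (\<integral>y. (emp_cdf n x y - cdf \<mu> y)\<^sup>2 \<partial>\<nu>)"

lemma sq_err_measurable [measurable]: "sq_err \<in> borel_measurable PX"
  unfolding sq_err_def by measurable

lemma sq_err_nonneg: "sq_err x \<ge> 0"
  by (simp add: sq_err_def)

lemma emp_cdf_measurable_snd: "x \<in> space PX \<Longrightarrow> (\<lambda>y. emp_cdf n x y) \<in> borel_measurable \<nu>"
  by measurable

lemma sq_err_le_1:
  assumes "x \<in> space PX"
  shows "sq_err x \<le> 1"
proof -
  note emp_cdf_measurable_snd[OF assms, measurable]
  have "sq_err x \<le> (\<integral>y. 1 \<partial>\<nu>)" unfolding sq_err_def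
    by (intro integral_mono Y.integrable_bounded_real[of _ 1]) (auto simp: emp_cdf_error_sq_le_1)
  then show ?thesis by (simp add: Y.prob_space[simplified])
qed

lemma sq_err_integrable: "integrable PX sq_err"
  using sq_err_nonneg sq_err_le_1 by (intro PX.P.integrable_bounded_real[of _ 1]) auto

lemma sqrt_sq_err_integrable: "integrable PX (\<lambda>x. sqrt (sq_err x))"
  using sq_err_nonneg sq_err_le_1 by (intro PX.P.integrable_bounded_real[of _ 1]) auto

lemma sq_err_mean: "(\<integral>x. sq_err x \<partial>PX) \<le> 1 / real n"
  using emp_cdf_mean_square by (simp add: sq_err_def)

lemma stat_measurable [measurable]:
  assumes [measurable]: "f \<in> borel_measurable borel"
  shows "(\<lambda>(x, y). stat f x y) \<in> borel_measurable (PX \<Otimes>\<^sub>M PY)"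
proof -
  have [measurable]: "(\<lambda>p. snd p j) \<in> borel_measurable (PX \<Otimes>\<^sub>M PY)" if "j \<in> {1..m}" for j
  proof -
    have "(\<lambda>p. snd p j) \<in> measurable (PX \<Otimes>\<^sub>M PY) \<nu>"
      by (rule measurable_compose[OF measurable_snd measurable_component_singleton[OF that]])
    then show ?thesis by (simp add: measurable_cong_sets[OF refl Y.events_eq_borel])
  qed
  have "(\<lambda>p. stat f (fst p) (snd p)) \<in> borel_measurable (PX \<Otimes>\<^sub>M PY)"
    unfolding stat_def by measurable
  then show ?thesis by (simp add: case_prod_beta)
qed

text \<open>Conditionally on the first sample, \<open>stat f\<close> is an average of independent terms
  around \<open>\<integral>y. f (emp_cdf n x y) \<partial>\<nu>\<close>.\<close>
lemma stat_deviation_decomposition: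
  assumes f [measurable]: "f \<in> borel_measurable borel"
    and B: "\<And>u. u \<in> {0..1} \<Longrightarrow> \<bar>f u\<bar> \<le> B"
  shows "(\<integral>p. \<bar>stat f (fst p) (snd p) - pop_mean f\<bar> \<partial>(PX \<Otimes>\<^sub>M PY))
    \<le> (\<integral>x. sqrt ((\<integral>y. (f (emp_cdf n x y))\<^sup>2 \<partial>\<nu>) / real m) \<partial>PX)
      + (\<integral>x. \<bar>(\<integral>y. f (emp_cdf n x y) \<partial>\<nu>) - pop_mean f\<bar> \<partial>PX)"
proof -
  define e where "e = pop_mean f"
  define G where "G x = (\<integral>y. (f (emp_cdf n x y))\<^sup>2 \<partial>\<nu>)" for x
  define A where "A x = (\<integral>y. f (emp_cdf n x y) \<partial>\<nu>)" for x
  have fB: "\<bar>f (emp_cdf n x y)\<bar> \<le> B" for x y by (intro B emp_cdf_range)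
  have B0: "B \<ge> 0" using B[of 0] by auto
  have fB2: "(f (emp_cdf n x y))\<^sup>2 \<le> B\<^sup>2" for x y using power_mono[OF fB abs_ge_zero, of x y 2] by simp
  have Gm [measurable]: "G \<in> borel_measurable PX" unfolding G_def by measurable
  have Am [measurable]: "A \<in> borel_measurable PX" unfolding A_def by measurable
  have fm [measurable]: "(\<lambda>y. f (emp_cdf n x y)) \<in> borel_measurable \<nu>" if "x \<in> space PX" for x
    using that by measurable
  have i1: "integrable \<nu> (\<lambda>y. f (emp_cdf n x y))" if "x \<in> space PX" for x
    using fB fm[OF that] by (intro Y.integrable_bounded_real[of _ B])
  have i2: "integrable \<nu> (\<lambda>y. (f (emp_cdf n x y))\<^sup>2)" if "x \<in> space PX" for x
    using fB2 fm[OF that] by (intro Y.integrable_bounded_real[of _ "B\<^sup>2"]) auto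
  have G0: "G x \<ge> 0" for x by (simp add: G_def)
  have GB: "G x \<le> B\<^sup>2" if "x \<in> space PX" for x
    using integral_mono[OF i2[OF that], of "\<lambda>_. B\<^sup>2"] fB2 by (simp add: G_def Y.prob_space[simplified])
  have AB: "\<bar>A x\<bar> \<le> B" if "x \<in> space PX" for x
  proof -
    have "\<bar>A x\<bar> \<le> (\<integral>y. \<bar>f (emp_cdf n x y)\<bar> \<partial>\<nu>)" unfolding A_def by (rule integral_abs_bound)
    also have "\<dots> \<le> (\<integral>y. B \<partial>\<nu>)" using i1[OF that] fB by (intro integral_mono) auto
    finally show ?thesis by (simp add: Y.prob_space[simplified])
  qed
  have sB: "\<bar>stat f x y\<bar> \<le> B" for x y
  proof -
    have "\<bar>\<Sum>j=1..m. f (emp_cdf n x (y j))\<bar> \<le> (\<Sum>j=1..m. \<bar>f (emp_cdf n x (y j))\<bar>)" by (rule sum_abs)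
    also have "\<dots> \<le> (\<Sum>j=1..m. B)" by (intro sum_mono fB)
    finally show ?thesis using m by (simp add: stat_def field_simps)
  qed
  have sm: "stat f x \<in> borel_measurable PY" if "x \<in> space PX" for x
    using measurable_compose_Pair1[OF that stat_measurable[OF f]] by simp
  have sc: "\<bar>stat f x y - c\<bar> \<le> B + \<bar>c\<bar>" for x y c using sB[of x y] by linarith
  have si: "integrable PY (\<lambda>y. \<bar>stat f x y - c\<bar>)" if "x \<in> space PX" for x c
    using sm[OF that] sc[of x _ c] by (intro PY.P.integrable_bounded_real[of _ "B + \<bar>c\<bar>"]) auto
  have pint: "integrable (PX \<Otimes>\<^sub>M PY) (\<lambda>(x, y). \<bar>stat f x y - e\<bar>)"
    using sc[of _ _ e] by (intro PXY.P.integrable_bounded_real[of _ "B + \<bar>e\<bar>"]) auto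
  have inner: "(\<integral>y. \<bar>stat f x y - e\<bar> \<partial>PY) \<le> sqrt (G x / real m) + \<bar>A x - e\<bar>" if x: "x \<in> space PX" for x
  proof -
    have "(\<integral>y. \<bar>stat f x y - e\<bar> \<partial>PY) \<le> (\<integral>y. \<bar>stat f x y - A x\<bar> + \<bar>A x - e\<bar> \<partial>PY)"
      using si[OF x] by (intro integral_mono) auto
    also have "\<dots> = (\<integral>y. \<bar>stat f x y - A x\<bar> \<partial>PY) + \<bar>A x - e\<bar>"
      using si[OF x] by (simp add: PY.P.prob_space)
    also have "(\<integral>y. \<bar>stat f x y - A x\<bar> \<partial>PY) \<le> sqrt (G x / real m)"
      unfolding stat_def A_def G_def
      by (rule iid_mean_abs_deviation[OF Y.prob_space_axioms fm[OF x] fB m])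
    finally show ?thesis by simp
  qed
  have "(\<integral>p. \<bar>stat f (fst p) (snd p) - e\<bar> \<partial>(PX \<Otimes>\<^sub>M PY)) = (\<integral>(x, y). \<bar>stat f x y - e\<bar> \<partial>(PX \<Otimes>\<^sub>M PY))"
    by (simp add: case_prod_unfold)
  also have "\<dots> = (\<integral>x. (\<integral>y. \<bar>stat f x y - e\<bar> \<partial>PY) \<partial>PX)"
    using PXY.integral_fst'[OF pint] by simp
  also have "\<dots> \<le> (\<integral>x. sqrt (G x / real m) + \<bar>A x - e\<bar> \<partial>PX)"
  proof (intro integral_mono inner)
    show "integrable PX (\<lambda>x. \<integral>y. \<bar>stat f x y - e\<bar> \<partial>PY)"
      using PXY.integrable_fst'[OF pint] by simp
    show "integrable PX (\<lambda>x. sqrt (G x / real m) + \<bar>A x - e\<bar>)"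
    proof (rule PX.P.integrable_bounded_real[of _ "sqrt (B\<^sup>2 / real m) + (B + \<bar>e\<bar>)"])
      fix x assume x: "x \<in> space PX"
      have "sqrt (G x / real m) \<le> sqrt (B\<^sup>2 / real m)"
        using GB[OF x] by (intro real_sqrt_le_mono divide_right_mono) auto
      moreover have "0 \<le> sqrt (G x / real m)" using G0[of x] by simp
      ultimately show "\<bar>sqrt (G x / real m) + \<bar>A x - e\<bar>\<bar> \<le> sqrt (B\<^sup>2 / real m) + (B + \<bar>e\<bar>)"
        using AB[OF x] by linarith
    qed measurable
  qed
  also have "\<dots> = (\<integral>x. sqrt (G x / real m) \<partial>PX) + (\<integral>x. \<bar>A x - e\<bar> \<partial>PX)"
  proof (rule Bochner_Integration.integral_add)
    show "integrable PX (\<lambda>x. sqrt (G x / real m))"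
    proof (rule PX.P.integrable_bounded_real[of _ "sqrt (B\<^sup>2 / real m)"])
      fix x assume x: "x \<in> space PX"
      have "sqrt (G x / real m) \<le> sqrt (B\<^sup>2 / real m)"
        using GB[OF x] by (intro real_sqrt_le_mono divide_right_mono) auto
      then show "\<bar>sqrt (G x / real m)\<bar> \<le> sqrt (B\<^sup>2 / real m)" using G0[of x] by simp
    qed measurable
    show "integrable PX (\<lambda>x. \<bar>A x - e\<bar>)"
    proof (rule PX.P.integrable_bounded_real[of _ "B + \<bar>e\<bar>"])
      fix x assume x: "x \<in> space PX"
      show "\<bar>\<bar>A x - e\<bar>\<bar> \<le> B + \<bar>e\<bar>" using AB[OF x] by linarith
    qed measurable
  qed
  finally show ?thesis unfolding G_def A_def e_def .
qed

text \<open>The conditional sampling error uses only the bound on \<open>f\<close>. The conditional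
  bias is at most L times the mean of |F_n - F|, so two passages from first to second moments, over
  Y and then over the first sample, give L / sqrt n.\<close>

lemma stat_deviation_crude:
  assumes f [measurable]: "f \<in> borel_measurable borel"
    and B: "\<And>u. u \<in> {0..1} \<Longrightarrow> \<bar>f u\<bar> \<le> B"
    and L: "\<And>u v. u \<in> {0..1} \<Longrightarrow> v \<in> {0..1} \<Longrightarrow> \<bar>f u - f v\<bar> \<le> L * \<bar>u - v\<bar>" and L0: "L \<ge> 0"
  shows "(\<integral>p. \<bar>stat f (fst p) (snd p) - pop_mean f\<bar> \<partial>(PX \<Otimes>\<^sub>M PY)) \<le> B / sqrt m + L / sqrt n"
proof -
  have fB: "\<bar>f (emp_cdf n x y)\<bar> \<le> B" for x y by (intro B emp_cdf_range)
  have B0: "B \<ge> 0" using B[of 0] by auto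
  have fB2: "(f (emp_cdf n x y))\<^sup>2 \<le> B\<^sup>2" for x y using power_mono[OF fB abs_ge_zero, of x y 2] by simp
  have fm [measurable]: "(\<lambda>y. f (emp_cdf n x y)) \<in> borel_measurable \<nu>" if "x \<in> space PX" for x
    using that by measurable
  have em [measurable]: "(\<lambda>y. emp_cdf n x y) \<in> borel_measurable \<nu>" if "x \<in> space PX" for x
    using that by measurable
  have t1: "(\<integral>x. sqrt ((\<integral>y. (f (emp_cdf n x y))\<^sup>2 \<partial>\<nu>) / real m) \<partial>PX) \<le> B / sqrt m"
  proof -
    have pt: "sqrt ((\<integral>y. (f (emp_cdf n x y))\<^sup>2 \<partial>\<nu>) / real m) \<le> B / sqrt m" if "x \<in> space PX" for x
    proof -
      have "(\<integral>y. (f (emp_cdf n x y))\<^sup>2 \<partial>\<nu>) \<le> (\<integral>y. B\<^sup>2 \<partial>\<nu>)"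
        using fB2 fm[OF that] by (intro integral_mono Y.integrable_bounded_real[of _ "B\<^sup>2"]) auto
      then have "sqrt ((\<integral>y. (f (emp_cdf n x y))\<^sup>2 \<partial>\<nu>) / real m) \<le> sqrt (B\<^sup>2 / real m)"
        by (intro real_sqrt_le_mono divide_right_mono) (auto simp: Y.prob_space[simplified])
      then show ?thesis using B0 by (simp add: real_sqrt_divide)
    qed
    have "(\<integral>x. sqrt ((\<integral>y. (f (emp_cdf n x y))\<^sup>2 \<partial>\<nu>) / real m) \<partial>PX) \<le> (\<integral>x. B / sqrt m \<partial>PX)"
    proof (intro integral_mono pt)
      show "integrable PX (\<lambda>x. sqrt ((\<integral>y. (f (emp_cdf n x y))\<^sup>2 \<partial>\<nu>) / real m))"
        using pt by (intro PX.P.integrable_bounded_real[of _ "B / sqrt m"]) auto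
    qed auto
    then show ?thesis by (simp add: PX.P.prob_space)
  qed
  have pt: "\<bar>(\<integral>y. f (emp_cdf n x y) \<partial>\<nu>) - pop_mean f\<bar> \<le> L * sqrt (sq_err x)" if x: "x \<in> space PX" for x
  proof -
    note em[OF x, measurable]
    have ie: "integrable \<nu> (\<lambda>y. emp_cdf n x y - cdf \<mu> y)" "integrable \<nu> (\<lambda>y. (emp_cdf n x y - cdf \<mu> y)\<^sup>2)"
      by (auto intro!: Y.integrable_bounded_real[of _ 1] simp: emp_cdf_error_le_1 emp_cdf_error_sq_le_1)
    have if': "integrable \<nu> (\<lambda>y. f (emp_cdf n x y))" "integrable \<nu> (\<lambda>y. f (cdf \<mu> y))"
      by (auto intro!: Y.integrable_bounded_real[of _ B] fB B[OF cdf_range])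
    have "(\<integral>y. f (emp_cdf n x y) \<partial>\<nu>) - pop_mean f = (\<integral>y. f (emp_cdf n x y) - f (cdf \<mu> y) \<partial>\<nu>)"
      unfolding pop_mean_def using if' by simp
    also have "\<bar>\<dots>\<bar> \<le> (\<integral>y. \<bar>f (emp_cdf n x y) - f (cdf \<mu> y)\<bar> \<partial>\<nu>)" by (rule integral_abs_bound)
    also have "\<dots> \<le> (\<integral>y. L * \<bar>emp_cdf n x y - cdf \<mu> y\<bar> \<partial>\<nu>)"
      using if' ie by (intro integral_mono L emp_cdf_range cdf_range) auto
    also have "\<dots> = L * (\<integral>y. \<bar>emp_cdf n x y - cdf \<mu> y\<bar> \<partial>\<nu>)" by simp
    also have "\<dots> \<le> L * sqrt (sq_err x)"
      unfolding sq_err_def by (intro mult_left_mono L0 Y.expectation_abs_le_sqrt ie)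
    finally show ?thesis .
  qed
  have "(\<integral>x. \<bar>(\<integral>y. f (emp_cdf n x y) \<partial>\<nu>) - pop_mean f\<bar> \<partial>PX) \<le> (\<integral>x. L * sqrt (sq_err x) \<partial>PX)"
  proof (intro integral_mono pt)
    show "integrable PX (\<lambda>x. \<bar>(\<integral>y. f (emp_cdf n x y) \<partial>\<nu>) - pop_mean f\<bar>)"
    proof (rule PX.P.integrable_bounded_real[of _ L])
      fix x assume x: "x \<in> space PX"
      have "L * sqrt (sq_err x) \<le> L * 1" using L0 sq_err_le_1[OF x] by (intro mult_left_mono) auto
      then show "\<bar>\<bar>(\<integral>y. f (emp_cdf n x y) \<partial>\<nu>) - pop_mean f\<bar>\<bar> \<le> L" using pt[OF x] by simp
    qed measurable
  qed (use sqrt_sq_err_integrable in simp)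
  also have "\<dots> = L * (\<integral>x. \<bar>sqrt (sq_err x)\<bar> \<partial>PX)" using sq_err_nonneg by simp
  also have "\<dots> \<le> L * sqrt (\<integral>x. (sqrt (sq_err x))\<^sup>2 \<partial>PX)"
    using sq_err_integrable sq_err_nonneg by (intro mult_left_mono L0 PX.P.expectation_abs_le_sqrt sqrt_sq_err_integrable) simp
  also have "\<dots> \<le> L * sqrt (1 / n)"
    using sq_err_mean sq_err_nonneg by (intro mult_left_mono L0 real_sqrt_le_mono) simp
  also have "\<dots> = L / sqrt n" by (simp add: real_sqrt_divide)
  finally show ?thesis using t1 stat_deviation_decomposition[OF f B] by simp
qed


text \<open>With g the derivative of a score f, this is the first-order effect of a single
  observation \<open>x\<close> of the first sample on the conditional mean of f(F_n(Y)).\<close>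

definition influence :: "(real \<Rightarrow> real) \<Rightarrow> real \<Rightarrow> real" where
  "influence g x = (\<integral>y. g (cdf \<mu> y) * ((if x \<le> y then 1 else 0) - cdf \<mu> y) \<partial>\<nu>)"

lemma influence_measurable [measurable]:
  assumes [measurable]: "g \<in> borel_measurable borel"
  shows "influence g \<in> borel_measurable \<mu>"
  unfolding influence_def by measurable

lemma influence_kernel_bound:
  assumes "\<And>u. u \<in> {0..1} \<Longrightarrow> \<bar>g u\<bar> \<le> L"
  shows "\<bar>g (cdf \<mu> y) * ((if x \<le> y then 1 else 0) - cdf \<mu> y)\<bar> \<le> L"
proof -
  have "\<bar>g (cdf \<mu> y)\<bar> * \<bar>(if x \<le> y then 1 else 0) - cdf \<mu> y\<bar> \<le> L * 1"
    using cdf_range[of y] assms[OF cdf_range, of y] by (intro mult_mono) auto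
  then show ?thesis by (simp add: abs_mult)
qed

lemma influence_kernel_integrable:
  assumes [measurable]: "g \<in> borel_measurable borel" and "\<And>u. u \<in> {0..1} \<Longrightarrow> \<bar>g u\<bar> \<le> L"
  shows "integrable \<nu> (\<lambda>y. g (cdf \<mu> y) * ((if x \<le> y then 1 else 0) - cdf \<mu> y))"
  by (rule Y.integrable_bounded_real[of _ L]) (measurable, intro influence_kernel_bound assms(2))

lemma influence_bound:
  assumes "g \<in> borel_measurable borel" and "\<And>u. u \<in> {0..1} \<Longrightarrow> \<bar>g u\<bar> \<le> L"
  shows "\<bar>influence g x\<bar> \<le> L"
proof -
  have "\<bar>influence g x\<bar> \<le> (\<integral>y. \<bar>g (cdf \<mu> y) * ((if x \<le> y then 1 else 0) - cdf \<mu> y)\<bar> \<partial>\<nu>)"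
    unfolding influence_def by (rule integral_abs_bound)
  also have "\<dots> \<le> (\<integral>y. L \<partial>\<nu>)"
    using influence_kernel_integrable[OF assms] influence_kernel_bound[of g L, OF assms(2)]
    by (intro integral_mono) (auto simp del: abs_mult)
  finally show ?thesis by (simp add: Y.prob_space[simplified])
qed

text \<open>By Fubini the integration over \<open>x\<close> comes first; for fixed y the indicator
  then has mean \<open>cdf \<mu> y\<close>.\<close>

lemma influence_mean_zero:
  assumes [measurable]: "g \<in> borel_measurable borel" and L: "\<And>u. u \<in> {0..1} \<Longrightarrow> \<bar>g u\<bar> \<le> L"
  shows "(\<integral>x. influence g x \<partial>\<mu>) = 0"
proof -
  interpret XY: pair_prob_space \<mu> \<nu> by unfold_locales
  have "(\<integral>x. influence g x \<partial>\<mu>)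
      = (\<integral>y. (\<integral>x. g (cdf \<mu> y) * ((if x \<le> y then 1 else 0) - cdf \<mu> y) \<partial>\<mu>) \<partial>\<nu>)"
    unfolding influence_def
  proof (rule XY.Fubini_integral[symmetric])
    show "integrable (\<mu> \<Otimes>\<^sub>M \<nu>) (\<lambda>(x, y). g (cdf \<mu> y) * ((if x \<le> y then 1 else 0) - cdf \<mu> y))"
      using influence_kernel_bound[of g L, OF L] by (intro XY.P.integrable_bounded_real[of _ L]) auto
  qed
  also have "\<dots> = (\<integral>y. 0 \<partial>\<nu>)"
  proof (intro Bochner_Integration.integral_cong refl)
    fix y
    have "(\<integral>x. (if x \<le> y then 1 else 0) - cdf \<mu> y \<partial>\<mu>) = 0"
      by (subst Bochner_Integration.integral_diff)
         (auto intro!: X.integrable_bounded_real[of _ 1] simp: X.prob_space[simplified] integral_le_indicator)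
    then show "(\<integral>x. g (cdf \<mu> y) * ((if x \<le> y then 1 else 0) - cdf \<mu> y) \<partial>\<mu>) = 0" by simp
  qed
  finally show ?thesis by simp
qed

text \<open>F_n is an average of indicators and the left side is linear in F_n, so the linear term
  is an i.i.d. mean to which the moment bound applies.\<close>

lemma influence_average:
  assumes [measurable]: "g \<in> borel_measurable borel" and L: "\<And>u. u \<in> {0..1} \<Longrightarrow> \<bar>g u\<bar> \<le> L"
  shows "(\<integral>y. g (cdf \<mu> y) * (emp_cdf n x y - cdf \<mu> y) \<partial>\<nu>) = (\<Sum>i=1..n. influence g (x i)) / real n"
proof -
  have "g (cdf \<mu> y) * (emp_cdf n x y - cdf \<mu> y)
      = (\<Sum>i=1..n. g (cdf \<mu> y) * ((if x i \<le> y then 1 else 0) - cdf \<mu> y)) / real n" for y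
    using n by (simp add: emp_cdf_def sum_subtractf sum_distrib_left [symmetric] field_simps)
  then have "(\<integral>y. g (cdf \<mu> y) * (emp_cdf n x y - cdf \<mu> y) \<partial>\<nu>)
      = (\<integral>y. (\<Sum>i=1..n. g (cdf \<mu> y) * ((if x i \<le> y then 1 else 0) - cdf \<mu> y)) \<partial>\<nu>) / real n"
    by simp
  also have "\<dots> = (\<Sum>i=1..n. influence g (x i)) / real n"
    unfolding influence_def
    by (subst Bochner_Integration.integral_sum) (auto intro: influence_kernel_integrable[OF assms])
  finally show ?thesis .
qed

text \<open>A Taylor expansion of \<open>f\<close> around F splits the conditional bias into a
  centred i.i.d. mean, of size sqrt (K / n), and a remainder of at most Q times
  \<open>sq_err\<close>. The conditional sampling error is compared with the second moment of f(V),
  which keeps the supremum \<open>B\<close> out of the bound.\<close>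

lemma stat_deviation_fine:
  assumes f [measurable]: "f \<in> borel_measurable borel" and g [measurable]: "g \<in> borel_measurable borel"
    and B: "\<And>u. u \<in> {0..1} \<Longrightarrow> \<bar>f u\<bar> \<le> B"
    and L: "\<And>u v. u \<in> {0..1} \<Longrightarrow> v \<in> {0..1} \<Longrightarrow> \<bar>f u - f v\<bar> \<le> L * \<bar>u - v\<bar>"
    and gL: "\<And>u. u \<in> {0..1} \<Longrightarrow> \<bar>g u\<bar> \<le> L"
    and Q: "\<And>u v. u \<in> {0..1} \<Longrightarrow> v \<in> {0..1} \<Longrightarrow> \<bar>f u - f v - g v * (u - v)\<bar> \<le> Q * (u - v)\<^sup>2"
    and K: "(\<integral>x. (influence g x)\<^sup>2 \<partial>\<mu>) \<le> K" and Q0: "Q \<ge> 0"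
  shows "(\<integral>p. \<bar>stat f (fst p) (snd p) - pop_mean f\<bar> \<partial>(PX \<Otimes>\<^sub>M PY))
     \<le> sqrt ((2 * pop_mean (\<lambda>u. (f u)\<^sup>2) + 2 * L\<^sup>2 / n) / m) + sqrt (K / n) + Q / n"
proof -
  have fB: "\<bar>f (emp_cdf n x y)\<bar> \<le> B" for x y by (intro B emp_cdf_range)
  have fB2: "(f (emp_cdf n x y))\<^sup>2 \<le> B\<^sup>2" for x y using power_mono[OF fB abs_ge_zero, of x y 2] by simp
  have fF2: "(f (cdf \<mu> y))\<^sup>2 \<le> B\<^sup>2" for y using power_mono[OF B[OF cdf_range] abs_ge_zero, of y 2] by simp
  define G where "G x = (\<integral>y. (f (emp_cdf n x y))\<^sup>2 \<partial>\<nu>)" for x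
  define V where "V = pop_mean (\<lambda>u. (f u)\<^sup>2)"
  have Gm [measurable]: "G \<in> borel_measurable PX" unfolding G_def by measurable
  have G0: "G x \<ge> 0" for x by (simp add: G_def)
  have GB: "G x \<le> 2 * V + 2 * L\<^sup>2 * sq_err x" if x: "x \<in> space PX" for x
  proof -
    note emp_cdf_measurable_snd[OF x, measurable]
    have i: "integrable \<nu> (\<lambda>y. (f (emp_cdf n x y))\<^sup>2)" "integrable \<nu> (\<lambda>y. (f (cdf \<mu> y))\<^sup>2)"
      using fB2 fF2 by (auto intro!: Y.integrable_bounded_real[of _ "B\<^sup>2"])
    have i': "integrable \<nu> (\<lambda>y. (emp_cdf n x y - cdf \<mu> y)\<^sup>2)"
      using emp_cdf_error_sq_le_1 by (auto intro!: Y.integrable_bounded_real[of _ 1])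
    have "G x \<le> (\<integral>y. 2 * (f (cdf \<mu> y))\<^sup>2 + 2 * L\<^sup>2 * (emp_cdf n x y - cdf \<mu> y)\<^sup>2 \<partial>\<nu>)"
      unfolding G_def
    proof (intro integral_mono)
      fix y
      let ?u = "emp_cdf n x y" and ?v = "cdf \<mu> y"
      have "(f ?u - f ?v)\<^sup>2 \<le> (L * \<bar>?u - ?v\<bar>)\<^sup>2"
        using power_mono[OF L[OF emp_cdf_range cdf_range] abs_ge_zero, of n x y y 2] by simp
      then have "(f ?u - f ?v)\<^sup>2 \<le> L\<^sup>2 * (?u - ?v)\<^sup>2" by (simp add: power_mult_distrib)
      \<comment> \<open>The difference of the two sides is the square (f u - 2 f v)^2.\<close>
      moreover have "(f ?u)\<^sup>2 \<le> 2 * (f ?v)\<^sup>2 + 2 * (f ?u - f ?v)\<^sup>2"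
        using zero_le_power2[of "f ?u - 2 * f ?v"] by (simp add: power2_eq_square algebra_simps)
      ultimately show "(f ?u)\<^sup>2 \<le> 2 * (f ?v)\<^sup>2 + 2 * L\<^sup>2 * (?u - ?v)\<^sup>2" by linarith
    qed (use i i' in auto)
    also have "\<dots> = 2 * V + 2 * L\<^sup>2 * sq_err x"
      using i i' by (simp add: V_def pop_mean_def sq_err_def)
    finally show ?thesis .
  qed
  have Gi: "integrable PX G"
  proof (rule PX.P.integrable_bounded_real[OF Gm])
    fix x assume x: "x \<in> space PX"
    have "2 * L\<^sup>2 * sq_err x \<le> 2 * L\<^sup>2 * 1" using sq_err_le_1[OF x] by (intro mult_left_mono) auto
    then show "\<bar>G x\<bar> \<le> 2 * V + 2 * L\<^sup>2" using GB[OF x] G0[of x] by simp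
  qed
  have sGi: "integrable PX (\<lambda>x. sqrt (G x / m))"
  proof (rule PX.P.integrable_bounded_real)
    fix x assume x: "x \<in> space PX"
    have "2 * L\<^sup>2 * sq_err x \<le> 2 * L\<^sup>2 * 1" using sq_err_le_1[OF x] by (intro mult_left_mono) auto
    then have "sqrt (G x / m) \<le> sqrt ((2 * V + 2 * L\<^sup>2) / m)"
      using GB[OF x] by (intro real_sqrt_le_mono divide_right_mono) auto
    then show "\<bar>sqrt (G x / m)\<bar> \<le> sqrt ((2 * V + 2 * L\<^sup>2) / m)" using G0[of x] by simp
  qed measurable
  have "(\<integral>x. G x \<partial>PX) \<le> (\<integral>x. 2 * V + 2 * L\<^sup>2 * sq_err x \<partial>PX)"
    using sq_err_integrable by (intro integral_mono GB Gi) auto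
  also have "\<dots> = 2 * V + 2 * L\<^sup>2 * (\<integral>x. sq_err x \<partial>PX)"
    using sq_err_integrable by (simp add: PX.P.prob_space)
  also have "\<dots> \<le> 2 * V + 2 * L\<^sup>2 * (1 / n)"
    by (intro add_left_mono mult_left_mono sq_err_mean) auto
  finally have GV: "(\<integral>x. G x \<partial>PX) \<le> 2 * V + 2 * L\<^sup>2 / n" by simp
  have "(\<integral>x. sqrt (G x / m) \<partial>PX) = (\<integral>x. \<bar>sqrt (G x / m)\<bar> \<partial>PX)" using G0 by simp
  also have "\<dots> \<le> sqrt (\<integral>x. (sqrt (G x / m))\<^sup>2 \<partial>PX)"
    using Gi G0 by (intro PX.P.expectation_abs_le_sqrt sGi) simp
  also have "\<dots> \<le> sqrt ((2 * V + 2 * L\<^sup>2 / n) / m)"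
    using GV G0 by (intro real_sqrt_le_mono) (simp add: divide_right_mono)
  finally have t1: "(\<integral>x. sqrt (G x / m) \<partial>PX) \<le> sqrt ((2 * V + 2 * L\<^sup>2 / n) / m)" .

  define W where "W x = (\<Sum>i=1..n. influence g (x i)) / real n" for x
  have Wm [measurable]: "W \<in> borel_measurable PX" unfolding W_def by measurable
  have WL: "\<bar>W x\<bar> \<le> L" for x
  proof -
    have "\<bar>\<Sum>i=1..n. influence g (x i)\<bar> \<le> (\<Sum>i=1..n. \<bar>influence g (x i)\<bar>)" by (rule sum_abs)
    also have "\<dots> \<le> (\<Sum>i=1..n. L)" by (intro sum_mono influence_bound[OF g gL])
    finally show ?thesis using n by (simp add: W_def field_simps)
  qed
  have Wi: "integrable PX W" using WL by (intro PX.P.integrable_bounded_real[of _ L]) auto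
  have W1: "(\<integral>x. \<bar>W x\<bar> \<partial>PX) \<le> sqrt (K / n)"
  proof -
    have "(\<integral>x. \<bar>W x\<bar> \<partial>PX) \<le> sqrt ((\<integral>x. (influence g x)\<^sup>2 \<partial>\<mu>) / real n)"
      using iid_mean_abs_deviation[OF X.prob_space_axioms influence_measurable[OF g] influence_bound[OF g gL] n]
        influence_mean_zero[OF g gL] by (simp add: W_def)
    also have "\<dots> \<le> sqrt (K / n)" using K by (intro real_sqrt_le_mono divide_right_mono) auto
    finally show ?thesis .
  qed
  have pt: "\<bar>(\<integral>y. f (emp_cdf n x y) \<partial>\<nu>) - pop_mean f\<bar> \<le> \<bar>W x\<bar> + Q * sq_err x" if x: "x \<in> space PX" for x
  proof -
    note emp_cdf_measurable_snd[OF x, measurable]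
    have ie: "integrable \<nu> (\<lambda>y. (emp_cdf n x y - cdf \<mu> y)\<^sup>2)"
      by (auto intro!: Y.integrable_bounded_real[of _ 1] simp: emp_cdf_error_sq_le_1)
    have if': "integrable \<nu> (\<lambda>y. f (emp_cdf n x y))" "integrable \<nu> (\<lambda>y. f (cdf \<mu> y))"
      by (auto intro!: Y.integrable_bounded_real[of _ B] fB B[OF cdf_range])
    have ig: "integrable \<nu> (\<lambda>y. g (cdf \<mu> y) * (emp_cdf n x y - cdf \<mu> y))"
    proof (rule Y.integrable_bounded_real[of _ L])
      fix y
      have "\<bar>g (cdf \<mu> y)\<bar> * \<bar>emp_cdf n x y - cdf \<mu> y\<bar> \<le> L * 1"
        using gL[OF cdf_range, of y] emp_cdf_error_le_1[of x y] by (intro mult_mono) auto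
      then show "\<bar>g (cdf \<mu> y) * (emp_cdf n x y - cdf \<mu> y)\<bar> \<le> L" by (simp add: abs_mult)
    qed measurable
    let ?r = "\<lambda>y. f (emp_cdf n x y) - f (cdf \<mu> y) - g (cdf \<mu> y) * (emp_cdf n x y - cdf \<mu> y)"
    have ir: "integrable \<nu> ?r" using if' ig by auto
    have "(\<integral>y. f (emp_cdf n x y) \<partial>\<nu>) - pop_mean f = W x + (\<integral>y. ?r y \<partial>\<nu>)"
      unfolding pop_mean_def W_def using if' ig influence_average[OF g gL, of x] by simp
    moreover have "\<bar>\<integral>y. ?r y \<partial>\<nu>\<bar> \<le> Q * sq_err x"
    proof -
      have "\<bar>\<integral>y. ?r y \<partial>\<nu>\<bar> \<le> (\<integral>y. \<bar>?r y\<bar> \<partial>\<nu>)" by (rule integral_abs_bound)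
      also have "\<dots> \<le> (\<integral>y. Q * (emp_cdf n x y - cdf \<mu> y)\<^sup>2 \<partial>\<nu>)"
        using ir ie by (intro integral_mono Q emp_cdf_range cdf_range) auto
      finally show ?thesis by (simp add: sq_err_def)
    qed
    ultimately show ?thesis by linarith
  qed
  have "(\<integral>x. \<bar>(\<integral>y. f (emp_cdf n x y) \<partial>\<nu>) - pop_mean f\<bar> \<partial>PX) \<le> (\<integral>x. \<bar>W x\<bar> + Q * sq_err x \<partial>PX)"
  proof (intro integral_mono pt)
    show "integrable PX (\<lambda>x. \<bar>(\<integral>y. f (emp_cdf n x y) \<partial>\<nu>) - pop_mean f\<bar>)"
    proof (rule PX.P.integrable_bounded_real[of _ "L + Q"])
      fix x assume x: "x \<in> space PX"
      have "Q * sq_err x \<le> Q * 1" using Q0 sq_err_le_1[OF x] by (intro mult_left_mono) auto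
      then show "\<bar>\<bar>(\<integral>y. f (emp_cdf n x y) \<partial>\<nu>) - pop_mean f\<bar>\<bar> \<le> L + Q" using pt[OF x] WL[of x] by simp
    qed measurable
  qed (use Wi sq_err_integrable in auto)
  also have "\<dots> = (\<integral>x. \<bar>W x\<bar> \<partial>PX) + Q * (\<integral>x. sq_err x \<partial>PX)"
    using Wi sq_err_integrable by simp
  also have "\<dots> \<le> sqrt (K / n) + Q * (1 / n)"
    by (intro add_mono W1 mult_left_mono sq_err_mean Q0)
  finally show ?thesis
    using t1 stat_deviation_decomposition[OF f B] unfolding G_def V_def by simp
qed

end

section \<open>The influence function\<close>

abbreviation unif01 :: "real measure" where
  "unif01 \<equiv> density lborel (indicator {0..1})"

lemma real_distribution_unif01: "real_distribution unif01"
proof -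
  have "emeasure unif01 UNIV = 1" by (subst emeasure_density) auto
  then interpret prob_space unif01 by (intro prob_spaceI) simp
  show ?thesis by unfold_locales simp
qed

lemma cdf_unif01:
  assumes u: "0 \<le> u" "u \<le> 1"
  shows "cdf unif01 u = u"
proof -
  have "emeasure unif01 {..u} = (\<integral>\<^sup>+z. indicator {0..1} z * indicator {..u} z \<partial>lborel)"
    by (subst emeasure_density) auto
  also have "\<dots> = (\<integral>\<^sup>+z. indicator {0..u} z \<partial>lborel)"
    using u by (intro nn_integral_cong) (auto split: split_indicator)
  finally have "emeasure unif01 {..u} = (\<integral>\<^sup>+z. indicator {0..u} z \<partial>lborel)" .
  then have "emeasure unif01 {..u} = ennreal u" using u by simp
  then show ?thesis using u by (simp add: cdf_def measure_def)
qed

lemma integral_unif01: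
  fixes h :: "real \<Rightarrow> real"
  assumes "continuous_on {0..1} h" and [measurable]: "h \<in> borel_measurable borel"
  shows "(\<integral>u. h u \<partial>unif01) = integral {0..1} h"
proof -
  have "unif01 = density lborel (\<lambda>x. ennreal (indicat_real {0..1} x))"
    by (simp add: ennreal_indicator)
  then have "(\<integral>u. h u \<partial>unif01) = (\<integral>u. indicat_real {0..1} u *\<^sub>R h u \<partial>lborel)"
    by (simp only:) (subst integral_density, auto)
  also have "\<dots> = integral {0..1} h"
    using set_borel_integral_eq_integral(2)[OF borel_integrable_atLeastAtMost'[OF assms(1)]]
    by (simp add: set_lebesgue_integral_def)
  finally show ?thesis .
qed

lemma (in real_distribution) isCont_cdf_absolutely_continuous:
  assumes "absolutely_continuous lborel M"
  shows "isCont (cdf M) x"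
proof -
  have "{x} \<in> null_sets lborel" by (simp add: null_sets_def)
  then have "{x} \<in> null_sets M" using assms unfolding absolutely_continuous_def by auto
  then show ?thesis by (simp add: isCont_cdf measure_def null_sets_def)
qed

text \<open>Continuity suffices: for 0 \<le> u < 1 a nonempty set {F \<le> u} is a closed half-line,
  with F equal to u at its end, even if F has flat pieces.\<close>

lemma (in real_distribution) probability_integral_transform:
  assumes cont: "\<And>x. isCont (cdf M) x"
  shows "distr M borel (cdf M) = unif01"
proof (rule cdf_unique)
  let ?F = "cdf M"
  have Fm [measurable]: "?F \<in> borel_measurable borel"
    by (rule borel_measurable_mono) (auto simp: mono_def cdf_nondecreasing)
  have Fm' [measurable]: "?F \<in> borel_measurable M" by (rule measurable_finite_borel[OF Fm])
  show "real_distribution (distr M borel ?F)" by (rule real_distribution_distr[OF Fm'])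
  show "real_distribution unif01" by (rule real_distribution_unif01)
  interpret U: real_distribution unif01 by (rule real_distribution_unif01)
  have cD: "cdf (distr M borel ?F) u = prob {x. ?F x \<le> u}" for u
    unfolding cdf_def2[of "distr M borel ?F"]
    by (subst measure_distr[OF Fm']) (auto intro!: arg_cong[where f = prob])
  have mid: "prob {x. ?F x \<le> u} = u" if u: "0 \<le> u" "u < 1" for u
  \<comment> \<open>Emptiness is possible only for u = 0, since F tends to 0 at minus
    infinity.\<close>
  proof (cases "{x. ?F x \<le> u} = {}")
    case True
    have "u \<le> 0"
    proof (rule ccontr)
      assume "\<not> u \<le> 0"
      then have "eventually (\<lambda>x. ?F x < u) at_bot" using cdf_lim_at_bot by (intro order_tendstoD(2)) auto
      then obtain x where "?F x < u" by (metis eventually_at_bot_linorder order_refl)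
      then have "x \<in> {x. ?F x \<le> u}" by simp
      then show False using True by blast
    qed
    then show ?thesis using u True by simp
  next
    case False
    have "eventually (\<lambda>x. u < ?F x) at_top" using cdf_lim_at_top_prob u by (intro order_tendstoD(1)) auto
    then obtain b where b: "u < ?F b" by (metis eventually_at_top_linorder order_refl)
    have ub: "x \<le> b" if "?F x \<le> u" for x
      using that b cdf_nondecreasing[of b x] by linarith
    \<comment> \<open>The largest point with F \<le> u; taking the supremum places it at the right
      end of any flat piece at height u.\<close>
    define s where "s = Sup {x. ?F x \<le> u}"
    have bdd: "bdd_above {x. ?F x \<le> u}" using ub by (auto simp: bdd_above_def)
    have "closed {x. ?F x \<le> u}"
      using cont by (intro closed_Collect_le continuous_intros continuous_at_imp_continuous_on) auto
    then have s: "?F s \<le> u" using closed_contains_Sup[OF False bdd] by (simp add: s_def)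
    have "{x. ?F x \<le> u} = {..s}"
    proof (intro equalityI subsetI)
      fix x assume "x \<in> {x. ?F x \<le> u}"
      then show "x \<in> {..s}" using cSup_upper[OF _ bdd] by (simp add: s_def)
    next
      fix x assume "x \<in> {..s}"
      then show "x \<in> {x. ?F x \<le> u}" using cdf_nondecreasing[of x s] s by simp
    qed
    moreover have "?F s = u"
    proof -
      obtain z where "?F z = u"
        using IVT'[of ?F s u b] s b ub[OF s] cont by (auto intro: continuous_at_imp_continuous_on)
      then have "z \<le> s" using cSup_upper[OF _ bdd, of z] by (simp add: s_def)
      then show ?thesis using cdf_nondecreasing[of z s] s \<open>?F z = u\<close> by simp
    qed
    ultimately show ?thesis by (simp add: cdf_def)
  qed
  show "cdf (distr M borel ?F) = cdf unif01"
  proof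
    fix u :: real
    consider "u < 0" | "0 \<le> u" "u < 1" | "u \<ge> 1" by linarith
    then show "cdf (distr M borel ?F) u = cdf unif01 u"
    proof cases
      case 1
      have "{x. ?F x \<le> u} = {}" using 1 cdf_nonneg by (auto simp: not_le intro: less_le_trans)
      then have "cdf (distr M borel ?F) u = 0" by (simp only: cD measure_empty)
      moreover have "cdf unif01 u = 0"
        using U.cdf_nondecreasing[of u 0] U.cdf_nonneg[of u] cdf_unif01[of 0] 1 by simp
      ultimately show ?thesis by simp
    next
      case 2
      then show ?thesis by (simp add: cD mid cdf_unif01)
    next
      case 3
      have "{x. ?F x \<le> u} = UNIV" using 3 cdf_bounded_prob by (auto intro: order_trans)
      then have "cdf (distr M borel ?F) u = 1" using prob_space by (simp add: cD)
      moreover have "cdf unif01 u = 1"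
        using U.cdf_nondecreasing[of 1 u] U.cdf_bounded_prob[of u] cdf_unif01[of 1] 3 by simp
      ultimately show ?thesis by simp
    qed
  qed
qed

section \<open>Score averages when F(Y) has a continuous density\<close>

locale two_sample_density = two_sample +
  fixes r :: "real \<Rightarrow> real"
  assumes cdf_cont: "\<And>x. isCont (cdf \<mu>) x"
    and r_cont: "continuous_on UNIV r" and r_nonneg: "\<And>z. r z \<ge> 0"
    and r_density: "distr \<nu> borel (cdf \<mu>) = density lborel (\<lambda>z. indicator {0<..<1} z * ennreal (r z))"
begin

lemma r_measurable [measurable]: "r \<in> borel_measurable borel"
  by (intro borel_measurable_continuous_onI r_cont)

lemma integral_cdf_Y:
  fixes h :: "real \<Rightarrow> real"
  assumes [measurable]: "h \<in> borel_measurable borel"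
  shows "(\<integral>y. h (cdf \<mu> y) \<partial>\<nu>) = (\<integral>z. indicat_real {0<..<1} z * r z * h z \<partial>lborel)"
proof -
  have "(\<integral>y. h (cdf \<mu> y) \<partial>\<nu>) = (\<integral>z. h z \<partial>distr \<nu> borel (cdf \<mu>))"
    by (subst integral_distr) auto
  also have "distr \<nu> borel (cdf \<mu>) = density lborel (\<lambda>z. ennreal (indicat_real {0<..<1} z * r z))"
    unfolding r_density by (intro arg_cong2[where f = density] ext refl)
      (auto simp: ennreal_mult r_nonneg ennreal_indicator split: split_indicator)
  also have "(\<integral>z. h z \<partial>density lborel (\<lambda>z. ennreal (indicat_real {0<..<1} z * r z)))
      = (\<integral>z. (indicat_real {0<..<1} z * r z) *\<^sub>R h z \<partial>lborel)"
    by (rule integral_density) (auto simp: r_nonneg)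
  finally show ?thesis by simp
qed

lemma pop_mean_eq_integral:
  assumes "continuous_on UNIV h"
  shows "pop_mean h = integral {0..1} (\<lambda>z. r z * h z)"
proof -
  have [measurable]: "h \<in> borel_measurable borel" by (intro borel_measurable_continuous_onI assms)
  have c: "continuous_on {0..1} (\<lambda>z. r z * h z)"
    by (intro continuous_intros continuous_on_subset[OF r_cont] continuous_on_subset[OF assms]) auto
  have "pop_mean h = (\<integral>z. indicat_real {0<..<1} z * r z * h z \<partial>lborel)"
    unfolding pop_mean_def by (rule integral_cdf_Y) simp
  also have "\<dots> = (\<integral>z. indicat_real {0..1} z *\<^sub>R (r z * h z) \<partial>lborel)"
    using AE_lborel_singleton[of "0::real"] AE_lborel_singleton[of "1::real"]
    by (intro integral_cong_AE) (auto split: split_indicator)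
  also have "\<dots> = integral {0..1} (\<lambda>z. r z * h z)"
    using set_borel_integral_eq_integral(2)[OF borel_integrable_atLeastAtMost'[OF c]]
    by (simp add: set_lebesgue_integral_def)
  finally show ?thesis .
qed

text \<open>Used with c = F(x): outside the null event F(y) = F(x), the comparisons x \<le> y and
  F(x) \<le> F(y) agree although F need not be strictly increasing.\<close>

lemma cdf_Y_no_atom: "AE y in \<nu>. cdf \<mu> y \<noteq> c"
proof -
  have "AE z in distr \<nu> borel (cdf \<mu>). z \<noteq> c"
    unfolding r_density using AE_lborel_singleton[of c] by (subst AE_density) auto
  then show ?thesis by (subst (asm) AE_distr_iff) auto
qed

text \<open>For \<open>r = 1\<close> the influence function of \<open>f'\<close> is exactly \<open>- f (cdf \<mu> x)\<close>.\<close>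
lemma influence_near_uniform:
  assumes f': "\<And>z. (f has_real_derivative g z) (at z)" and g_cont: "continuous_on UNIV g"
    and f0: "integral {0..1} f = 0"
    and L: "\<And>u. u \<in> {0..1} \<Longrightarrow> \<bar>g u\<bar> \<le> L"
    and \<eta>: "\<And>u. u \<in> {0..1} \<Longrightarrow> \<bar>r u - 1\<bar> \<le> \<eta>"
  shows "\<bar>influence g x + f (cdf \<mu> x)\<bar> \<le> L * \<eta>"
proof -
  define a where "a = cdf \<mu> x"
  have a: "0 \<le> a" "a \<le> 1" using cdf_range[of x] by (auto simp: a_def)
  have gm [measurable]: "g \<in> borel_measurable borel" by (intro borel_measurable_continuous_onI g_cont)
  have f_cont: "continuous_on A f" for A
    using f' by (meson DERIV_isCont continuous_at_imp_continuous_on)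
  have fm [measurable]: "f \<in> borel_measurable borel" by (intro borel_measurable_continuous_onI f_cont)
  \<comment> \<open>The influence kernel in the variables a = F(x) and z = F(y); it is bounded by
    \<open>L\<close> on [0,1].\<close>
  define h where "h z = g z * ((if a \<le> z then 1 else 0) - z)" for z
  have hm [measurable]: "h \<in> borel_measurable borel" unfolding h_def by measurable
  have hL: "\<bar>h z\<bar> \<le> L" if "z \<in> {0..1}" for z
  proof -
    have "\<bar>g z\<bar> * \<bar>(if a \<le> z then 1 else 0) - z\<bar> \<le> L * 1"
      using that L[OF that] by (intro mult_mono) auto
    then show ?thesis by (simp add: h_def abs_mult)
  qed
  have rb: "\<bar>(r z - 1) * h z\<bar> \<le> L * \<eta>" if "z \<in> {0..1}" for z
    unfolding abs_mult mult.commute[of L] using hL[OF that] \<eta>[OF that] by (intro mult_mono) auto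
  have ri: "integrable lborel (\<lambda>z. indicat_real {0..1} z * ((r z - 1) * h z))"
  proof (rule Bochner_Integration.integrable_bound[of lborel "\<lambda>z. indicat_real {0..1} z * (L * \<eta>)"])
    show "AE z in lborel. norm (indicat_real {0..1} z * ((r z - 1) * h z)) \<le> norm (indicat_real {0..1} z * (L * \<eta>))"
      using rb by (auto split: split_indicator intro: order_trans[OF _ abs_ge_self])
  qed auto
  have "influence g x = (\<integral>y. h (cdf \<mu> y) \<partial>\<nu>)"
    unfolding influence_def
  proof (rule integral_cong_AE)
    show "AE y in \<nu>. g (cdf \<mu> y) * ((if x \<le> y then 1 else 0) - cdf \<mu> y) = h (cdf \<mu> y)"
      using cdf_Y_no_atom[of a]
    proof eventually_elim
      case (elim y)
      have "x \<le> y \<longleftrightarrow> a \<le> cdf \<mu> y"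
        using X.cdf_nondecreasing[of x y] X.cdf_nondecreasing[of y x] elim unfolding a_def by linarith
      then show ?case by (simp add: h_def)
    qed
  qed measurable
  also have "\<dots> = (\<integral>z. indicat_real {0<..<1} z * r z * h z \<partial>lborel)"
    by (rule integral_cdf_Y) simp
  also have "\<dots> = (\<integral>z. indicat_real {0..1} z * ((r z - 1) * h z) + indicat_real {0..1} z * h z \<partial>lborel)"
    using AE_lborel_singleton[of "0::real"] AE_lborel_singleton[of "1::real"]
    by (intro integral_cong_AE) (auto simp: algebra_simps split: split_indicator)
  also have "\<dots> = (\<integral>z. indicat_real {0..1} z * ((r z - 1) * h z) \<partial>lborel) + (\<integral>z. indicat_real {0..1} z * h z \<partial>lborel)"
  proof (rule Bochner_Integration.integral_add)
    show "integrable lborel (\<lambda>z. indicat_real {0..1} z * h z)"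
    proof (rule Bochner_Integration.integrable_bound[of lborel "\<lambda>z. indicat_real {0..1} z * L"])
      show "AE z in lborel. norm (indicat_real {0..1} z * h z) \<le> norm (indicat_real {0..1} z * L)"
        using hL by (auto split: split_indicator intro: order_trans[OF _ abs_ge_self])
    qed auto
    show "integrable lborel (\<lambda>z. indicat_real {0..1} z * ((r z - 1) * h z))" by (rule ri)
  qed
  finally have dec: "influence g x = (\<integral>z. indicat_real {0..1} z * ((r z - 1) * h z) \<partial>lborel)
      + (\<integral>z. indicat_real {0..1} z * h z \<partial>lborel)" .
  have rem: "\<bar>\<integral>z. indicat_real {0..1} z * ((r z - 1) * h z) \<partial>lborel\<bar> \<le> L * \<eta>"
  proof -
    have "\<bar>\<integral>z. indicat_real {0..1} z * ((r z - 1) * h z) \<partial>lborel\<bar>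
        \<le> (\<integral>z. \<bar>indicat_real {0..1} z * ((r z - 1) * h z)\<bar> \<partial>lborel)"
      by (rule integral_abs_bound)
    also have "\<dots> \<le> (\<integral>z. indicat_real {0..1::real} z * (L * \<eta>) \<partial>lborel)"
      using ri rb by (intro integral_mono) (auto split: split_indicator)
    finally have "\<bar>\<integral>z. indicat_real {0..1} z * ((r z - 1) * h z) \<partial>lborel\<bar>
        \<le> (\<integral>z. indicat_real {0..1::real} z * (L * \<eta>) \<partial>lborel)" .
    then show ?thesis by simp
  qed
  \<comment> \<open>The integral of g over [a,1] is f(1) - f(a); integration by parts and the zero
    mean of \<open>f\<close> give f(1) for the integral of z g over [0,1].\<close>
  have main: "(\<integral>z. indicat_real {0..1} z * h z \<partial>lborel) = - f a"
  proof -
    have i1: "(\<integral>z. g z * indicat_real {a..1} z \<partial>lborel) = f 1 - f a"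
      using a f' g_cont by (intro integral_FTC_Icc_real) (auto simp: continuous_on_eq_continuous_at)
    have j1: "integrable lborel (\<lambda>z. g z * indicat_real {a..1} z)"
      using borel_integrable_atLeastAtMost'[OF continuous_on_subset[OF g_cont], of a 1]
      by (simp add: set_integrable_def mult.commute)
    have i2: "(\<integral>z. (z * g z + f z) * indicat_real {0..1} z \<partial>lborel) = 1 * f 1 - 0 * f 0"
    proof (rule integral_FTC_Icc_real)
      fix z :: real
      show "DERIV (\<lambda>z. z * f z) z :> z * g z + f z"
        using f' by (auto intro!: derivative_eq_intros)
      show "isCont (\<lambda>z. z * g z + f z) z"
        using g_cont f_cont[of UNIV] by (auto intro!: continuous_intros simp: continuous_on_eq_continuous_at)
    qed simp
    have j2: "integrable lborel (\<lambda>z. z * g z * indicat_real {0..1} z)"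
    proof -
      have "continuous_on {0..1} (\<lambda>z. z * g z)"
        by (intro continuous_intros continuous_on_subset[OF g_cont]) simp
      then show ?thesis
        using borel_integrable_atLeastAtMost'[of 0 1 "\<lambda>z. z * g z"]
        by (simp add: set_integrable_def mult.commute)
    qed
    have sf: "set_integrable lborel {0..1} f" by (intro borel_integrable_atLeastAtMost' f_cont)
    have j3: "integrable lborel (\<lambda>z. f z * indicat_real {0..1} z)"
      using sf by (simp add: set_integrable_def mult.commute)
    have i3: "(\<integral>z. f z * indicat_real {0..1} z \<partial>lborel) = 0"
      using set_borel_integral_eq_integral(2)[OF sf] f0 by (simp add: set_lebesgue_integral_def mult.commute)
    have "(\<integral>z. indicat_real {0..1} z * h z \<partial>lborel)
       = (\<integral>z. g z * indicat_real {a..1} z - z * g z * indicat_real {0..1} z \<partial>lborel)"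
      using a by (intro Bochner_Integration.integral_cong refl) (auto simp: h_def algebra_simps split: split_indicator)
    also have "\<dots> = (f 1 - f a) - (\<integral>z. z * g z * indicat_real {0..1} z \<partial>lborel)"
      using j1 j2 i1 by simp
    also have "(\<integral>z. z * g z * indicat_real {0..1} z \<partial>lborel) = f 1"
    proof -
      have "(\<integral>z. (z * g z + f z) * indicat_real {0..1} z \<partial>lborel)
          = (\<integral>z. z * g z * indicat_real {0..1} z \<partial>lborel) + (\<integral>z. f z * indicat_real {0..1} z \<partial>lborel)"
        using j2 j3 by (simp add: distrib_right)
      then show ?thesis using i2 i3 by simp
    qed
    finally show ?thesis by simp
  qed
  show ?thesis using dec rem main by (simp add: a_def)
qed

text \<open>The influence function is -f(F(x)) up to L \<eta>, and F(X) is uniform, so f(F(X)) has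
  second moment 1. The factors 2 come from squaring a sum of two terms.\<close>

lemma influence_second_moment:
  assumes f': "\<And>z. (f has_real_derivative g z) (at z)" and g_cont: "continuous_on UNIV g"
    and f0: "integral {0..1} f = 0" and f1: "integral {0..1} (\<lambda>z. (f z)\<^sup>2) = 1"
    and L: "\<And>u. u \<in> {0..1} \<Longrightarrow> \<bar>g u\<bar> \<le> L" and B: "\<And>u. u \<in> {0..1} \<Longrightarrow> \<bar>f u\<bar> \<le> B"
    and \<eta>: "\<And>u. u \<in> {0..1} \<Longrightarrow> \<bar>r u - 1\<bar> \<le> \<eta>"
  shows "(\<integral>x. (influence g x)\<^sup>2 \<partial>\<mu>) \<le> 2 + 2 * (L * \<eta>)\<^sup>2"
proof -
  have gm [measurable]: "g \<in> borel_measurable borel" by (intro borel_measurable_continuous_onI g_cont)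
  have f_cont: "continuous_on A f" for A
    using f' by (meson DERIV_isCont continuous_at_imp_continuous_on)
  have fm [measurable]: "f \<in> borel_measurable borel" by (intro borel_measurable_continuous_onI f_cont)
  have iB: "\<bar>influence g x\<bar> \<le> L" for x by (rule influence_bound[OF gm L])
  have i1: "integrable \<mu> (\<lambda>x. (influence g x)\<^sup>2)"
    using power_mono[OF iB abs_ge_zero, of _ 2]
    by (intro X.integrable_bounded_real[of _ "L\<^sup>2"]) auto
  have i2: "integrable \<mu> (\<lambda>x. (f (cdf \<mu> x))\<^sup>2)"
    using power_mono[OF B[OF cdf_range] abs_ge_zero, of _ 2]
    by (intro X.integrable_bounded_real[of _ "B\<^sup>2"]) auto
  have "(\<integral>x. (influence g x)\<^sup>2 \<partial>\<mu>) \<le> (\<integral>x. 2 * (f (cdf \<mu> x))\<^sup>2 + 2 * (L * \<eta>)\<^sup>2 \<partial>\<mu>)"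
  proof (rule integral_mono[OF i1])
    fix x
    let ?i = "influence g x" and ?f = "f (cdf \<mu> x)"
    have "(?i + ?f)\<^sup>2 \<le> (L * \<eta>)\<^sup>2"
      using power_mono[OF influence_near_uniform[OF f' g_cont f0 L \<eta>] abs_ge_zero, of x 2] by simp
    moreover have "?i\<^sup>2 \<le> 2 * ?f\<^sup>2 + 2 * (?i + ?f)\<^sup>2"
      using zero_le_power2[of "?i + 2 * ?f"] by (simp add: power2_eq_square algebra_simps)
    ultimately show "?i\<^sup>2 \<le> 2 * ?f\<^sup>2 + 2 * (L * \<eta>)\<^sup>2" by linarith
  qed (use i2 in auto)
  also have "\<dots> = 2 * (\<integral>x. (f (cdf \<mu> x))\<^sup>2 \<partial>\<mu>) + 2 * (L * \<eta>)\<^sup>2"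
    using i2 by (simp add: X.prob_space[simplified])
  also have "(\<integral>x. (f (cdf \<mu> x))\<^sup>2 \<partial>\<mu>) = (\<integral>u. (f u)\<^sup>2 \<partial>distr \<mu> borel (cdf \<mu>))"
    by (subst integral_distr) auto
  also have "\<dots> = 1"
    unfolding X.probability_integral_transform[OF cdf_cont] using f1
    by (subst integral_unif01) (auto intro!: continuous_intros f_cont)
  finally show ?thesis by simp
qed

end

section \<open>Power of the test\<close>

lemma deriv_bound_imp_lipschitz:
  fixes f :: "real \<Rightarrow> real"
  assumes "\<And>x. (f has_real_derivative g x) (at x)" "\<And>x. x \<in> {0..1} \<Longrightarrow> \<bar>g x\<bar> \<le> L"
    and "u \<in> {0..1}" "v \<in> {0..1}"
  shows "\<bar>f u - f v\<bar> \<le> L * \<bar>u - v\<bar>"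
  using field_differentiable_bound[of "{0..1}" f g L u v] assms
  by (auto intro: has_field_derivative_at_within)

text \<open>The mean value inequality is applied to f(x) - g(v) x on the segment from u to v, where
  its derivative is at most Q |u - v|. This costs a factor 2 against the sharp Taylor bound.\<close>

lemma deriv_bound_imp_quadratic_remainder:
  fixes f :: "real \<Rightarrow> real"
  assumes f: "\<And>x. (f has_real_derivative g x) (at x)" and g: "\<And>x. (g has_real_derivative h x) (at x)"
    and Q: "\<And>x. x \<in> {0..1} \<Longrightarrow> \<bar>h x\<bar> \<le> Q" and uv: "u \<in> {0..1}" "v \<in> {0..1}"
  shows "\<bar>f u - f v - g v * (u - v)\<bar> \<le> Q * (u - v)\<^sup>2"
proof -
  have Q0: "Q \<ge> 0" using Q[of 0] by auto
  have sub: "closed_segment u v \<subseteq> {0..1}" using uv by (auto simp: closed_segment_eq_real_ivl split: if_splits)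
  have "norm ((f u - g v * u) - (f v - g v * v)) \<le> Q * \<bar>u - v\<bar> * norm (u - v)"
  proof (rule field_differentiable_bound[where S = "closed_segment u v" and f' = "\<lambda>x. g x - g v"])
    fix x assume x: "x \<in> closed_segment u v"
    have "((\<lambda>x. f x - g v * x) has_real_derivative g x - g v) (at x)"
      by (auto intro!: derivative_eq_intros f)
    then show "((\<lambda>x. f x - g v * x) has_field_derivative g x - g v) (at x within closed_segment u v)"
      by (rule has_field_derivative_at_within)
    have "\<bar>g x - g v\<bar> \<le> Q * \<bar>x - v\<bar>"
      using x sub uv by (intro deriv_bound_imp_lipschitz[OF g Q]) auto
    also have "\<dots> \<le> Q * \<bar>u - v\<bar>"
      using x Q0 by (intro mult_left_mono) (auto simp: closed_segment_eq_real_ivl split: if_splits)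
    finally show "norm (g x - g v) \<le> Q * \<bar>u - v\<bar>" by simp
  qed auto
  moreover have "(f u - g v * u) - (f v - g v * v) = f u - f v - g v * (u - v)" by (simp add: algebra_simps)
  ultimately show ?thesis by (simp add: power2_eq_square flip: abs_mult)
qed

section \<open>Rejection probability at fixed sample sizes\<close>

locale smooth_test = two_sample_density \<mu> \<nu> n m "rho b d \<theta>" + exp_family b d \<theta>
  for \<mu> \<nu> :: "real measure" and n m :: nat and b :: basis and d :: nat and \<theta> :: "nat \<Rightarrow> real"
begin

abbreviation "L \<equiv> psi_bd1 b d"
abbreviation "Q \<equiv> psi_bd2 b d"

lemma psi_measurable [measurable]: "psi b k \<in> borel_measurable borel"
  by (intro borel_measurable_continuous_onI continuous_on_psi)

lemma psi_hat_eq_stat: "psi_hat b n m x y k = stat (psi b k) x y"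
  by (simp add: psi_hat_def stat_def)

lemma pop_mean_psi: "pop_mean (psi b k) = e k"
  unfolding e_def by (intro pop_mean_eq_integral continuous_on_psi)

definition rejects :: "real \<Rightarrow> ((nat \<Rightarrow> real) \<times> (nat \<Rightarrow> real)) set" where
  "rejects \<alpha> = {\<omega> \<in> space (PX \<Otimes>\<^sub>M PY). test_S b \<alpha> n m d (fst \<omega>) (snd \<omega>) = 1}"

lemma rejects_measurable: "rejects \<alpha> \<in> sets (PX \<Otimes>\<^sub>M PY)"
proof -
  have [measurable]: "(\<lambda>\<omega>. stat (psi b k) (fst \<omega>) (snd \<omega>)) \<in> borel_measurable (PX \<Otimes>\<^sub>M PY)" for k
    using stat_measurable[OF psi_measurable[of k]] by (simp add: case_prod_unfold)
  have [measurable]: "(\<lambda>\<omega>. Psi_hat b n m d (fst \<omega>) (snd \<omega>)) \<in> borel_measurable (PX \<Otimes>\<^sub>M PY)"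
    unfolding Psi_hat_def psi_hat_eq_stat
    by (intro borel_measurable_times borel_measurable_const borel_measurable_Max) auto
  have "rejects \<alpha> = {\<omega> \<in> space (PX \<Otimes>\<^sub>M PY). crit \<alpha> d \<le> Psi_hat b n m d (fst \<omega>) (snd \<omega>)}"
    by (auto simp: rejects_def test_S_def)
  then show ?thesis by simp
qed

text \<open>One index is enough, as the statistic is a maximum. Markov's inequality bounds the
  probability that the \<open>k\<close>-th average misses its mean by \<open>s\<close> or more;
  otherwise the critical value is reached.\<close>

lemma rejection_probability:
  assumes k: "k \<in> {1..d}" and s: "s > 0"
    and c: "crit \<alpha> d \<le> sqrt (real n * real m / (real n + real m)) * (\<bar>e k\<bar> - s)"
    and E: "(\<integral>p. \<bar>stat (psi b k) (fst p) (snd p) - pop_mean (psi b k)\<bar> \<partial>(PX \<Otimes>\<^sub>M PY)) \<le> E"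
  shows "measure (PX \<Otimes>\<^sub>M PY) (rejects \<alpha>) \<ge> 1 - E / s"
proof -
  let ?P = "PX \<Otimes>\<^sub>M PY"
  let ?u = "\<lambda>p. \<bar>stat (psi b k) (fst p) (snd p) - e k\<bar>"
  have sm [measurable]: "(\<lambda>\<omega>. stat (psi b k) (fst \<omega>) (snd \<omega>)) \<in> borel_measurable ?P"
    using stat_measurable[OF psi_measurable[of k]] by (simp add: case_prod_unfold)
  have sB: "\<bar>stat (psi b k) x y\<bar> \<le> B" for x y
  proof -
    have "\<bar>\<Sum>j=1..m. psi b k (emp_cdf n x (y j))\<bar> \<le> (\<Sum>j=1..m. \<bar>psi b k (emp_cdf n x (y j))\<bar>)" by (rule sum_abs)
    also have "\<dots> \<le> (\<Sum>j=1..m. B)" by (intro sum_mono psi_le_B k emp_cdf_range)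
    finally show ?thesis using m by (simp add: stat_def field_simps)
  qed
  have int: "integrable ?P ?u"
  proof (rule PXY.P.integrable_bounded_real[of _ "B + \<bar>e k\<bar>"])
    fix p
    show "\<bar>?u p\<bar> \<le> B + \<bar>e k\<bar>" using sB[of "fst p" "snd p"] by linarith
  qed measurable
  define A where "A = {p \<in> space ?P. s \<le> ?u p}"
  have A: "A \<in> sets ?P" unfolding A_def by measurable
  have "measure ?P A \<le> (\<integral>p. ?u p \<partial>?P) / s"
    unfolding A_def using int s by (intro integral_Markov_inequality_measure[where A = "{}"]) auto
  also have "\<dots> \<le> E / s" using E s unfolding pop_mean_psi by (intro divide_right_mono) auto
  finally have Am: "measure ?P A \<le> E / s" .
  have "space ?P - A \<subseteq> rejects \<alpha>"
  proof
    fix p assume p: "p \<in> space ?P - A"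
    then have "?u p < s" by (auto simp: A_def)
    then have "\<bar>e k\<bar> - s \<le> \<bar>psi_hat b n m (fst p) (snd p) k\<bar>" unfolding psi_hat_eq_stat by linarith
    also have "\<dots> \<le> Max ((\<lambda>k. \<bar>psi_hat b n m (fst p) (snd p) k\<bar>) ` {1..d})" using k by (intro Max_ge) auto
    finally have "crit \<alpha> d \<le> Psi_hat b n m d (fst p) (snd p)"
      unfolding Psi_hat_def by (intro order_trans[OF c] mult_left_mono) auto
    then show "p \<in> rejects \<alpha>" using p by (simp add: rejects_def test_S_def)
  qed
  then have "measure ?P (space ?P - A) \<le> measure ?P (rejects \<alpha>)"
    by (intro PXY.P.finite_measure_mono rejects_measurable)
  moreover have "measure ?P (space ?P - A) = 1 - measure ?P A"
    using A by (rule PXY.P.prob_compl)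
  ultimately show ?thesis using Am by linarith
qed

lemma deviation_crude:
  assumes k: "k \<in> {1..d}"
  shows "(\<integral>p. \<bar>stat (psi b k) (fst p) (snd p) - pop_mean (psi b k)\<bar> \<partial>(PX \<Otimes>\<^sub>M PY)) \<le> B / sqrt m + L / sqrt n"
proof -
  obtain p1 p2 where p: "\<And>x. (psi b k has_real_derivative p1 x) (at x)"
    "\<And>x. (p1 has_real_derivative p2 x) (at x)"
    "\<And>x. x \<in> {0..1} \<Longrightarrow> \<bar>psi b k x\<bar> \<le> B"
    "\<And>x. x \<in> {0..1} \<Longrightarrow> \<bar>p1 x\<bar> \<le> L"
    "\<And>x. x \<in> {0..1} \<Longrightarrow> \<bar>p2 x\<bar> \<le> Q"
    using k psi_regular[of k d b] by (metis atLeastAtMost_iff)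
  have "L \<ge> 0" using p(4)[of 0] by auto
  then show ?thesis
    by (intro stat_deviation_crude psi_measurable p(3) deriv_bound_imp_lipschitz[OF p(1,4)]) auto
qed

text \<open>Since B T \<le> 1/4, \<open>rho\<close> is at most 2, so \<psi>_k(V) has second moment
  at most 2, whence the 4. The distance 2 B T of \<open>rho\<close> from 1 is the \<eta> of the
  influence bound.\<close>

lemma deviation_fine:
  assumes k: "k \<in> {1..d}" and BT: "B * T \<le> 1/4"
  shows "(\<integral>p. \<bar>stat (psi b k) (fst p) (snd p) - pop_mean (psi b k)\<bar> \<partial>(PX \<Otimes>\<^sub>M PY))
    \<le> sqrt ((4 + 2 * L\<^sup>2 / n) / m) + sqrt ((2 + 2 * (L * (2 * (B * T)))\<^sup>2) / n) + Q / n"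
proof -
  obtain p1 p2 where p: "\<And>x. (psi b k has_real_derivative p1 x) (at x)"
    "\<And>x. (p1 has_real_derivative p2 x) (at x)"
    "\<And>x. x \<in> {0..1} \<Longrightarrow> \<bar>psi b k x\<bar> \<le> B"
    "\<And>x. x \<in> {0..1} \<Longrightarrow> \<bar>p1 x\<bar> \<le> L"
    "\<And>x. x \<in> {0..1} \<Longrightarrow> \<bar>p2 x\<bar> \<le> Q"
    using k psi_regular[of k d b] by (metis atLeastAtMost_iff)
  have p1c: "continuous_on UNIV p1" using p(2) by (meson DERIV_isCont continuous_at_imp_continuous_on)
  have p1m: "p1 \<in> borel_measurable borel" by (intro borel_measurable_continuous_onI p1c)
  have Q0: "Q \<ge> 0" using p(5)[of 0] by auto
  have f1: "integral {0..1} (\<lambda>z. (psi b k z)\<^sup>2) = 1"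
    using psi_orthonormal[of k k b] k by (simp add: power2_eq_square)
  have f0: "integral {0..1} (psi b k) = 0" using k by (intro psi_mean_zero) auto
  have V: "pop_mean (\<lambda>u. (psi b k u)\<^sup>2) \<le> 2"
  proof -
    have "pop_mean (\<lambda>u. (psi b k u)\<^sup>2) = integral {0..1} (\<lambda>z. rho b d \<theta> z * (psi b k z)\<^sup>2)"
      by (intro pop_mean_eq_integral continuous_intros)
    also have "\<dots> \<le> integral {0..1} (\<lambda>z. 2 * (psi b k z)\<^sup>2)"
    proof (intro integral_le integrable_continuous_interval continuous_intros)
      fix z :: real assume "z \<in> {0..1}"
      then have "rho b d \<theta> z \<le> 2" using rho_near_1[OF BT, of z] BT by linarith
      then show "rho b d \<theta> z * (psi b k z)\<^sup>2 \<le> 2 * (psi b k z)\<^sup>2" by (intro mult_right_mono) auto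
    qed
    also have "\<dots> = 2" using f1 by simp
    finally show ?thesis .
  qed
  have "(\<integral>p. \<bar>stat (psi b k) (fst p) (snd p) - pop_mean (psi b k)\<bar> \<partial>(PX \<Otimes>\<^sub>M PY))
    \<le> sqrt ((2 * pop_mean (\<lambda>u. (psi b k u)\<^sup>2) + 2 * L\<^sup>2 / n) / m)
      + sqrt ((2 + 2 * (L * (2 * (B * T)))\<^sup>2) / n) + Q / n"
  proof (rule stat_deviation_fine[OF psi_measurable p1m p(3) _ p(4)])
    show "\<bar>psi b k u - psi b k v\<bar> \<le> L * \<bar>u - v\<bar>" if "u \<in> {0..1}" "v \<in> {0..1}" for u v
      using that by (intro deriv_bound_imp_lipschitz[OF p(1,4)]) auto
    show "\<bar>psi b k u - psi b k v - p1 v * (u - v)\<bar> \<le> Q * (u - v)\<^sup>2" if "u \<in> {0..1}" "v \<in> {0..1}" for u v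
      using that by (intro deriv_bound_imp_quadratic_remainder[OF p(1,2,5)]) auto
    show "(\<integral>x. (influence p1 x)\<^sup>2 \<partial>\<mu>) \<le> 2 + 2 * (L * (2 * (B * T)))\<^sup>2"
      by (rule influence_second_moment[OF p(1) p1c f0 f1 p(4,3) rho_near_1[OF BT]])
  qed (use Q0 in auto)
  also have "\<dots> \<le> sqrt ((4 + 2 * L\<^sup>2 / n) / m) + sqrt ((2 + 2 * (L * (2 * (B * T)))\<^sup>2) / n) + Q / n"
    using V by (intro add_right_mono real_sqrt_le_mono divide_right_mono) auto
  finally show ?thesis .
qed


text \<open>Coarse comparisons by which sqrt (ln d) and \<open>B\<close> are absorbed into
  \<open>L\<close>, leaving \<open>w\<close> and \<open>q\<close> below as the only small
  quantities.\<close>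

lemma L_bounds: "sqrt (ln d) \<le> L" "B \<le> L" "L \<ge> 0"
proof -
  have d1: "real d \<ge> 1" using d by simp
  have "ln (real d) \<le> real d" using ln_le_minus_one[of "real d"] d1 by simp
  also have "\<dots> \<le> (real d)\<^sup>2" using d1 by (simp add: power2_eq_square)
  finally have "sqrt (ln d) \<le> real d" by (intro real_le_lsqrt) auto
  moreover have "real d \<le> L \<and> B \<le> L"
  proof (cases b)
    case Trig
    then show ?thesis using d1 by (simp add: psi_bd_def psi_bd1_def)
  next
    case Legendre
    have "1 * sqrt d \<le> (real d)\<^sup>2 * sqrt d" using d1 by (intro mult_right_mono) (auto simp: one_le_power)
    moreover have "real d * 1 \<le> (real d)\<^sup>2 * sqrt d" using d1 by (intro mult_mono) (auto simp: power2_eq_square)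
    moreover have "sqrt d \<ge> 0" by simp
    ultimately show ?thesis unfolding Legendre psi_bd_def psi_bd1_def basis.case by linarith
  qed
  ultimately show "sqrt (ln d) \<le> L" "B \<le> L" "L \<ge> 0" using d1 by linarith+
qed

text \<open>The failure bounds for small and for large B T are added, so the final estimate involves
  no case distinction and depends on \<theta> through neither its size nor the maximizing
  index.\<close>

lemma power_lower_bound:
  fixes c0 \<delta> \<epsilon> lam \<alpha> :: real
  defines "w \<equiv> L * B * d / sqrt n" and "q \<equiv> Q / sqrt n"
  assumes c0: "0 < c0" "c0 * real n \<le> real m" and mn: "m \<le> n" and d2: "d \<ge> 2"
    and \<delta>: "0 < \<delta>" "\<delta> \<le> 1/4" "1 + \<epsilon>/4 \<le> (1 - 3 * \<delta>) * (1 + \<epsilon>/2)" and \<epsilon>: "0 < \<epsilon>" "2 + \<epsilon> \<le> lam"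
    and max: "Max ((\<lambda>k. \<bar>\<theta> k\<bar>) ` {1..d}) = lam * sqrt (ln (real d) / nbar n m)"
    and crit: "crit \<alpha> d \<le> (1 + \<epsilon>/4) * sqrt (2 * ln (real d))"
    and w: "w \<le> 1" "w * (8 * (1 + \<epsilon>/4)) \<le> sqrt c0 * \<delta>"
  shows "measure (PX \<Otimes>\<^sub>M PY) (rejects \<alpha>)
    \<ge> 1 - (((sqrt (6 / c0) + 2 + q) / sqrt (ln d) + 4 * w) / \<delta> + 4 * (1 / sqrt c0 + 1) * w / \<delta>)"
proof -
  define nb where "nb = nbar n m"
  define r where "r = sqrt (real n * real m / (real n + real m))"
  \<comment> \<open>The common unit: the critical value is at most (1 + \<epsilon>/4) 2y, and the
    scaled largest coordinate is exactly lam y because nbar / 2 = nm / (n + m).\<close>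
  define y where "y = sqrt (ln d / 2)"
  have n0: "real n > 0" and m0: "real m > 0" using n m by auto
  have nbe: "nb = 2 * (real n * real m / (real n + real m))"
    using n0 m0 by (simp add: nb_def nbar_def field_simps)
  have nb0: "nb > 0" unfolding nbe using n0 m0 by (intro mult_pos_pos divide_pos_pos) auto
  have nb_le: "nb \<le> real n" unfolding nbe using n0 m0 mn by (simp add: field_simps)
  have nb_ge: "real m \<le> nb" unfolding nbe using n0 m0 mn by (simp add: field_simps)
  have "nb / 2 = real n * real m / (real n + real m)"
    unfolding nbe by (rule nonzero_mult_div_cancel_left) simp
  then have r_eq: "r = sqrt (nb / 2)" by (simp only: r_def)
  have r0: "r > 0" unfolding r_eq using nb0 by simp
  have sn: "sqrt n > 0" using n0 by simp
  have ld: "ln d > 0" using d2 by simp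
  have sld: "sqrt (ln d) > 0" using ld by simp
  have y2: "sqrt (2 * ln d) = 2 * y"
  proof -
    have "2 * ln (real d) = 2\<^sup>2 * (ln d / 2)" by simp
    then show ?thesis unfolding y_def by (simp only: real_sqrt_mult real_sqrt_abs abs_numeral)
  qed
  have y0: "y > 0" using ld by (simp add: y_def)
  have B0: "B > 0" using B_ge_2 by simp
  have w0: "w \<ge> 0" using L_bounds B0 by (simp add: w_def)
  have Q0: "Q \<ge> 0" by (cases b) (auto simp: psi_bd2_def)
  have q0: "q \<ge> 0" using Q0 by (simp add: q_def)
  show ?thesis
  proof (cases "B * T \<le> \<delta>")
    case True
    define \<tau> where "\<tau> = Max ((\<lambda>k. \<bar>\<theta> k\<bar>) ` {1..d})"
    have "\<tau> \<in> (\<lambda>k. \<bar>\<theta> k\<bar>) ` {1..d}" unfolding \<tau>_def using d by (intro Max_in) auto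
    then obtain k where k: "k \<in> {1..d}" "\<tau> = \<bar>\<theta> k\<bar>" by auto
    have le: "\<bar>\<theta> j\<bar> \<le> \<tau>" if "j \<in> {1..d}" for j unfolding \<tau>_def using that by (intro Max_ge) auto
    have \<tau>e: "\<tau> = lam * sqrt (ln d / nb)" using max by (simp add: \<tau>_def nb_def)
    have \<tau>0: "\<tau> > 0" unfolding \<tau>e using \<epsilon> ld nb0 by simp
    have rt: "r * \<tau> = lam * y"
    proof -
      have "sqrt (nb / 2) * sqrt (ln d / nb) = sqrt (ln d / 2)"
        using nb0 by (simp flip: real_sqrt_mult)
      then show ?thesis unfolding r_eq \<tau>e y_def by simp
    qed
    \<comment> \<open>A lower bound on the signal, from nbar \<le> n and lam \<ge> 1. It is what
      turns deviations of order 1 / sqrt n into failure terms of order 1 / sqrt (ln d).\<close>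
    have tn: "sqrt (ln d) \<le> \<tau> * sqrt n"
    proof -
      have "sqrt (ln d) = 1 * sqrt (ln d / n) * sqrt n" using n0 by (simp add: real_sqrt_divide)
      also have "\<dots> \<le> lam * sqrt (ln d / nb) * sqrt n"
        using \<epsilon> ld nb0 nb_le n0
        by (intro mult_right_mono mult_mono real_sqrt_le_mono divide_left_mono) auto
      finally show ?thesis by (simp add: \<tau>e)
    qed
    have ek: "(1 - 2 * \<delta>) * \<tau> \<le> \<bar>e k\<bar>"
      unfolding k(2) using True \<delta> k le by (intro e_small_theta) auto
    \<comment> \<open>Of the loss 3 \<delta>, 2 \<delta> comes from expanding the density and
      \<delta> is the slack left to the random deviation.\<close>
    have cr: "crit \<alpha> d \<le> r * (\<bar>e k\<bar> - \<delta> * \<tau>)"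
    proof -
      have "crit \<alpha> d \<le> (1 + \<epsilon>/4) * (2 * y)" using crit y2 by simp
      also have "\<dots> \<le> (1 - 3 * \<delta>) * (1 + \<epsilon>/2) * (2 * y)" using \<delta> y0 by (intro mult_right_mono) auto
      also have "\<dots> = ((1 - 3 * \<delta>) * y) * (2 + \<epsilon>)" by (simp add: algebra_simps)
      also have "\<dots> \<le> ((1 - 3 * \<delta>) * y) * lam" using \<delta> y0 \<epsilon> by (intro mult_left_mono) auto
      also have "\<dots> = (1 - 3 * \<delta>) * (r * \<tau>)" unfolding rt by simp
      also have "\<dots> = r * ((1 - 2 * \<delta>) * \<tau> - \<delta> * \<tau>)" by (simp add: algebra_simps)
      also have "\<dots> \<le> r * (\<bar>e k\<bar> - \<delta> * \<tau>)" using ek r0 by (intro mult_left_mono) auto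
      finally show ?thesis .
    qed
    define x where "x = L * (2 * (B * T))"
    define E0 where "E0 = sqrt ((4 + 2 * L\<^sup>2 / n) / m) + sqrt ((2 + 2 * x\<^sup>2) / n) + Q / n"
    have x0: "x \<ge> 0" using L_bounds B0 T_nonneg by (simp add: x_def)
    have xle: "2 * x \<le> 4 * (L * B * d) * \<tau>"
    proof -
      have "T \<le> (\<Sum>k=1..d. \<tau>)" unfolding T_def by (intro sum_mono le)
      then have "T \<le> d * \<tau>" by simp
      then have "L * (2 * (B * T)) \<le> L * (2 * (B * (d * \<tau>)))"
        using L_bounds B0 by (intro mult_left_mono) auto
      then show ?thesis by (simp add: x_def mult_ac)
    qed
    \<comment> \<open>From B d \<ge> 1 and w \<le> 1 it follows that L \<le> sqrt n, so the
      numerator is at most 6.\<close>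
    have h1: "sqrt ((4 + 2 * L\<^sup>2 / n) / m) \<le> sqrt (6 / c0) / sqrt n"
    proof -
      have "1 * L \<le> B * d * L"
      proof (rule mult_right_mono)
        have "1 * 1 \<le> B * real d" using B_ge_2 d by (intro mult_mono) auto
        then show "1 \<le> B * real d" by simp
      qed (rule L_bounds)
      then have "L \<le> w * sqrt n" using sn by (simp add: w_def mult_ac)
      also have "\<dots> \<le> 1 * sqrt n" using w sn by (intro mult_right_mono) auto
      finally have "L\<^sup>2 \<le> (sqrt n)\<^sup>2" using L_bounds by (intro power_mono) auto
      then have "L\<^sup>2 / n \<le> 1" using n0 by simp
      then have "4 + 2 * L\<^sup>2 / n \<le> 6" by linarith
      then have "(4 + 2 * L\<^sup>2 / n) / m \<le> 6 / (c0 * n)"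
        by (rule frac_le[rotated]) (use c0 n0 in auto)
      then have "sqrt ((4 + 2 * L\<^sup>2 / n) / m) \<le> sqrt (6 / (c0 * n))" by simp
      then show ?thesis by (simp add: real_sqrt_divide real_sqrt_mult)
    qed
    have h2: "sqrt ((2 + 2 * x\<^sup>2) / n) \<le> (2 + 2 * x) / sqrt n"
    proof -
      have "sqrt (2 + 2 * x\<^sup>2) \<le> 2 + 2 * x"
        using x0 by (intro real_le_lsqrt) (auto simp: power2_eq_square algebra_simps)
      then show ?thesis unfolding real_sqrt_divide by (intro divide_right_mono) auto
    qed
    have h3: "Q / n = q / sqrt n"
      using n0 by (simp add: q_def)
    have E1: "E0 \<le> (sqrt (6 / c0) + 2 + q + 4 * (L * B * d) * \<tau>) / sqrt n"
    proof -
      have "E0 \<le> sqrt (6 / c0) / sqrt n + (2 + 2 * x) / sqrt n + q / sqrt n"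
        unfolding E0_def using h1 h2 h3 by linarith
      also have "\<dots> = (sqrt (6 / c0) + 2 + q + 2 * x) / sqrt n" by (simp add: add_divide_distrib)
      also have "\<dots> \<le> (sqrt (6 / c0) + 2 + q + 4 * (L * B * d) * \<tau>) / sqrt n"
        using xle by (intro divide_right_mono) auto
      finally show ?thesis .
    qed
    have "1 - E0 / (\<delta> * \<tau>) \<le> measure (PX \<Otimes>\<^sub>M PY) (rejects \<alpha>)"
    proof (rule rejection_probability[OF k(1)])
      show "\<delta> * \<tau> > 0" using \<delta> \<tau>0 by simp
      show "crit \<alpha> d \<le> sqrt (real n * real m / (real n + real m)) * (\<bar>e k\<bar> - \<delta> * \<tau>)"
        using cr by (simp add: r_def)
      have "B * T \<le> 1/4" using True \<delta> by linarith
      from deviation_fine[OF k(1) this]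
      show "(\<integral>p. \<bar>stat (psi b k) (fst p) (snd p) - pop_mean (psi b k)\<bar> \<partial>(PX \<Otimes>\<^sub>M PY)) \<le> E0"
        unfolding E0_def x_def .
    qed
    moreover have "E0 / (\<delta> * \<tau>) \<le> ((sqrt (6 / c0) + 2 + q) / sqrt (ln d) + 4 * w) / \<delta>"
    proof -
      define A where "A = sqrt (6 / c0) + 2 + q"
      have A0: "A \<ge> 0" using q0 c0 by (simp add: A_def)
      have "E0 / (\<delta> * \<tau>) \<le> ((A + 4 * (L * B * d) * \<tau>) / sqrt n) / (\<delta> * \<tau>)"
        using E1 \<delta> \<tau>0 unfolding A_def by (intro divide_right_mono) auto
      also have "\<dots> = (A / (\<tau> * sqrt n) + 4 * w) / \<delta>"
        using \<tau>0 \<delta> sn by (simp add: w_def field_simps)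
      also have "\<dots> \<le> (A / sqrt (ln d) + 4 * w) / \<delta>"
        using A0 sld tn \<delta> \<tau>0 sn by (intro divide_right_mono add_right_mono divide_left_mono) auto
      finally show ?thesis by (simp add: A_def)
    qed
    moreover have "4 * (1 / sqrt c0 + 1) * w / \<delta> \<ge> 0" using c0 w0 \<delta> by simp
    ultimately show ?thesis by linarith
  next
    case False
    then obtain k where k: "k \<in> {1..d}" "\<delta> / (2 * B * d) \<le> \<bar>e k\<bar>"
      using e_large_theta[of \<delta>] \<delta> by auto
    \<comment> \<open>Half of the guaranteed size of |e_k|: one half covers the critical value, the
      other the deviation.\<close>
    define s where "s = \<delta> / (4 * B * d)"
    have d0: "real d > 0" using d by simp
    have s0: "s > 0" using \<delta> B0 d0 by (simp add: s_def)
    have es: "s \<le> \<bar>e k\<bar> - s" using k(2) by (simp add: s_def field_simps)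
    have cr: "crit \<alpha> d \<le> r * (\<bar>e k\<bar> - s)"
    proof -
      \<comment> \<open>The 8 collects the 4 in \<open>s\<close>, a sqrt 2 from the critical value
        and a sqrt 2 from r \<ge> sqrt (c0 n / 2).\<close>
      have "w * (8 * (1 + \<epsilon>/4)) * sqrt n \<le> sqrt c0 * \<delta> * sqrt n"
        using w(2) sn by (intro mult_right_mono) auto
      then have main: "8 * (1 + \<epsilon>/4) * L * (B * d) \<le> sqrt c0 * sqrt n * \<delta>"
        using sn by (simp add: w_def mult_ac)
      have "crit \<alpha> d \<le> (1 + \<epsilon>/4) * (sqrt 2 * sqrt (ln d))" using crit by (simp add: real_sqrt_mult)
      also have "\<dots> \<le> (1 + \<epsilon>/4) * (sqrt 2 * L)" using \<epsilon> L_bounds by (intro mult_left_mono) auto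
      also have "\<dots> = (8 * (1 + \<epsilon>/4) * L * (B * d)) * (sqrt 2 / (8 * (B * d)))"
        using B0 d0 by simp
      also have "\<dots> \<le> (sqrt c0 * sqrt n * \<delta>) * (sqrt 2 / (8 * (B * d)))"
        using main B0 d0 by (intro mult_right_mono) auto
      also have "\<dots> = (sqrt c0 * sqrt n / sqrt 2) * s"
        using B0 d0 by (simp add: s_def field_simps)
      also have "\<dots> \<le> r * s"
      proof (rule mult_right_mono)
        have "sqrt (c0 * n / 2) \<le> r" unfolding r_eq using c0(2) nb_ge by (intro real_sqrt_le_mono) auto
        then show "sqrt c0 * sqrt n / sqrt 2 \<le> r" by (simp add: real_sqrt_mult real_sqrt_divide)
      qed (use s0 in auto)
      also have "\<dots> \<le> r * (\<bar>e k\<bar> - s)" using es r0 by (intro mult_left_mono) auto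
      finally show ?thesis .
    qed
    define E0 where "E0 = B / sqrt m + L / sqrt n"
    have "1 - E0 / s \<le> measure (PX \<Otimes>\<^sub>M PY) (rejects \<alpha>)"
      using cr s0 deviation_crude[OF k(1)] unfolding E0_def r_def
      by (intro rejection_probability[OF k(1)])
    moreover have "E0 / s \<le> 4 * (1 / sqrt c0 + 1) * w / \<delta>"
    proof -
      have "B / sqrt m \<le> L / (sqrt c0 * sqrt n)"
      proof (rule frac_le)
        have "sqrt (c0 * n) \<le> sqrt m" using c0(2) by simp
        then show "sqrt c0 * sqrt n \<le> sqrt m" by (simp add: real_sqrt_mult)
      qed (use L_bounds c0 n0 in auto)
      then have "E0 \<le> (1 / sqrt c0 + 1) * L / sqrt n"
        unfolding E0_def by (simp add: add_divide_distrib distrib_right)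
      then have "E0 / s \<le> ((1 / sqrt c0 + 1) * L / sqrt n) / s" using s0 by (intro divide_right_mono) auto
      also have "\<dots> = 4 * (1 / sqrt c0 + 1) * w / \<delta>" by (simp add: s_def w_def mult_ac)
      finally show ?thesis .
    qed
    moreover have "((sqrt (6 / c0) + 2 + q) / sqrt (ln d) + 4 * w) / \<delta> \<ge> 0"
      using q0 w0 c0 \<delta> ld by (intro divide_nonneg_nonneg add_nonneg_nonneg) auto
    ultimately show ?thesis by linarith
  qed
qed

end

text \<open>Put x = d / n^g with g the growth exponent. In the trigonometric case both quotients are
  multiples of x^2; in the Legendre case the second one is 8 x^(9/2), and it dominates the first
  because L B d = 8 d^4.\<close>

lemma growth_bounds:
  fixes d :: "nat \<Rightarrow> nat"
  assumes d1: "\<And>n. d n \<ge> 1"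
    and x: "(\<lambda>n. real (d n) / real n powr growth_exp b) \<longlonglongrightarrow> 0"
  shows "(\<lambda>n. psi_bd1 b (d n) * psi_bd b (d n) * d n / sqrt n) \<longlonglongrightarrow> 0"
    and "(\<lambda>n. psi_bd2 b (d n) / sqrt n) \<longlonglongrightarrow> 0"
proof -
  define g where "g = growth_exp b"
  let ?x = "\<lambda>n. real (d n) / real n powr g"
  have x': "?x \<longlonglongrightarrow> 0" using x by (simp add: g_def)
  have ev: "eventually (\<lambda>n::nat. n \<ge> 1) sequentially" by (rule eventually_ge_at_top)
  have "(\<lambda>n. psi_bd1 b (d n) * psi_bd b (d n) * d n / sqrt n) \<longlonglongrightarrow> 0
      \<and> (\<lambda>n. psi_bd2 b (d n) / sqrt n) \<longlonglongrightarrow> 0"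
  proof (cases b)
    case Trig
    have sq: "(?x n)\<^sup>2 = (real (d n))\<^sup>2 / sqrt n" for n
      using Trig by (simp add: g_def growth_exp_def power_divide powr_half_sqrt [symmetric]
          power2_eq_square[of "_ powr _"] flip: powr_add)
    have l: "(\<lambda>n. c * (?x n)\<^sup>2) \<longlonglongrightarrow> 0" for c
      using tendsto_mult[OF tendsto_const[of c] tendsto_power[OF x', of 2]] by simp
    show ?thesis using l[of 16] l[of 32] unfolding sq
      by (simp add: Trig psi_bd_def psi_bd1_def psi_bd2_def power2_eq_square mult_ac)
  next
    case Legendre
    have sq: "(?x n)^4 * sqrt (?x n) = real (d n) ^ 4 * sqrt (d n) / sqrt n" if "n \<ge> 1" for n
    proof -
      have "(real n powr g)^4 * sqrt (real n powr g) = real n powr (g * 4) * real n powr (g / 2)"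
        using that by (simp add: powr_power powr_half_sqrt [symmetric] powr_powr mult.commute)
      also have "\<dots> = sqrt n"
        using that Legendre by (simp add: g_def growth_exp_def powr_half_sqrt [symmetric] flip: powr_add)
      finally show ?thesis by (simp add: power_divide real_sqrt_divide)
    qed
    have "(\<lambda>n. 8 * ((?x n)^4 * sqrt (?x n))) \<longlonglongrightarrow> 8 * (0 ^ 4 * sqrt 0)"
      by (intro tendsto_intros x')
    then have "(\<lambda>n. 8 * ((?x n)^4 * sqrt (?x n))) \<longlonglongrightarrow> 0" by simp
    then have q: "(\<lambda>n. psi_bd2 b (d n) / sqrt n) \<longlonglongrightarrow> 0"
      by (rule Lim_transform_eventually)
         (use ev in eventually_elim, simp add: sq Legendre psi_bd2_def)
    moreover have "(\<lambda>n. psi_bd1 b (d n) * psi_bd b (d n) * d n / sqrt n) \<longlonglongrightarrow> 0"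
    proof (rule tendsto_sandwich[OF _ _ tendsto_const q])
      show "eventually (\<lambda>n. 0 \<le> psi_bd1 b (d n) * psi_bd b (d n) * d n / sqrt n) sequentially"
        by (simp add: Legendre psi_bd_def psi_bd1_def)
      show "eventually (\<lambda>n. psi_bd1 b (d n) * psi_bd b (d n) * d n / sqrt n \<le> psi_bd2 b (d n) / sqrt n) sequentially"
      proof (intro always_eventually allI divide_right_mono)
        fix n
        have "psi_bd1 b (d n) * psi_bd b (d n) * d n = 8 * real (d n) ^ 4 * 1"
          by (simp add: Legendre psi_bd_def psi_bd1_def power2_eq_square power4_eq_xxxx)
        also have "\<dots> \<le> 8 * real (d n) ^ 4 * sqrt (d n)"
          using d1[of n] by (intro mult_left_mono) auto
        finally show "psi_bd1 b (d n) * psi_bd b (d n) * d n \<le> psi_bd2 b (d n)"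
          by (simp add: Legendre psi_bd2_def)
      qed simp
    qed
    ultimately show ?thesis by simp
  qed
  then show "(\<lambda>n. psi_bd1 b (d n) * psi_bd b (d n) * d n / sqrt n) \<longlonglongrightarrow> 0"
    "(\<lambda>n. psi_bd2 b (d n) / sqrt n) \<longlonglongrightarrow> 0" by auto
qed


text \<open>\<open>\<nu>\<close>, \<open>\<theta>\<close> and \<open>lam\<close> are indexed by
  \<open>n\<close> because the alternative changes with \<open>d n\<close>. The product measures
  express independence within and between the samples.\<close>

theorem theorem2:
  fixes b :: basis
    and \<mu> :: "real measure"
    and \<nu> :: "nat \<Rightarrow> real measure"
    and m d :: "nat \<Rightarrow> nat"
    and \<theta> :: "nat \<Rightarrow> nat \<Rightarrow> real"
    and lam :: "nat \<Rightarrow> real"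
    and c0 \<alpha> \<epsilon> :: real
  assumes "prob_space \<mu>" and "sets \<mu> = sets borel" and "absolutely_continuous lborel \<mu>"
    and "\<And>n. prob_space (\<nu> n)" and "\<And>n. sets (\<nu> n) = sets borel"
    and "\<And>n. absolutely_continuous lborel (\<nu> n)"
    and "0 < c0" and "c0 \<le> 1"
    and "\<And>n. c0 * real n \<le> real (m n) \<and> m n \<le> n"
    and "\<And>n. d n \<ge> 1"
    and "filterlim d at_top sequentially"
    and "(\<lambda>n. real (d n) / real n powr growth_exp b) \<longlonglongrightarrow> 0"
    and "0 < \<alpha>" and "\<alpha> < 1" and "0 < \<epsilon>"
    and "\<And>n. lam n \<ge> 2 + \<epsilon>"
    and "\<And>n. Max ((\<lambda>k. \<bar>\<theta> n k\<bar>) ` {1..d n}) = lam n * sqrt (ln (real (d n)) / nbar n (m n))"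
    and "\<And>n. distr (\<nu> n) borel (cdf \<mu>) =
               density lborel (\<lambda>z. indicator {0<..<1} z * ennreal (rho b (d n) (\<theta> n) z))"
  shows "(\<lambda>n. measure (PiM {1..n} (\<lambda>_. \<mu>) \<Otimes>\<^sub>M PiM {1..m n} (\<lambda>_. \<nu> n))
            {\<omega> \<in> space (PiM {1..n} (\<lambda>_. \<mu>) \<Otimes>\<^sub>M PiM {1..m n} (\<lambda>_. \<nu> n)).
               test_S b \<alpha> n (m n) (d n) (fst \<omega>) (snd \<omega>) = 1})
         \<longlonglongrightarrow> 1"
proof -
  note \<mu> = assms(1-3) and \<nu> = assms(4-6) and c0 = assms(7) and mn = assms(9) and d1 = assms(10)
    and d_lim = assms(11) and growth = assms(12) and \<alpha> = assms(13,14) and \<epsilon> = assms(15)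
    and lam = assms(16) and max = assms(17) and dens = assms(18)
  define w where "w n = psi_bd1 b (d n) * psi_bd b (d n) * d n / sqrt n" for n
  define q where "q n = psi_bd2 b (d n) / sqrt n" for n
  have w_lim: "w \<longlonglongrightarrow> 0" and q_lim: "q \<longlonglongrightarrow> 0"
    using growth_bounds[OF d1 growth] by (simp_all add: w_def[abs_def] q_def[abs_def])
  \<comment> \<open>The second entry solves 3 \<delta> (1 + \<epsilon>/2) \<le> \<epsilon>/4, which
    leaves a margin between 1 + \<epsilon>/2 and the critical constant 1 + \<epsilon>/4.\<close>
  define \<delta> where "\<delta> = min (1/4) (\<epsilon> / (12 + 6 * \<epsilon>))"
  have \<delta>: "0 < \<delta>" "\<delta> \<le> 1/4" using \<epsilon> by (auto simp: \<delta>_def)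
  have \<delta>3: "1 + \<epsilon>/4 \<le> (1 - 3 * \<delta>) * (1 + \<epsilon>/2)"
  proof -
    have "\<delta> * (12 + 6 * \<epsilon>) \<le> \<epsilon> / (12 + 6 * \<epsilon>) * (12 + 6 * \<epsilon>)"
      unfolding \<delta>_def using \<epsilon> by (intro mult_right_mono) auto
    then have "\<delta> * (12 + 6 * \<epsilon>) \<le> \<epsilon>" using \<epsilon> by simp
    then show ?thesis by (simp add: algebra_simps)
  qed
  \<comment> \<open>The failure bound of \<open>power_lower_bound\<close>. It vanishes since
    \<open>w\<close> tends to 0 and a convergent numerator is divided by sqrt (ln d), which tends to
    infinity.\<close>
  define fail where "fail n = ((sqrt (6 / c0) + 2 + q n) / sqrt (ln (d n)) + 4 * w n) / \<delta>
      + 4 * (1 / sqrt c0 + 1) * w n / \<delta>" for n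
  have ln_lim: "filterlim (\<lambda>n. sqrt (ln (real (d n)))) at_top sequentially"
    by (intro filterlim_compose[OF sqrt_at_top] filterlim_compose[OF ln_at_top]
        filterlim_compose[OF filterlim_real_sequentially] d_lim)
  have "(\<lambda>n. (sqrt (6 / c0) + 2 + q n) / sqrt (ln (real (d n)))) \<longlonglongrightarrow> 0"
    by (rule tendsto_divide_0[OF tendsto_add[OF tendsto_const q_lim]])
       (rule filterlim_at_top_imp_at_infinity[OF ln_lim])
  then have "fail \<longlonglongrightarrow> (0 + 4 * 0) / \<delta> + 4 * (1 / sqrt c0 + 1) * 0 / \<delta>"
    unfolding fail_def using \<delta> by (intro tendsto_intros w_lim) auto
  then have fail_lim: "(\<lambda>n. 1 - fail n) \<longlonglongrightarrow> 1"
    using tendsto_diff[OF tendsto_const[of "1::real"], of fail 0] by simp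
  interpret \<mu>: real_distribution \<mu>
    using \<mu> by (auto simp: real_distribution_def real_distribution_axioms_def)
  let ?P = "\<lambda>n. PiM {1..n} (\<lambda>_. \<mu>) \<Otimes>\<^sub>M PiM {1..m n} (\<lambda>_. \<nu> n)"
  let ?R = "\<lambda>n. {\<omega> \<in> space (?P n). test_S b \<alpha> n (m n) (d n) (fst \<omega>) (snd \<omega>) = 1}"
  have e1: "eventually (\<lambda>n. crit \<alpha> (d n) \<le> (1 + \<epsilon>/4) * sqrt (2 * ln (real (d n)))) sequentially"
    using \<alpha> \<epsilon> by (intro eventually_compose_filterlim[OF crit_upper_bound d_lim]) auto
  have e2: "eventually (\<lambda>n. d n \<ge> 2) sequentially"
    using d_lim by (simp add: filterlim_at_top)
  have e3: "eventually (\<lambda>n. w n < 1) sequentially"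
    using w_lim by (rule order_tendstoD(2)) simp
  have e4: "eventually (\<lambda>n. w n < sqrt c0 * \<delta> / (8 * (1 + \<epsilon>/4))) sequentially"
    using w_lim by (rule order_tendstoD(2)) (use c0 \<delta> \<epsilon> in auto)
  have e5: "eventually (\<lambda>n::nat. n \<ge> 1) sequentially" by (rule eventually_ge_at_top)
  have lower: "eventually (\<lambda>n. 1 - fail n \<le> measure (?P n) (?R n)) sequentially"
    using e1 e2 e3 e4 e5
  proof eventually_elim
    case (elim n)
    \<comment> \<open>The second sample is nonempty only through c0 n \<le> m and n \<ge> 1, one
      reason why the lower bound is claimed eventually.\<close>
    have m1: "m n \<ge> 1"
    proof -
      have "0 < c0 * real n" using c0 elim(5) by simp
      then have "0 < real (m n)" using mn[of n] by linarith
      then show ?thesis by simp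
    qed
    interpret \<nu>: real_distribution "\<nu> n"
      using \<nu> by (auto simp: real_distribution_def real_distribution_axioms_def)
    interpret ef: exp_family b "d n" "\<theta> n" by unfold_locales (rule d1)
    interpret smooth_test \<mu> "\<nu> n" n "m n" b "d n" "\<theta> n"
    proof unfold_locales
      show "isCont (cdf \<mu>) x" for x by (rule \<mu>.isCont_cdf_absolutely_continuous[OF \<mu>(3)])
    qed (use elim m1 dens ef.rho_cont ef.rho_nonneg in auto)
    have "w n * (8 * (1 + \<epsilon>/4)) \<le> sqrt c0 * \<delta>"
      using elim(4) \<epsilon> by (simp add: pos_less_divide_eq)
    then have "1 - fail n \<le> measure (?P n) (rejects \<alpha>)"
      unfolding fail_def w_def q_def
      using elim mn[of n] c0 \<delta> \<delta>3 \<epsilon> lam max[of n]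
      by (intro power_lower_bound[where lam = "lam n" and \<epsilon> = \<epsilon>]) (auto simp: w_def)
    then show ?case by (simp add: rejects_def)
  qed
  have upper: "measure (?P n) (?R n) \<le> 1" for n
  proof -
    interpret \<nu>: prob_space "\<nu> n" by (rule \<nu>)
    interpret X: product_prob_space "\<lambda>_. \<mu>" "{1..n}" by unfold_locales
    interpret Y: product_prob_space "\<lambda>_. \<nu> n" "{1..m n}" by unfold_locales
    interpret pair_prob_space "PiM {1..n} (\<lambda>_. \<mu>)" "PiM {1..m n} (\<lambda>_. \<nu> n)" by unfold_locales
    show ?thesis by (rule P.prob_le_1)
  qed
  show ?thesis
    by (rule tendsto_sandwich[OF lower _ fail_lim tendsto_const]) (simp add: upper)
qed

end
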